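(* Let $X$ be an inner Kan space which admits initial and terminal degeneracies $s_0$ and $s_\omega$. Then for any vertex $x\in X_0$, the edge $s_0x\in X_1$ is an idempotent equivalence at $x$. In particular, $X$ is quasi-unital.
   Context: Let $\mathcal{S}$ be the $\infty$-category of spaces, $\Delta_s$ the category of the ordered sets $[n]$, $n\ge 0$, and injective order-preserving maps, and $ss\mathcal{S}=\mathrm{Fun}(\Delta_s^{op},\mathcal{S})$ the $\infty$-category of semi-simplicial spaces. $X_n=X([n])$; $\Delta^n_s$ is the representable semi-simplicial set, $\Lambda^n_{i,s}\subset\Delta^n_s$ the horn (union of all codimension-one faces containing the vertex $i$). We write $a\sim b$ if two points lie in the same connected component. $X$ is an inner Kan space if for all $0<i<n$ every map $\Lambda^n_{i,s}\to X$ extends up to homotopy to $\Delta^n_s$. An edge $f\in X_1$ is an equivalence if for all $n\geq 2$ every map $\Lambda^n_{0,s}\to X$ whose edge $\{0,1\}$ is homotopic to $f$ (in the same component of $X_1$), and every map $\Lambda^n_{n,s}\to X$ whose edge $\{n-1,n\}$ is homotopic to $f$, extends up to homotopy to $\Delta^n_s$. An edge $f$ is idempotent if $d_0f\sim d_1f$ in $X_0$ and there is $H\in X_2$ with $d_iH\sim f$ for $i=0,1,2$; it is an idempotent at $x$ if moreover its endpoints are homotopic to $x$. An idempotent equivalence is an edge that is both. An inner Kan space is quasi-unital if every vertex $x$ admits an idempotent equivalence at $x$. Let $\Delta_{s,a}$ be the category of ordered sets $[n]$, $n\ge-1$, with $[-1]=\emptyset$, and injective order-preserving maps, and $ss\mathcal{S}_a=\mathrm{Fun}(\Delta_{s,a}^{op},\mathcal{S})$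 the $\infty$-category of augmented semi-simplicial spaces. A semi-simplicial space is regarded as an augmented one with $X_{-1}=\ast$. Let $\star$ be the join (concatenation) of ordered sets, $[k]\star[n]=[k+n+1]$. For $k\ge0$ the free slices $X_{\Delta^k_s/}$ and $X_{/\Delta^k_s}$ are the augmented semi-simplicial spaces $$(X_{\Delta^k_s/})_n=X([k]\star[n])=X_{k+n+1},\qquad (X_{/\Delta^k_s})_n=X([n]\star[k])=X_{n+k+1}\qquad(n\ge-1),$$ functorial in $[n]$ and contravariantly functorial in $[k]\in\Delta_s$. For $i=0,1$, $d_i\colon X_{\Delta^1_s/}\to X_{\Delta^0_s/}$ and $d_i\colon X_{/\Delta^1_s}\to X_{/\Delta^0_s}$ denote restriction along the coface map $[0]\to[1]$ omitting $i$. $X$ admits initial and terminal degeneracies if there exist maps $s_0\colon X_{\Delta^0_s/}\to X_{\Delta^1_s/}$ and $s_\omega\colon X_{/\Delta^0_s}\to X_{/\Delta^1_s}$ of augmented semi-simplicial spaces, together with homotopies $d_i\circ s_0\simeq\mathrm{id}$ and $d_i\circ s_\omega\simeq\mathrm{id}$ for $i=0,1$ (in $ss\mathcal{S}_a$), such that for every vertex $x\in X_0$ the edges $s_0x$ and $s_\omega x$ (obtained by evaluating $s_0,s_\omega$ at $[-1]$, where they are maps $X_0\to X_1$) lie in the same component of $X_1$. *)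

theory Defs
  imports "HOL-Library.FuncSet"
begin

text \<open>
  The infinity-category of (augmented) semi-simplicial spaces is modelled by strict diagrams of Kan
  complexes. \<open>Delta_s\<close> is a direct category, so in the Reedy model structure on
  contravariant diagrams of simplicial sets every object is cofibrant, and the underlying
  infinity-category is that of the Reedy fibrant diagrams: every semi-simplicial space is represented
  by a Reedy fibrant one, a map in the infinity-category between Reedy fibrant diagrams (or from a
  semi-simplicial set to one) is represented by a strict natural transformation, and homotopies of
  such maps are represented by strict simplicial homotopies. The free slices of a Reedy fibrant
  diagram are again Reedy fibrant (as augmented diagrams), so this applies to them as well.
\<close>

section \<open>Index categories\<close>

text \<open>
  Objects are natural numbers \<open>n\<close>, standing for the ordered set \<open>I n\<close>. For \<open>Delta\<close> and
  \<open>Delta_s\<close> take \<open>I = atMost\<close>, so that \<open>n\<close> stands for \<open>[n]\<close>. For \<open>Delta_{s,a}\<close> take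
  \<open>I = lessThan\<close>, so that \<open>n\<close> stands for \<open>[n-1]\<close> and \<open>0\<close> stands for \<open>[-1]\<close>.
\<close>

definition id_map :: "(nat \<Rightarrow> nat set) \<Rightarrow> nat \<Rightarrow> nat \<Rightarrow> nat" where
  "id_map I n = (\<lambda>j\<in>I n. j)"

definition mono_maps :: "nat \<Rightarrow> nat \<Rightarrow> (nat \<Rightarrow> nat) set" where
  "mono_maps m n = {\<theta> \<in> {..m} \<rightarrow>\<^sub>E {..n}. mono_on {..m} \<theta>}"

definition inj_maps :: "(nat \<Rightarrow> nat set) \<Rightarrow> nat \<Rightarrow> nat \<Rightarrow> (nat \<Rightarrow> nat) set" where
  "inj_maps I m n = {\<mu> \<in> I m \<rightarrow>\<^sub>E I n. strict_mono_on (I m) \<mu>}"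

text \<open>The map \<open>[m] \<rightarrow> [m+1]\<close> omitting \<open>i\<close>.\<close>

definition coface :: "nat \<Rightarrow> nat \<Rightarrow> nat \<Rightarrow> nat" where
  "coface m i = (\<lambda>j\<in>{..m}. if j < i then j else Suc j)"

text \<open>
  Concatenation of \<open>\<theta> : {..<a} \<rightarrow> {..<a'}\<close> and \<open>\<phi> : {..<b} \<rightarrow> {..<b'}\<close>, a map
  \<open>{..<a+b} \<rightarrow> {..<a'+b'}\<close>. Here \<open>a, a', b\<close> are cardinalities, not the \<open>n\<close> of \<open>[n]\<close>.
\<close>

definition join_map :: "nat \<Rightarrow> nat \<Rightarrow> nat \<Rightarrow> (nat \<Rightarrow> nat) \<Rightarrow> (nat \<Rightarrow> nat) \<Rightarrow> nat \<Rightarrow> nat" where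
  "join_map a a' b \<theta> \<phi> = (\<lambda>j\<in>{..<a + b}. if j < a then \<theta> j else a' + \<phi> (j - a))"


section \<open>Simplicial sets and Kan fibrations\<close>

text \<open>For \<open>\<theta> : [m] \<rightarrow> [n]\<close>, the operator \<open>act S m n \<theta>\<close> maps \<open>cells S n\<close> to \<open>cells S m\<close>.\<close>

record 'a sset =
  cells :: "nat \<Rightarrow> 'a set"
  act :: "nat \<Rightarrow> nat \<Rightarrow> (nat \<Rightarrow> nat) \<Rightarrow> 'a \<Rightarrow> 'a"

definition simplicial_set :: "'a sset \<Rightarrow> bool" where
  "simplicial_set S \<longleftrightarrow>
    (\<forall>m n. \<forall>\<theta>\<in>mono_maps m n. act S m n \<theta> \<in> cells S n \<rightarrow> cells S m) \<and>
    (\<forall>n. \<forall>x\<in>cells S n. act S n n (id_map atMost n) x = x) \<and>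
    (\<forall>l m n. \<forall>\<phi>\<in>mono_maps l m. \<forall>\<theta>\<in>mono_maps m n. \<forall>x\<in>cells S n.
       act S l n (compose {..l} \<theta> \<phi>) x = act S l m \<phi> (act S m n \<theta> x))"

definition simplicial_map :: "'a sset \<Rightarrow> 'b sset \<Rightarrow> (nat \<Rightarrow> 'a \<Rightarrow> 'b) \<Rightarrow> bool" where
  "simplicial_map S T f \<longleftrightarrow>
    (\<forall>n. f n \<in> cells S n \<rightarrow> cells T n) \<and>
    (\<forall>m n. \<forall>\<theta>\<in>mono_maps m n. \<forall>x\<in>cells S n. f m (act S m n \<theta> x) = act T m n \<theta> (f n x))"

definition std_simplex :: "nat \<Rightarrow> (nat \<Rightarrow> nat) sset" where
  "std_simplex n = \<lparr>cells = (\<lambda>p. mono_maps p n), act = (\<lambda>l m \<phi> \<theta>. compose {..l} \<theta> \<phi>)\<rparr>"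

definition std_horn :: "nat \<Rightarrow> nat \<Rightarrow> (nat \<Rightarrow> nat) sset" where
  "std_horn n k = (std_simplex n)
    \<lparr>cells := (\<lambda>p. {\<theta> \<in> mono_maps p n. \<exists>j\<le>n. j \<noteq> k \<and> j \<notin> \<theta> ` {..p}})\<rparr>"

definition kan_complex :: "'a sset \<Rightarrow> bool" where
  "kan_complex S \<longleftrightarrow> simplicial_set S \<and>
    (\<forall>n k h. 1 \<le> n \<longrightarrow> k \<le> n \<longrightarrow> simplicial_map (std_horn n k) S h \<longrightarrow>
      (\<exists>g. simplicial_map (std_simplex n) S g \<and>
           (\<forall>p. \<forall>\<theta>\<in>cells (std_horn n k) p. g p \<theta> = h p \<theta>)))"

definition kan_fibration :: "'a sset \<Rightarrow> 'b sset \<Rightarrow> (nat \<Rightarrow> 'a \<Rightarrow> 'b) \<Rightarrow> bool" where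
  "kan_fibration E B f \<longleftrightarrow> simplicial_map E B f \<and>
    (\<forall>n k h b. 1 \<le> n \<longrightarrow> k \<le> n \<longrightarrow>
      simplicial_map (std_horn n k) E h \<longrightarrow> simplicial_map (std_simplex n) B b \<longrightarrow>
      (\<forall>p. \<forall>\<theta>\<in>cells (std_horn n k) p. f p (h p \<theta>) = b p \<theta>) \<longrightarrow>
      (\<exists>g. simplicial_map (std_simplex n) E g \<and>
           (\<forall>p. \<forall>\<theta>\<in>cells (std_horn n k) p. g p \<theta> = h p \<theta>) \<and>
           (\<forall>p. \<forall>\<theta>\<in>cells (std_simplex n) p. f p (g p \<theta>) = b p \<theta>)))"

abbreviation points :: "'a sset \<Rightarrow> 'a set" where
  "points S \<equiv> cells S 0"

text \<open>The relation \<open>x \<sim> y\<close>: connected by a zigzag of 1-simplices.\<close>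

definition same_component :: "'a sset \<Rightarrow> 'a \<Rightarrow> 'a \<Rightarrow> bool" where
  "same_component S = equivclp (\<lambda>x y. \<exists>e\<in>cells S 1.
     act S 0 1 (\<lambda>_\<in>{..0}. 0) e = x \<and> act S 0 1 (\<lambda>_\<in>{..0}. 1) e = y)"


section \<open>Semi-simplicial spaces, plain and augmented\<close>

text \<open>For \<open>\<mu> : I m \<rightarrow> I n\<close>, the map of spaces \<open>Res X m n \<mu>\<close> goes from \<open>Lev X n\<close> to \<open>Lev X m\<close>.\<close>

record 'a diagram =
  Lev :: "nat \<Rightarrow> 'a sset"
  Res :: "nat \<Rightarrow> nat \<Rightarrow> (nat \<Rightarrow> nat) \<Rightarrow> nat \<Rightarrow> 'a \<Rightarrow> 'a"

definition space_presheaf :: "(nat \<Rightarrow> nat set) \<Rightarrow> 'a diagram \<Rightarrow> bool" where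
  "space_presheaf I X \<longleftrightarrow>
    (\<forall>n. kan_complex (Lev X n)) \<and>
    (\<forall>m n. \<forall>\<mu>\<in>inj_maps I m n. simplicial_map (Lev X n) (Lev X m) (Res X m n \<mu>)) \<and>
    (\<forall>n p. \<forall>x\<in>cells (Lev X n) p. Res X n n (id_map I n) p x = x) \<and>
    (\<forall>l m n p. \<forall>\<nu>\<in>inj_maps I l m. \<forall>\<mu>\<in>inj_maps I m n. \<forall>x\<in>cells (Lev X n) p.
       Res X l n (compose (I l) \<mu> \<nu>) p x = Res X l m \<nu> p (Res X m n \<mu> p x))"

definition presheaf_map ::
  "(nat \<Rightarrow> nat set) \<Rightarrow> 'a diagram \<Rightarrow> 'b diagram \<Rightarrow> (nat \<Rightarrow> nat \<Rightarrow> 'a \<Rightarrow> 'b) \<Rightarrow> bool" where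
  "presheaf_map I A B f \<longleftrightarrow>
    (\<forall>n. simplicial_map (Lev A n) (Lev B n) (f n)) \<and>
    (\<forall>m n p. \<forall>\<mu>\<in>inj_maps I m n. \<forall>a\<in>cells (Lev A n) p.
       f m p (Res A m n \<mu> p a) = Res B m n \<mu> p (f n p a))"

text \<open>The levelwise product with the simplicial interval.\<close>

definition times_interval :: "'a diagram \<Rightarrow> ('a \<times> (nat \<Rightarrow> nat)) diagram" where
  "times_interval A =
    \<lparr>Lev = (\<lambda>n. \<lparr>cells = (\<lambda>p. cells (Lev A n) p \<times> cells (std_simplex 1) p),
                 act = (\<lambda>l m \<phi>. map_prod (act (Lev A n) l m \<phi>) (act (std_simplex 1) l m \<phi>))\<rparr>),
     Res = (\<lambda>m n \<mu> p. map_prod (Res A m n \<mu> p) id)\<rparr>"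

text \<open>One homotopy suffices, as this is only used for Reedy fibrant \<open>B\<close>.\<close>

definition homotopic_maps ::
  "(nat \<Rightarrow> nat set) \<Rightarrow> 'a diagram \<Rightarrow> 'b diagram \<Rightarrow>
   (nat \<Rightarrow> nat \<Rightarrow> 'a \<Rightarrow> 'b) \<Rightarrow> (nat \<Rightarrow> nat \<Rightarrow> 'a \<Rightarrow> 'b) \<Rightarrow> bool" where
  "homotopic_maps I A B f g \<longleftrightarrow>
    (\<exists>H. presheaf_map I (times_interval A) B H \<and>
      (\<forall>n p. \<forall>a\<in>cells (Lev A n) p.
         H n p (a, \<lambda>_\<in>{..p}. 0) = f n p a \<and> H n p (a, \<lambda>_\<in>{..p}. 1) = g n p a))"


section \<open>Maps out of simplices, horns and boundaries\<close>

text \<open>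
  Subobjects of the representable \<open>Delta^n_s\<close> are given by their sets of \<open>m\<close>-simplices, which are
  maps \<open>[m] \<rightarrow> [n]\<close>; faces are given by precomposition.
\<close>

definition ss_simplex :: "nat \<Rightarrow> nat \<Rightarrow> (nat \<Rightarrow> nat) set" where
  "ss_simplex n m = inj_maps atMost m n"

definition ss_boundary :: "nat \<Rightarrow> nat \<Rightarrow> (nat \<Rightarrow> nat) set" where
  "ss_boundary n m = {\<mu> \<in> inj_maps atMost m n. \<exists>j\<le>n. j \<notin> \<mu> ` {..m}}"

definition ss_horn :: "nat \<Rightarrow> nat \<Rightarrow> nat \<Rightarrow> (nat \<Rightarrow> nat) set" where
  "ss_horn n i m = {\<mu> \<in> inj_maps atMost m n. \<exists>j\<le>n. j \<noteq> i \<and> j \<notin> \<mu> ` {..m}}"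

definition restrict_family ::
  "(nat \<Rightarrow> (nat \<Rightarrow> nat) set) \<Rightarrow> (nat \<Rightarrow> (nat \<Rightarrow> nat) \<Rightarrow> 'a) \<Rightarrow> nat \<Rightarrow> (nat \<Rightarrow> nat) \<Rightarrow> 'a" where
  "restrict_family K u = (\<lambda>m. restrict (u m) (K m))"

text \<open>
  The space of maps \<open>K \<rightarrow> X\<close>: a \<open>p\<close>-simplex is a natural family of \<open>p\<close>-simplices \<open>u m \<mu>\<close> of
  \<open>X_m\<close>, for \<open>\<mu>\<close> in \<open>K m\<close>, set to \<open>undefined\<close> outside of \<open>K\<close>.
\<close>

definition mapping_space ::
  "(nat \<Rightarrow> (nat \<Rightarrow> nat) set) \<Rightarrow> 'a diagram \<Rightarrow> (nat \<Rightarrow> (nat \<Rightarrow> nat) \<Rightarrow> 'a) sset" where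
  "mapping_space K X =
    \<lparr>cells = (\<lambda>p. {u. (\<forall>m. u m \<in> K m \<rightarrow>\<^sub>E cells (Lev X m) p) \<and>
        (\<forall>l m. \<forall>\<nu>\<in>inj_maps atMost l m. \<forall>\<mu>\<in>K m.
           u l (compose {..l} \<mu> \<nu>) = Res X l m \<nu> p (u m \<mu>))}),
     act = (\<lambda>p q \<theta> u. restrict_family K (\<lambda>m \<mu>. act (Lev X m) p q \<theta> (u m \<mu>)))\<rparr>"

text \<open>The matching map \<open>X_n \<rightarrow> Map(\<partial>Delta^n_s, X)\<close>.\<close>

definition matching_map :: "'a diagram \<Rightarrow> nat \<Rightarrow> nat \<Rightarrow> 'a \<Rightarrow> nat \<Rightarrow> (nat \<Rightarrow> nat) \<Rightarrow> 'a" where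
  "matching_map X n p x = restrict_family (ss_boundary n) (\<lambda>m \<mu>. Res X m n \<mu> p x)"

definition semi_simplicial_space :: "'a diagram \<Rightarrow> bool" where
  "semi_simplicial_space X \<longleftrightarrow> space_presheaf atMost X \<and>
    (\<forall>n. kan_fibration (Lev X n) (mapping_space (ss_boundary n) X) (matching_map X n))"

definition horn_extends ::
  "'a diagram \<Rightarrow> nat \<Rightarrow> nat \<Rightarrow> (nat \<Rightarrow> (nat \<Rightarrow> nat) \<Rightarrow> 'a) \<Rightarrow> bool" where
  "horn_extends X n i u \<longleftrightarrow>
    (\<exists>v\<in>points (mapping_space (ss_simplex n) X).
       same_component (mapping_space (ss_horn n i) X) (restrict_family (ss_horn n i) v) u)"


section \<open>Inner Kan spaces, equivalences and idempotents\<close>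

definition inner_Kan_space :: "'a diagram \<Rightarrow> bool" where
  "inner_Kan_space X \<longleftrightarrow> semi_simplicial_space X \<and>
    (\<forall>n i. 0 < i \<longrightarrow> i < n \<longrightarrow>
      (\<forall>u\<in>points (mapping_space (ss_horn n i) X). horn_extends X n i u))"

text \<open>
  The edges \<open>{0,1}\<close> and \<open>{n-1,n}\<close>, written here as maps \<open>[1] \<rightarrow> [n]\<close>, belong to the
  respective horns because \<open>n \<ge> 2\<close>.
\<close>

definition equivalence_edge :: "'a diagram \<Rightarrow> 'a \<Rightarrow> bool" where
  "equivalence_edge X f \<longleftrightarrow> f \<in> points (Lev X 1) \<and>
    (\<forall>n\<ge>2.
      (\<forall>u\<in>points (mapping_space (ss_horn n 0) X).
         same_component (Lev X 1) (u 1 (\<lambda>j\<in>{..1}. j)) f \<longrightarrow> horn_extends X n 0 u) \<and>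
      (\<forall>u\<in>points (mapping_space (ss_horn n n) X).
         same_component (Lev X 1) (u 1 (\<lambda>j\<in>{..1}. n - 1 + j)) f \<longrightarrow> horn_extends X n n u))"

text \<open>The face map \<open>d_i : X_{m+1} \<rightarrow> X_m\<close> on points.\<close>

definition face :: "'a diagram \<Rightarrow> nat \<Rightarrow> nat \<Rightarrow> 'a \<Rightarrow> 'a" where
  "face X m i = Res X m (Suc m) (coface m i) 0"

definition idempotent_edge :: "'a diagram \<Rightarrow> 'a \<Rightarrow> bool" where
  "idempotent_edge X f \<longleftrightarrow> f \<in> points (Lev X 1) \<and>
    same_component (Lev X 0) (face X 0 0 f) (face X 0 1 f) \<and>
    (\<exists>H\<in>points (Lev X 2). \<forall>i\<le>2. same_component (Lev X 1) (face X 1 i H) f)"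

definition idempotent_at :: "'a diagram \<Rightarrow> 'a \<Rightarrow> 'a \<Rightarrow> bool" where
  "idempotent_at X x f \<longleftrightarrow> idempotent_edge X f \<and>
    same_component (Lev X 0) (face X 0 0 f) x \<and> same_component (Lev X 0) (face X 0 1 f) x"

definition idempotent_equivalence_at :: "'a diagram \<Rightarrow> 'a \<Rightarrow> 'a \<Rightarrow> bool" where
  "idempotent_equivalence_at X x f \<longleftrightarrow> idempotent_at X x f \<and> equivalence_edge X f"

definition quasi_unital :: "'a diagram \<Rightarrow> bool" where
  "quasi_unital X \<longleftrightarrow> inner_Kan_space X \<and>
    (\<forall>x\<in>points (Lev X 0). \<exists>f. idempotent_equivalence_at X x f)"


section \<open>Free slices and degeneracies\<close>

text \<open>
  As augmented diagrams, the slices are indexed by \<open>I = lessThan\<close>: index \<open>n\<close> stands for \<open>[n-1]\<close>,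
  so the space at index \<open>n\<close> is \<open>X_{k+n}\<close>. Since \<open>k \<ge> 0\<close>, the value of \<open>X\<close> at \<open>[-1]\<close>
  never occurs.
\<close>

definition slice_under :: "'a diagram \<Rightarrow> nat \<Rightarrow> 'a diagram" where
  "slice_under X k =
    \<lparr>Lev = (\<lambda>n. Lev X (k + n)),
     Res = (\<lambda>m n \<mu>. Res X (k + m) (k + n) (join_map (Suc k) (Suc k) m (id_map atMost k) \<mu>))\<rparr>"

definition slice_over :: "'a diagram \<Rightarrow> nat \<Rightarrow> 'a diagram" where
  "slice_over X k =
    \<lparr>Lev = (\<lambda>n. Lev X (n + k)),
     Res = (\<lambda>m n \<mu>. Res X (m + k) (n + k) (join_map m n (Suc k) \<mu> (id_map atMost k)))\<rparr>"

text \<open>Contravariant functoriality of the slices in \<open>\<kappa> : [k] \<rightarrow> [k']\<close>.\<close>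

definition under_restriction ::
  "'a diagram \<Rightarrow> nat \<Rightarrow> nat \<Rightarrow> (nat \<Rightarrow> nat) \<Rightarrow> nat \<Rightarrow> nat \<Rightarrow> 'a \<Rightarrow> 'a" where
  "under_restriction X k k' \<kappa> n =
    Res X (k + n) (k' + n) (join_map (Suc k) (Suc k') n \<kappa> (id_map lessThan n))"

definition over_restriction ::
  "'a diagram \<Rightarrow> nat \<Rightarrow> nat \<Rightarrow> (nat \<Rightarrow> nat) \<Rightarrow> nat \<Rightarrow> nat \<Rightarrow> 'a \<Rightarrow> 'a" where
  "over_restriction X k k' \<kappa> n =
    Res X (n + k) (n + k') (join_map n n (Suc k) (id_map lessThan n) \<kappa>)"

definition initial_degeneracies :: "'a diagram \<Rightarrow> (nat \<Rightarrow> nat \<Rightarrow> 'a \<Rightarrow> 'a) \<Rightarrow> bool" where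
  "initial_degeneracies X s\<^sub>0 \<longleftrightarrow>
    presheaf_map lessThan (slice_under X 0) (slice_under X 1) s\<^sub>0 \<and>
    (\<forall>i\<le>1. homotopic_maps lessThan (slice_under X 0) (slice_under X 0)
       (\<lambda>n p x. under_restriction X 0 1 (coface 0 i) n p (s\<^sub>0 n p x)) (\<lambda>n p x. x))"

definition terminal_degeneracies :: "'a diagram \<Rightarrow> (nat \<Rightarrow> nat \<Rightarrow> 'a \<Rightarrow> 'a) \<Rightarrow> bool" where
  "terminal_degeneracies X s\<^sub>\<omega> \<longleftrightarrow>
    presheaf_map lessThan (slice_over X 0) (slice_over X 1) s\<^sub>\<omega> \<and>
    (\<forall>i\<le>1. homotopic_maps lessThan (slice_over X 0) (slice_over X 0)
       (\<lambda>n p x. over_restriction X 0 1 (coface 0 i) n p (s\<^sub>\<omega> n p x)) (\<lambda>n p x. x))"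

text \<open>
  The first argument \<open>0\<close> of \<open>s\<^sub>0\<close> and \<open>s\<^sub>\<omega>\<close> below is evaluation at \<open>[-1]\<close>, the second
  one is the simplicial degree.
\<close>

definition admits_degeneracies ::
  "'a diagram \<Rightarrow> (nat \<Rightarrow> nat \<Rightarrow> 'a \<Rightarrow> 'a) \<Rightarrow> (nat \<Rightarrow> nat \<Rightarrow> 'a \<Rightarrow> 'a) \<Rightarrow> bool" where
  "admits_degeneracies X s\<^sub>0 s\<^sub>\<omega> \<longleftrightarrow>
    initial_degeneracies X s\<^sub>0 \<and> terminal_degeneracies X s\<^sub>\<omega> \<and>
    (\<forall>x\<in>points (Lev X 0). same_component (Lev X 1) (s\<^sub>0 0 0 x) (s\<^sub>\<omega> 0 0 x))"

end

theory Submission imports Defs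
begin

text \<open>
  Since \<open>X\<close> is Reedy fibrant, all lifting problems can be solved strictly on points and paths of the
  levels, and \<open>s0\<close> can be deformed to a map \<open>s\<close> with \<open>d 1 s = id\<close>. The composite
  \<open>phi = d 0 s\<close> is only homotopic to the identity, but it preserves \<open>d 0\<close>, and \<open>phi (s a)\<close> is a
  2-simplex exhibiting the edge \<open>c = phi (s x)\<close> as a strict right unit for the edges in the image
  of \<open>phi\<close>. The edge \<open>c\<close> lies in the component of \<open>s0 x\<close>, and a horn with \<open>d 0\<close> missing is a cone
  with apex 0, on which the homotopy from \<open>phi\<close> to the identity is defined. So it suffices to fill
  such horns in the image of \<open>phi\<close> whose first edge is \<open>c\<close>.

  The slice of \<open>X\<close> over the boundary of a simplex is a right fibration over \<open>X\<close>, because \<open>X\<close> is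
  inner Kan, and so is the slice over the simplex itself. A horn as above is an edge \<open>f\<close> in the first
  slice with a lift of its source to the second one. In the first slice right inverses exist by
  lifting, the right units come from \<open>phi\<close> and \<open>s\<close>, and the group-theoretic argument that right inverses
  are left inverses gives \<open>r\<close> with \<open>r f = c\<close>. Right lifts along \<open>r\<close>, and then along \<open>f\<close>, fill the horn.
  Horns with \<open>d n\<close> missing are treated by reversing the order of the vertices.
\<close>

section \<open>Ranks and complexes of finite sets\<close>

text \<open>A horn with face 0 missing, on the vertices \<open>0..N\<close>, is the union of the
  join of \<open>{0, 1}\<close> with the boundary of the simplex on \<open>{2..N}\<close> and the
  join of \<open>{0}\<close> with that whole simplex. The first piece is the edge in the slice over
  the boundary, the second is the lift of its source. The obstacle is that a right fibration lifts
  an edge from a lift of its target, whereas here the source is given. The left inverse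
  \<open>r\<close> runs backwards and thereby exchanges the two ends. Its construction needs an edge
  of the form \<open>phi f\<close> whose target is itself \<open>phi\<close> of a vertex of the
  slice. Therefore \<open>phi\<close> is applied twice: on the cone with apex 1, which brings the
  target into the image of \<open>phi\<close>, and then on the cone with apex 0, which replaces
  \<open>f\<close> by \<open>phi f\<close>. The first application moves vertex 1 and drags the edge
  \<open>{0, 1}\<close> along; the edge can return to \<open>s x\<close> because the two homotopies
  involved, from \<open>d 0 s0\<close> to the identity and to \<open>phi\<close>, move a vertex
  along one and the same path.\<close>

definition rank :: "nat set \<Rightarrow> nat \<Rightarrow> nat" where
  "rank W a = card {v \<in> W. v < a}"

lemma rank_less_card:
  assumes "finite W" "a \<in> W"
  shows "rank W a < card W"
  unfolding rank_def by (rule psubset_card_mono) (use assms in auto)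

lemma rank_less:
  assumes "finite W" "a \<in> W" "a < b"
  shows "rank W a < rank W b"
  unfolding rank_def by (rule psubset_card_mono) (use assms in auto)

lemma rank_less_iff:
  assumes "finite W" "a \<in> W" "b \<in> W"
  shows "rank W a < rank W b \<longleftrightarrow> a < b"
  by (metis assms linorder_neqE_nat not_less_iff_gr_or_eq rank_less)

lemma rank_surj:
  assumes "finite W" "r < card W"
  shows "\<exists>a\<in>W. rank W a = r"
proof -
  have "inj_on (rank W) W"
    by (rule inj_onI) (metis assms(1) linorder_neqE_nat not_less_iff_gr_or_eq rank_less)
  moreover have "rank W ` W \<subseteq> {..<card W}"
    using assms(1) rank_less_card by auto
  ultimately have "rank W ` W = {..<card W}"
    by (metis card_image card_lessThan card_subset_eq finite_lessThan)
  then show ?thesis using assms(2) by (metis imageE lessThan_iff)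
qed

text \<open>Face operators are numbered by ranks, families are indexed by vertex sets;
  \<open>el\<close> turns a face number back into the vertex that it deletes.\<close>

lemma rank_enumeration:
  assumes "finite W"
  obtains el where "\<And>r. r < card W \<Longrightarrow> el r \<in> W \<and> rank W (el r) = r"
    "\<And>a. a \<in> W \<Longrightarrow> el (rank W a) = a"
proof -
  define el where "el r = (SOME a. a \<in> W \<and> rank W a = r)" for r
  have el: "el r \<in> W \<and> rank W (el r) = r" if "r < card W" for r
    unfolding el_def by (rule someI_ex) (use rank_surj[OF assms that] in auto)
  moreover have "el (rank W a) = a" if "a \<in> W" for a
    using el[of "rank W a"] rank_less_card[OF assms that] that rank_less[OF assms]
    by (metis linorder_neqE_nat nat_less_le)
  ultimately show thesis by (rule that)
qed

lemma rank_remove_ge: "a \<le> b \<Longrightarrow> rank (W - {b}) a = rank W a"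
  unfolding rank_def by (rule arg_cong[where f = card]) auto

lemma rank_remove_less:
  assumes "finite W" "a \<in> W" "a < b"
  shows "rank (W - {a}) b = rank W b - 1"
proof -
  have "{v \<in> W - {a}. v < b} = {v \<in> W. v < b} - {a}" by auto
  then show ?thesis unfolding rank_def using assms by simp
qed

lemma rank_insert_min:
  assumes "finite W" "v \<notin> W" "v < a"
  shows "rank (insert v W) a = Suc (rank W a)"
proof -
  have "{w \<in> insert v W. w < a} = insert v {w \<in> W. w < a}" using assms by auto
  then show ?thesis unfolding rank_def using assms by simp
qed

lemma rank_min:
  assumes "\<And>w. w \<in> W \<Longrightarrow> v \<le> w"
  shows "rank W v = 0"
proof -
  have "{w \<in> W. w < v} = {}" using assms leD by blast
  then show ?thesis unfolding rank_def by simp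
qed

text \<open>Abstract simplicial complexes. The empty face is required because an element of a slice
  stores there its underlying simplex in the base.\<close>

definition fin_complex :: "nat set set \<Rightarrow> bool" where
  "fin_complex J \<longleftrightarrow> finite J \<and> {} \<in> J \<and> (\<forall>W\<in>J. finite W \<and> (\<forall>V. V \<subseteq> W \<longrightarrow> V \<in> J))"

lemma fin_complexD:
  assumes "fin_complex J"
  shows "finite J" "{} \<in> J" "W \<in> J \<Longrightarrow> finite W" "W \<in> J \<Longrightarrow> V \<subseteq> W \<Longrightarrow> V \<in> J"
    "W \<in> J \<Longrightarrow> W - {a} \<in> J"
  using assms Diff_subset[of W "{a}"] unfolding fin_complex_def by metis+

text \<open>A missing face of least cardinality has all its proper faces in \<open>K\<close>. Both
  cell-by-cell inductions below, for horn filling and for homotopy extension, rest on this.\<close>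

lemma fin_complex_add_cell:
  assumes J: "fin_complex J" and K: "fin_complex K" and "K \<subset> J"
  obtains W where "W \<in> J - K" "W \<noteq> {}" "\<And>a. a \<in> W \<Longrightarrow> W - {a} \<in> K" "fin_complex (insert W K)"
proof -
  obtain V where "V \<in> J - K" using \<open>K \<subset> J\<close> by auto
  define W where "W = arg_min card (\<lambda>V. V \<in> J - K)"
  have W: "W \<in> J - K" unfolding W_def by (rule arg_min_natI, fact)
  have min: "card W \<le> card V" if "V \<in> J - K" for V
    unfolding W_def by (rule arg_min_nat_le, fact)
  have finW: "finite W" using W J fin_complexD(3) by blast
  have sub: "V \<in> K" if "V \<subset> W" for V
  proof (rule ccontr)
    assume "V \<notin> K"
    moreover have "V \<in> J" using W J fin_complexD(4) that by blast
    ultimately have "card W \<le> card V" using min by blast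
    then show False using psubset_card_mono[OF finW that] by linarith
  qed
  show thesis
  proof (rule that[OF W])
    show "W \<noteq> {}" using W K fin_complexD(2) by blast
    show "W - {a} \<in> K" if "a \<in> W" for a using that by (intro sub) auto
    show "fin_complex (insert W K)"
      using K sub finW unfolding fin_complex_def by (metis finite_insert insert_iff psubsetI)
  qed
qed

section \<open>Augmented semi-simplicial sets and their slices\<close>

text \<open>The index is the number of vertices, so that \<open>A n\<close> consists of the \<open>(n-1)\<close>-simplices and
  \<open>d n\<close> goes from \<open>A (n + 1)\<close> to \<open>A n\<close>.\<close>

locale face_set =
  fixes A :: "nat \<Rightarrow> 'a set" and d :: "nat \<Rightarrow> nat \<Rightarrow> 'a \<Rightarrow> 'a"
  assumes face_closed: "x \<in> A (Suc n) \<Longrightarrow> i \<le> n \<Longrightarrow> d n i x \<in> A n"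
    and face_face: "x \<in> A (Suc (Suc n)) \<Longrightarrow> i < j \<Longrightarrow> j \<le> Suc n \<Longrightarrow>
      d n i (d (Suc n) j x) = d n (j - 1) (d (Suc n) i x)"

text \<open>For \<open>J\<close> the faces of a complex \<open>K\<close>, the elements of \<open>slice A d J k\<close> are the maps from the join
  of the simplex with \<open>k\<close> vertices with \<open>K\<close>.\<close>

definition slice ::
  "(nat \<Rightarrow> 'a set) \<Rightarrow> (nat \<Rightarrow> nat \<Rightarrow> 'a \<Rightarrow> 'a) \<Rightarrow> nat set set \<Rightarrow> nat \<Rightarrow> (nat set \<Rightarrow> 'a) set" where
  "slice A d J k = {u \<in> extensional J. \<forall>W\<in>J. u W \<in> A (k + card W) \<and>
     (\<forall>a\<in>W. d (k + card (W - {a})) (k + rank W a) (u W) = u (W - {a}))}"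

definition slice_face ::
  "(nat \<Rightarrow> nat \<Rightarrow> 'a \<Rightarrow> 'a) \<Rightarrow> nat set set \<Rightarrow> nat \<Rightarrow> nat \<Rightarrow> (nat set \<Rightarrow> 'a) \<Rightarrow> nat set \<Rightarrow> 'a" where
  "slice_face d J k i u = (\<lambda>W\<in>J. d (k + card W) i (u W))"

abbreviation "fam A d J \<equiv> slice A d J 0"

lemma sliceI:
  assumes "u \<in> extensional J" "\<And>W. W \<in> J \<Longrightarrow> u W \<in> A (k + card W)"
    "\<And>W a. W \<in> J \<Longrightarrow> a \<in> W \<Longrightarrow> d (k + card (W - {a})) (k + rank W a) (u W) = u (W - {a})"
  shows "u \<in> slice A d J k"
  using assms unfolding slice_def by blast

lemma sliceD:
  assumes "u \<in> slice A d J k"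
  shows "u \<in> extensional J" "W \<in> J \<Longrightarrow> u W \<in> A (k + card W)"
    "W \<in> J \<Longrightarrow> a \<in> W \<Longrightarrow> d (k + card (W - {a})) (k + rank W a) (u W) = u (W - {a})"
  using assms unfolding slice_def by blast+

lemma slice_restrict:
  assumes u: "u \<in> slice A d J k" and "fin_complex K" "K \<subseteq> J"
  shows "restrict u K \<in> slice A d K k"
proof (rule sliceI)
  fix W a assume W: "W \<in> K" "a \<in> W"
  then have "W - {a} \<in> K" using assms fin_complexD(5) by blast
  then show "d (k + card (W - {a})) (k + rank W a) (restrict u K W) = restrict u K (W - {a})"
    using W sliceD(3)[OF u, of W a] assms(3) by auto
qed (use sliceD(2)[OF u] assms(3) in auto)

lemma slice_add_cell:
  assumes z: "z \<in> slice A d K k" and K: "fin_complex K" and W: "W \<notin> K"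
    and "c \<in> A (k + card W)"
    and sub: "\<And>a. a \<in> W \<Longrightarrow> W - {a} \<in> K"
    and "\<And>a. a \<in> W \<Longrightarrow> d (k + card (W - {a})) (k + rank W a) c = z (W - {a})"
  shows "z(W := c) \<in> slice A d (insert W K) k"
proof (rule sliceI)
  fix V a assume V: "V \<in> insert W K" "a \<in> V"
  then have "V - {a} \<in> K" using sub fin_complexD(5)[OF K] by blast
  then have "V - {a} \<noteq> W" using W by auto
  then show "d (k + card (V - {a})) (k + rank V a) ((z(W := c)) V) = (z(W := c)) (V - {a})"
    using V assms(6) sliceD(3)[OF z] by auto
qed (use sliceD(1,2)[OF z] assms(4) in \<open>auto simp: extensional_def\<close>)

lemma face_set_slice:
  assumes "face_set A d" and J: "fin_complex J"
  shows "face_set (slice A d J) (slice_face d J)"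
proof -
  interpret face_set A d by fact
  show ?thesis
  proof
    fix u k i assume u: "u \<in> slice A d J (Suc k)" and i: "i \<le> k"
    show "slice_face d J k i u \<in> slice A d J k"
    proof (rule sliceI)
      fix W assume W: "W \<in> J"
      then show "slice_face d J k i u W \<in> A (k + card W)"
        unfolding slice_face_def using sliceD(2)[OF u W] face_closed i by simp
      fix a assume a: "a \<in> W"
      have fin: "finite W" and Wa: "W - {a} \<in> J" using W fin_complexD[OF J] by auto
      have c: "card W = Suc (card (W - {a}))" using a fin by (metis card_Suc_Diff1)
      then have mem: "u W \<in> A (Suc (Suc (k + card (W - {a}))))" using sliceD(2)[OF u W] by simp
      have r: "rank W a \<le> card (W - {a})" using rank_less_card[OF fin a] c by simp
      have "d (k + card (W - {a})) (k + rank W a) (d (k + card W) i (u W))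
        = d (k + card (W - {a})) i (d (k + card W) (Suc k + rank W a) (u W))"
        using face_face[OF mem, of i "Suc k + rank W a"] i r c by simp
      also have "\<dots> = d (k + card (W - {a})) i (u (W - {a}))"
        using sliceD(3)[OF u W a] c by simp
      finally show "d (k + card (W - {a})) (k + rank W a) (slice_face d J k i u W)
          = slice_face d J k i u (W - {a})"
        unfolding slice_face_def using W Wa by simp
    qed (simp add: slice_face_def)
  next
    fix u k i j assume u: "u \<in> slice A d J (Suc (Suc k))" and ij: "i < j" "j \<le> Suc k"
    show "slice_face d J k i (slice_face d J (Suc k) j u)
        = slice_face d J k (j - 1) (slice_face d J (Suc k) i u)"
    proof
      fix W show "slice_face d J k i (slice_face d J (Suc k) j u) W
        = slice_face d J k (j - 1) (slice_face d J (Suc k) i u) W"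
        unfolding slice_face_def using face_face[of "u W" "k + card W" i j] ij sliceD(2)[OF u]
        by (cases "W \<in> J") auto
    qed
  qed
qed

text \<open>Both sides are the value at \<open>W - {a, b}\<close>, reached by deleting the two
  vertices in either order; only the rank of the larger vertex drops by one.\<close>

lemma slice_faces_compatible:
  assumes z: "z \<in> slice A d K k" and W: "finite W" "card W = Suc w" "W - {a} \<in> K" "W - {b} \<in> K"
    and ab: "a \<in> W" "b \<in> W" "a < b"
  shows "d (k + (w - 1)) (k + rank W a) (z (W - {b})) = d (k + (w - 1)) (k + (rank W b - 1)) (z (W - {a}))"
proof -
  have a: "a \<in> W - {b}" and b: "b \<in> W - {a}" using ab by auto
  have "card (W - {b} - {a}) = w - 1" "card (W - {a} - {b}) = w - 1"
    using a b W ab by auto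
  moreover have "W - {b} - {a} = W - {a} - {b}" by auto
  moreover have "rank (W - {b}) a = rank W a" using rank_remove_ge ab by simp
  moreover have "rank (W - {a}) b = rank W b - 1" using rank_remove_less W ab by simp
  ultimately show ?thesis
    using sliceD(3)[OF z W(4) a] sliceD(3)[OF z W(3) b] by simp
qed

lemma slice_face_restrict: "K \<subseteq> J \<Longrightarrow> slice_face d K k i (restrict u K) = restrict (slice_face d J k i u) K"
  unfolding slice_face_def by (auto simp: fun_eq_iff restrict_def)

section \<open>Filling horns in slices\<close>

text \<open>Elements of \<open>A (Suc (Suc n))\<close> have dimension \<open>Suc n\<close>, so
  \<open>0 < i\<close> and \<open>i \<le> n\<close> say that the missing face is an inner one. The
  fillers are strict.\<close>

locale inner_kan_set = face_set A d for A :: "nat \<Rightarrow> 'a set" and d +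
  assumes inner_fill: "0 < i \<Longrightarrow> i \<le> n \<Longrightarrow>
     (\<And>j. j \<le> Suc n \<Longrightarrow> j \<noteq> i \<Longrightarrow> y j \<in> A (Suc n)) \<Longrightarrow>
     (\<And>a b. a < b \<Longrightarrow> b \<le> Suc n \<Longrightarrow> a \<noteq> i \<Longrightarrow> b \<noteq> i \<Longrightarrow> d n a (y b) = d n (b - 1) (y a)) \<Longrightarrow>
     \<exists>z\<in>A (Suc (Suc n)). \<forall>j\<le>Suc n. j \<noteq> i \<longrightarrow> d (Suc n) j z = y j"
begin

text \<open>The simplex sought is the value at \<open>W\<close>, that is, on the join of a
  \<open>k\<close>-simplex with \<open>W\<close>. Apart from face \<open>i\<close>, its faces
  opposite to the first \<open>k + 1\<close> vertices come from \<open>y\<close> and those opposite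
  to the vertices of \<open>W\<close> from \<open>z\<close>.\<close>

lemma slice_fill_cell:
  assumes J: "fin_complex J" and K: "fin_complex K"
    and i: "0 < i" "i \<le> k" and z: "z \<in> slice A d K (Suc k)" and W: "W \<in> J" "W \<noteq> {}"
    and sub: "\<And>a. a \<in> W \<Longrightarrow> W - {a} \<in> K \<inter> J"
    and y: "\<And>j. j \<le> k \<Longrightarrow> j \<noteq> i \<Longrightarrow> y j \<in> slice A d J k"
    and comp: "\<And>a b. a < b \<Longrightarrow> b \<le> k \<Longrightarrow> a \<noteq> i \<Longrightarrow> b \<noteq> i \<Longrightarrow>
      slice_face d J (k - 1) a (y b) = slice_face d J (k - 1) (b - 1) (y a)"
    and zy: "\<And>j V. j \<le> k \<Longrightarrow> j \<noteq> i \<Longrightarrow> V \<in> K \<inter> J \<Longrightarrow> d (k + card V) j (z V) = y j V"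
  shows "\<exists>c\<in>A (Suc k + card W). (\<forall>j\<le>k. j \<noteq> i \<longrightarrow> d (k + card W) j c = y j W) \<and>
     (\<forall>a\<in>W. d (Suc k + card (W - {a})) (Suc k + rank W a) c = z (W - {a}))"
proof -
  have fin: "finite W" using W fin_complexD[OF J] by auto
  obtain w where w: "card W = Suc w" using W(2) fin by (metis card_eq_0_iff not0_implies_Suc)
  have cw: "card (W - {a}) = w" if "a \<in> W" for a using that w by simp
  obtain el where el: "\<And>r. r \<le> w \<Longrightarrow> el r \<in> W \<and> rank W (el r) = r"
    and elr: "\<And>a. a \<in> W \<Longrightarrow> el (rank W a) = a"
    using rank_enumeration[OF fin] w less_Suc_eq_le by metis
  \<comment> \<open>Index \<open>j \<le> k\<close> deletes a vertex of the \<open>k\<close>-simplex,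
    index \<open>Suc k + r\<close> the vertex of rank \<open>r\<close> in \<open>W\<close>.\<close>
  define q where "q j = (if j \<le> k then y j W else z (W - {el (j - Suc k)}))" for j
  obtain k' where k': "k = Suc k'" using i by (cases k) auto
  have "\<exists>c\<in>A (Suc (Suc (k + w))). \<forall>j\<le>Suc (k + w). j \<noteq> i \<longrightarrow> d (Suc (k + w)) j c = q j"
  proof (rule inner_fill)
    fix j assume "j \<le> Suc (k + w)" "j \<noteq> i"
    show "q j \<in> A (Suc (k + w))"
    proof (cases "j \<le> k")
      case True
      then show ?thesis unfolding q_def using sliceD(2)[OF y] W(1) w \<open>j \<noteq> i\<close> by fastforce
    next
      case False
      then have "el (j - Suc k) \<in> W" using el \<open>j \<le> Suc (k + w)\<close> by simp
      then show ?thesis unfolding q_def using False sliceD(2)[OF z] sub cw by fastforce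
    qed
  next
    fix a b assume ab: "a < b" "b \<le> Suc (k + w)" "a \<noteq> i" "b \<noteq> i"
    \<comment> \<open>Two faces from \<open>y\<close>, one of each kind, or two faces from
      \<open>z\<close>: compatibility comes from \<open>comp\<close>, from \<open>zy\<close>
      together with the slice condition on \<open>y a\<close>, and from the slice condition on
      \<open>z\<close>, respectively.\<close>
    consider "b \<le> k" | "a \<le> k" "k < b" | "k < a" by linarith
    then show "d (k + w) a (q b) = d (k + w) (b - 1) (q a)"
    proof cases
      case 1
      have "slice_face d J (k - 1) a (y b) W = slice_face d J (k - 1) (b - 1) (y a) W"
        using comp ab 1 by simp
      then show ?thesis unfolding q_def slice_face_def using 1 ab W w k' by simp
    next
      case 2
      let ?e = "el (b - Suc k)"
      have e: "?e \<in> W" "rank W ?e = b - Suc k" using el[of "b - Suc k"] 2 ab by auto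
      have "d (k + w) a (z (W - {?e})) = y a (W - {?e})"
        using zy[of a "W - {?e}"] 2 ab sub e cw by auto
      also have "\<dots> = d (k + w) (b - 1) (y a W)"
        using sliceD(3)[OF y, of a W ?e] 2 ab W e cw by auto
      finally show ?thesis unfolding q_def using 2 by simp
    next
      case 3
      let ?e = "el (a - Suc k)" and ?f = "el (b - Suc k)"
      have e: "?e \<in> W" "rank W ?e = a - Suc k" using el[of "a - Suc k"] 3 ab by auto
      have f: "?f \<in> W" "rank W ?f = b - Suc k" using el[of "b - Suc k"] 3 ab by auto
      have ef: "?e < ?f" using rank_less_iff[OF fin e(1) f(1)] e f 3 ab by auto
      have "d (Suc k + (w - 1)) (Suc k + rank W ?e) (z (W - {?f}))
          = d (Suc k + (w - 1)) (Suc k + (rank W ?f - 1)) (z (W - {?e}))"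
        by (rule slice_faces_compatible[OF z fin w]) (use sub e f ef in auto)
      moreover have "w > 0" "Suc (b - 2) = b - 1" using 3 ab by auto
      ultimately show ?thesis unfolding q_def using 3 ab e f by simp
    qed
  qed (use i in auto)
  then obtain c where c: "c \<in> A (Suc (Suc (k + w)))"
    "\<And>j. j \<le> Suc (k + w) \<Longrightarrow> j \<noteq> i \<Longrightarrow> d (Suc (k + w)) j c = q j" by blast
  show ?thesis
  proof (intro bexI conjI ballI allI impI)
    show "c \<in> A (Suc k + card W)" using c(1) w by simp
    show "d (k + card W) j c = y j W" if "j \<le> k" "j \<noteq> i" for j
      using c(2)[of j] that w unfolding q_def by simp
    show "d (Suc k + card (W - {a})) (Suc k + rank W a) c = z (W - {a})" if "a \<in> W" for a
      using c(2)[of "Suc k + rank W a"] that w i cw elr rank_less_card[OF fin that]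
      unfolding q_def by auto
  qed
qed

text \<open>This is the lifting property of a right fibration: a horn in the slice under \<open>J\<close>, filled over
  the subcomplex \<open>K\<close>, is filled by adding the faces of \<open>J\<close> one by one. Each face \<open>W\<close> with
  \<open>W \<noteq> {}\<close> turns the outer horn \<open>i = k\<close> into an inner one.\<close>

lemma slice_fill:
  assumes J: "fin_complex J" and K: "fin_complex K" and KJ: "K \<subseteq> J"
    and i: "0 < i" "i \<le> k" and z: "z \<in> slice A d K (Suc k)"
    and y: "\<And>j. j \<le> k \<Longrightarrow> j \<noteq> i \<Longrightarrow> y j \<in> slice A d J k"
    and comp: "\<And>a b. a < b \<Longrightarrow> b \<le> k \<Longrightarrow> a \<noteq> i \<Longrightarrow> b \<noteq> i \<Longrightarrow>
      slice_face d J (k - 1) a (y b) = slice_face d J (k - 1) (b - 1) (y a)"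
    and zy: "\<And>j. j \<le> k \<Longrightarrow> j \<noteq> i \<Longrightarrow> slice_face d K k j z = restrict (y j) K"
  shows "\<exists>w\<in>slice A d J (Suc k). restrict w K = z \<and> (\<forall>j\<le>k. j \<noteq> i \<longrightarrow> slice_face d J k j w = y j)"
  using K KJ z zy
proof (induction "card (J - K)" arbitrary: K z rule: less_induct)
  case less
  note K = less.prems(1) and KJ = less.prems(2) and z = less.prems(3) and zy = less.prems(4)
  show ?case
  proof (cases "K = J")
    case True
    have "restrict z K = z" using sliceD(1)[OF z] by (simp add: extensional_restrict)
    moreover have "restrict (y j) K = y j" if "j \<le> k" "j \<noteq> i" for j
      using sliceD(1)[OF y[OF that]] True by (simp add: extensional_restrict)
    ultimately show ?thesis using z zy True by (intro bexI[of _ z]) auto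
  next
    case False
    then obtain W where W: "W \<in> J - K" "W \<noteq> {}" "\<And>a. a \<in> W \<Longrightarrow> W - {a} \<in> K" "fin_complex (insert W K)"
      using fin_complex_add_cell[OF J K] KJ by blast
    have zy': "d (k + card V) j (z V) = y j V" if "j \<le> k" "j \<noteq> i" "V \<in> K" for j V
      using fun_cong[OF zy[OF that(1,2)], of V] that(3) unfolding slice_face_def by simp
    obtain c where c: "c \<in> A (Suc k + card W)"
      "\<And>j. j \<le> k \<Longrightarrow> j \<noteq> i \<Longrightarrow> d (k + card W) j c = y j W"
      "\<And>a. a \<in> W \<Longrightarrow> d (Suc k + card (W - {a})) (Suc k + rank W a) c = z (W - {a})"
      using slice_fill_cell[OF J K i z _ W(2) _ y comp zy'] W KJ by blast
    have "\<exists>w\<in>slice A d J (Suc k). restrict w (insert W K) = z(W := c) \<and>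
        (\<forall>j\<le>k. j \<noteq> i \<longrightarrow> slice_face d J k j w = y j)"
    proof (rule less.hyps)
      show "card (J - insert W K) < card (J - K)"
        by (rule psubset_card_mono) (use W fin_complexD(1)[OF J] in auto)
      show "fin_complex (insert W K)" by fact
      show "insert W K \<subseteq> J" using KJ W by auto
      show "z(W := c) \<in> slice A d (insert W K) (Suc k)"
        by (rule slice_add_cell[OF z K]) (use W c in auto)
      show "slice_face d (insert W K) k j (z(W := c)) = restrict (y j) (insert W K)"
        if "j \<le> k" "j \<noteq> i" for j
        using zy'[OF that] c(2)[OF that] by (auto simp: slice_face_def fun_eq_iff restrict_def)
    qed
    then obtain w where w: "w \<in> slice A d J (Suc k)" "restrict w (insert W K) = z(W := c)"
      "\<forall>j\<le>k. j \<noteq> i \<longrightarrow> slice_face d J k j w = y j" by blast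
    have "restrict w K = restrict (restrict w (insert W K)) K" by (auto simp: fun_eq_iff restrict_def)
    also have "\<dots> = z" unfolding w(2) using W(1) sliceD(1)[OF z]
      by (auto simp: fun_eq_iff restrict_def extensional_def)
    finally show ?thesis using w by blast
  qed
qed

end

section \<open>One-sided degeneracies\<close>

text \<open>A natural section \<open>s\<close> of \<open>d 1\<close> which repeats the first vertex. No relation is imposed on
  \<open>d n 0 (s n x)\<close>, which is the endomorphism \<open>deg_shift\<close>: the given homotopies
  \<open>d 0 s \<simeq> id\<close> and \<open>d 1 s \<simeq> id\<close> induce different loops on the common face
  \<open>d 0 d 0 s = d 0 d 1 s\<close>, so they cannot both be made strict.\<close>

definition deg_shift :: "(nat \<Rightarrow> nat \<Rightarrow> 'a \<Rightarrow> 'a) \<Rightarrow> (nat \<Rightarrow> 'a \<Rightarrow> 'a) \<Rightarrow> nat \<Rightarrow> 'a \<Rightarrow> 'a" where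
  "deg_shift d s n x = d n 0 (s n x)"

definition slice_deg :: "(nat \<Rightarrow> 'a \<Rightarrow> 'a) \<Rightarrow> nat set set \<Rightarrow> nat \<Rightarrow> (nat set \<Rightarrow> 'a) \<Rightarrow> nat set \<Rightarrow> 'a" where
  "slice_deg s J k u = (\<lambda>W\<in>J. s (k + card W) (u W))"

locale left_degeneracy = face_set A d for A :: "nat \<Rightarrow> 'a set" and d +
  fixes s :: "nat \<Rightarrow> 'a \<Rightarrow> 'a"
  assumes s_closed: "x \<in> A n \<Longrightarrow> 0 < n \<Longrightarrow> s n x \<in> A (Suc n)"
    and d1_s: "x \<in> A n \<Longrightarrow> 0 < n \<Longrightarrow> d n 1 (s n x) = x"
    and d_s: "x \<in> A (Suc n) \<Longrightarrow> 0 < n \<Longrightarrow> 0 < j \<Longrightarrow> j \<le> n \<Longrightarrow>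
      d (Suc n) (Suc j) (s (Suc n) x) = s n (d n j x)"
begin

abbreviation "phi \<equiv> deg_shift d s"

lemma d0_s: "d n 0 (s n x) = phi n x"
  by (simp add: deg_shift_def)

lemma phi_closed: "x \<in> A n \<Longrightarrow> 0 < n \<Longrightarrow> phi n x \<in> A n"
  unfolding deg_shift_def by (intro face_closed s_closed) auto

text \<open>By the face identity \<open>d 0 d 0 s = d 0 d 1 s\<close> and \<open>d 1 s = id\<close>.
  So \<open>phi\<close> changes only the part of a simplex that contains its first vertex.\<close>

lemma d0_phi: "x \<in> A (Suc n) \<Longrightarrow> d n 0 (phi (Suc n) x) = d n 0 x"
  using face_face[of "s (Suc n) x" n 0 1] d1_s[of x "Suc n"] s_closed[of x "Suc n"]
  unfolding deg_shift_def by simp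

lemma d_phi:
  assumes "x \<in> A (Suc n)" "0 < n" "0 < j" "j \<le> n"
  shows "d n j (phi (Suc n) x) = phi n (d n j x)"
  using face_face[of "s (Suc n) x" n 0 "Suc j"] d_s[OF assms] s_closed[of x "Suc n"] assms
  unfolding deg_shift_def by simp

lemma slice_deg_closed:
  assumes J: "fin_complex J" and u: "u \<in> slice A d J k" and k: "0 < k"
  shows "slice_deg s J k u \<in> slice A d J (Suc k)"
proof (rule sliceI)
  fix W a assume W: "W \<in> J" "a \<in> W"
  have fin: "finite W" and Wa: "W - {a} \<in> J" using W fin_complexD[OF J] by auto
  obtain w where c: "card W = Suc w" "card (W - {a}) = w"
    using W fin by (metis card_Suc_Diff1)
  have "d (Suc (k + w)) (Suc (k + rank W a)) (s (Suc (k + w)) (u W))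
      = s (k + w) (d (k + w) (k + rank W a) (u W))"
    by (rule d_s) (use sliceD(2)[OF u W(1)] rank_less_card[OF fin W(2)] c k in auto)
  moreover have "d (k + w) (k + rank W a) (u W) = u (W - {a})" using sliceD(3)[OF u W] c by simp
  ultimately show "d (Suc k + card (W - {a})) (Suc k + rank W a) (slice_deg s J k u W)
      = slice_deg s J k u (W - {a})"
    unfolding slice_deg_def using W Wa c by simp
qed (use s_closed sliceD(2)[OF u] k in \<open>auto simp: slice_deg_def\<close>)

lemma left_degeneracy_slice:
  assumes J: "fin_complex J"
  shows "left_degeneracy (slice A d J) (slice_face d J) (slice_deg s J)"
proof -
  interpret S: face_set "slice A d J" "slice_face d J"
    using J face_set_axioms by (rule face_set_slice[rotated])
  show ?thesis
  proof
    fix u k assume u: "u \<in> slice A d J k" and k: "0 < k"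
    show "slice_deg s J k u \<in> slice A d J (Suc k)" by (rule slice_deg_closed) fact+
    show "slice_face d J k 1 (slice_deg s J k u) = u"
      using d1_s sliceD(1,2)[OF u] k
      by (auto simp: slice_deg_def slice_face_def fun_eq_iff extensional_def)
  next
    fix u k j assume u: "u \<in> slice A d J (Suc k)" and "0 < k" "0 < j" "j \<le> k"
    then show "slice_face d J (Suc k) (Suc j) (slice_deg s J (Suc k) u)
        = slice_deg s J k (slice_face d J k j u)"
      using d_s sliceD(2)[OF u] by (auto simp: slice_deg_def slice_face_def fun_eq_iff)
  qed
qed

end

lemma slice_deg_restrict:
  "K \<subseteq> J \<Longrightarrow> restrict (slice_deg s J k u) K = slice_deg s K k (restrict u K)"
  unfolding slice_deg_def by (auto simp: fun_eq_iff restrict_def)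

lemma deg_shift_slice:
  "deg_shift (slice_face d J) (slice_deg s J) k u = (\<lambda>W\<in>J. deg_shift d s (k + card W) (u W))"
  unfolding slice_deg_def slice_face_def deg_shift_def by (auto simp: fun_eq_iff restrict_def)

lemma deg_shift_restrict:
  "K \<subseteq> J \<Longrightarrow> restrict (deg_shift (slice_face d J) (slice_deg s J) k u) K
    = deg_shift (slice_face d K) (slice_deg s K) k (restrict u K)"
  unfolding deg_shift_slice by (auto simp: fun_eq_iff restrict_def)

text \<open>A slice over the complex \<open>{{}}\<close> is a copy of \<open>A\<close>, so lifting
  relative to it means lifting along the projection from a slice to the base.\<close>

lemma fin_complex_point: "fin_complex {{}}"
  unfolding fin_complex_def by auto

lemma slice_point: "c \<in> A k \<Longrightarrow> (\<lambda>W\<in>{{}}. c) \<in> slice A d {{}} k"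
  by (rule sliceI) auto

lemma slice_face_point: "slice_face d {{}} k j (\<lambda>W\<in>{{}}. c) = restrict y {{}} \<longleftrightarrow> d k j c = y {}"
  unfolding slice_face_def by (auto simp: fun_eq_iff restrict_def)

lemma restrict_point: "restrict y {{}} = (\<lambda>W\<in>{{}}. c) \<longleftrightarrow> y {} = c"
  by (auto simp: fun_eq_iff restrict_def)

section \<open>Lifting of horns of dimension at most three\<close>

context inner_kan_set
begin

text \<open>The suffix gives the dimension of the horn and its missing face. Slices are indexed by
  the number of vertices, so the given edges have degree 2 and the filler has degree 3.\<close>

lemma slice_fill_2_2:
  assumes J: "fin_complex J" and K: "fin_complex K" "K \<subseteq> J" and z: "z \<in> slice A d K 3"
    and y: "y0 \<in> slice A d J 2" "y1 \<in> slice A d J 2" "slice_face d J 1 0 y1 = slice_face d J 1 0 y0"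
    and zy: "slice_face d K 2 0 z = restrict y0 K" "slice_face d K 2 1 z = restrict y1 K"
  obtains w where "w \<in> slice A d J 3" "restrict w K = z" "slice_face d J 2 0 w = y0"
    "slice_face d J 2 1 w = y1"
proof -
  define y' where "y' j = (if j = 0 then y0 else y1)" for j :: nat
  have "\<exists>w\<in>slice A d J (Suc 2). restrict w K = z \<and>
      (\<forall>j\<le>2. j \<noteq> 2 \<longrightarrow> slice_face d J 2 j w = y' j)"
  proof (rule slice_fill[OF J K])
    fix j :: nat assume "j \<le> 2" "j \<noteq> 2"
    then have "j = 0 \<or> j = 1" by auto
    then show "y' j \<in> slice A d J 2" "slice_face d K 2 j z = restrict (y' j) K"
      using y zy unfolding y'_def by auto
  next
    fix a b :: nat assume "a < b" "b \<le> 2" "a \<noteq> 2" "b \<noteq> 2"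
    then have "a = 0 \<and> b = 1" by auto
    then show "slice_face d J (2 - 1) a (y' b) = slice_face d J (2 - 1) (b - 1) (y' a)"
      using y unfolding y'_def by simp
  qed (use z in auto)
  then obtain w where "w \<in> slice A d J (Suc 2)" "restrict w K = z"
    and w: "\<forall>j\<le>2. j \<noteq> 2 \<longrightarrow> slice_face d J 2 j w = y' j" by blast
  then show thesis using that[of w] w[rule_format, of 0] w[rule_format, of 1] unfolding y'_def by simp
qed

lemma slice_fill_3_2:
  assumes J: "fin_complex J" and K: "fin_complex K" "K \<subseteq> J" and z: "z \<in> slice A d K 4"
    and y: "y0 \<in> slice A d J 3" "y1 \<in> slice A d J 3" "y3 \<in> slice A d J 3"
    and comp: "slice_face d J 2 0 y1 = slice_face d J 2 0 y0"
      "slice_face d J 2 0 y3 = slice_face d J 2 2 y0"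
      "slice_face d J 2 1 y3 = slice_face d J 2 2 y1"
    and zy: "slice_face d K 3 0 z = restrict y0 K" "slice_face d K 3 1 z = restrict y1 K"
      "slice_face d K 3 3 z = restrict y3 K"
  obtains w where "w \<in> slice A d J 4" "restrict w K = z" "slice_face d J 3 0 w = y0"
    "slice_face d J 3 1 w = y1" "slice_face d J 3 3 w = y3"
proof -
  define y' where "y' j = (if j = 0 then y0 else if j = 1 then y1 else y3)" for j :: nat
  have "\<exists>w\<in>slice A d J (Suc 3). restrict w K = z \<and>
      (\<forall>j\<le>3. j \<noteq> 2 \<longrightarrow> slice_face d J 3 j w = y' j)"
  proof (rule slice_fill[OF J K])
    fix j :: nat assume "j \<le> 3" "j \<noteq> 2"
    then have "j = 0 \<or> j = 1 \<or> j = 3" by auto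
    then show "y' j \<in> slice A d J 3" "slice_face d K 3 j z = restrict (y' j) K"
      using y zy unfolding y'_def by auto
  next
    fix a b :: nat assume "a < b" "b \<le> 3" "a \<noteq> 2" "b \<noteq> 2"
    then have "a = 0 \<and> b = 1 \<or> a = 0 \<and> b = 3 \<or> a = 1 \<and> b = 3" by auto
    then show "slice_face d J (3 - 1) a (y' b) = slice_face d J (3 - 1) (b - 1) (y' a)"
      using comp unfolding y'_def by auto
  qed (use z in auto)
  then obtain w where "w \<in> slice A d J (Suc 3)" "restrict w K = z"
    and w: "\<forall>j\<le>3. j \<noteq> 2 \<longrightarrow> slice_face d J 3 j w = y' j" by blast
  then show thesis
    using that[of w] w[rule_format, of 0] w[rule_format, of 1] w[rule_format, of 3]
    unfolding y'_def by simp
qed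

lemma slice_fill_3_1:
  assumes J: "fin_complex J" and K: "fin_complex K" "K \<subseteq> J" and z: "z \<in> slice A d K 4"
    and y: "y0 \<in> slice A d J 3" "y2 \<in> slice A d J 3" "y3 \<in> slice A d J 3"
    and comp: "slice_face d J 2 0 y2 = slice_face d J 2 1 y0"
      "slice_face d J 2 0 y3 = slice_face d J 2 2 y0"
      "slice_face d J 2 2 y3 = slice_face d J 2 2 y2"
    and zy: "slice_face d K 3 0 z = restrict y0 K" "slice_face d K 3 2 z = restrict y2 K"
      "slice_face d K 3 3 z = restrict y3 K"
  obtains w where "w \<in> slice A d J 4" "restrict w K = z" "slice_face d J 3 0 w = y0"
    "slice_face d J 3 2 w = y2" "slice_face d J 3 3 w = y3"
proof -
  define y' where "y' j = (if j = 0 then y0 else if j = 2 then y2 else y3)" for j :: nat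
  have "\<exists>w\<in>slice A d J (Suc 3). restrict w K = z \<and>
      (\<forall>j\<le>3. j \<noteq> 1 \<longrightarrow> slice_face d J 3 j w = y' j)"
  proof (rule slice_fill[OF J K])
    fix j :: nat assume "j \<le> 3" "j \<noteq> 1"
    then have "j = 0 \<or> j = 2 \<or> j = 3" by auto
    then show "y' j \<in> slice A d J 3" "slice_face d K 3 j z = restrict (y' j) K"
      using y zy unfolding y'_def by auto
  next
    fix a b :: nat assume "a < b" "b \<le> 3" "a \<noteq> 1" "b \<noteq> 1"
    then have "a = 0 \<and> b = 2 \<or> a = 0 \<and> b = 3 \<or> a = 2 \<and> b = 3" by auto
    then show "slice_face d J (3 - 1) a (y' b) = slice_face d J (3 - 1) (b - 1) (y' a)"
      using comp unfolding y'_def by auto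
  qed (use z in auto)
  then obtain w where "w \<in> slice A d J (Suc 3)" "restrict w K = z"
    and w: "\<forall>j\<le>3. j \<noteq> 1 \<longrightarrow> slice_face d J 3 j w = y' j" by blast
  then show thesis
    using that[of w] w[rule_format, of 0] w[rule_format, of 2] w[rule_format, of 3]
    unfolding y'_def by simp
qed

text \<open>Face 0 of an edge is its target: an edge of the slice over \<open>K\<close> lifts as
  soon as its target does.\<close>

lemma slice_fill_1_1:
  assumes J: "fin_complex J" and K: "fin_complex K" "K \<subseteq> J" and z: "z \<in> slice A d K 2"
    and y: "y0 \<in> slice A d J 1" and zy: "slice_face d K 1 0 z = restrict y0 K"
  obtains w where "w \<in> slice A d J 2" "restrict w K = z" "slice_face d J 1 0 w = y0"
proof -
  have "\<exists>w\<in>slice A d J (Suc 1). restrict w K = z \<and>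
      (\<forall>j\<le>1. j \<noteq> 1 \<longrightarrow> slice_face d J 1 j w = (\<lambda>_. y0) j)"
    by (rule slice_fill[OF J K]) (use assms in \<open>auto simp: numeral_2_eq_2 less_Suc_eq_le le_Suc_eq\<close>)
  then show thesis using that by (auto simp: numeral_2_eq_2)
qed

end

section \<open>Left inverses and outer fillers in slices\<close>

locale inner_kan_degeneracy = inner_kan_set A d + left_degeneracy A d s
  for A :: "nat \<Rightarrow> 'a set" and d s
begin

text \<open>These are the base simplices over which all lifts of the next lemma take place. Face 0
  of \<open>c2\<close> is \<open>phi 2 (s 1 x)\<close>, while the other two are
  \<open>s 1 x\<close>. Since \<open>phi\<close> keeps face 0 and acts on the other faces, one
  application makes all faces equal, and the same happens for \<open>c3\<close>.\<close>

lemma constant_simplex: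
  assumes x: "x \<in> A 1" and dx: "d 1 0 (s 1 x) = x"
  defines "c2 \<equiv> s 2 (s 1 x)" and "c3 \<equiv> s 3 (s 2 (s 1 x))"
  shows "s 1 x \<in> A 2" "c2 \<in> A 3" "c3 \<in> A 4" "d 1 1 (s 1 x) = x"
    "d 2 0 c2 = phi 2 (s 1 x)" "d 2 1 c2 = s 1 x" "d 2 2 c2 = s 1 x"
    "j \<le> 2 \<Longrightarrow> d 2 j (phi 3 c2) = phi 2 (s 1 x)" "j \<le> 3 \<Longrightarrow> d 3 j (phi 4 c3) = phi 3 c2"
proof -
  show s1: "s 1 x \<in> A 2" using s_closed[OF x] by (simp add: numeral_2_eq_2)
  show c2: "c2 \<in> A 3" using s_closed[OF s1] by (simp add: numeral_3_eq_3 c2_def)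
  have c3': "s 3 c2 \<in> A 4" using s_closed[OF c2] by simp
  then show c3: "c3 \<in> A 4" by (simp add: c2_def c3_def)
  show d1: "d 1 1 (s 1 x) = x" using d1_s[OF x] by simp
  show e0: "d 2 0 c2 = phi 2 (s 1 x)" by (simp add: c2_def d0_s)
  show e1: "d 2 1 c2 = s 1 x" using d1_s[OF s1] by (simp add: c2_def)
  show e2: "d 2 2 c2 = s 1 x" using d_s[of "s 1 x" 1 1] s1 d1 by (simp add: c2_def numeral_2_eq_2)
  have "d 2 0 (phi 3 c2) = phi 2 (s 1 x)" using d0_phi[of c2 2] c2 e0 by simp
  moreover have "d 2 1 (phi 3 c2) = phi 2 (s 1 x)" using d_phi[of c2 2 1] c2 e1 by simp
  moreover have "d 2 2 (phi 3 c2) = phi 2 (s 1 x)" using d_phi[of c2 2 2] c2 e2 by simp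
  ultimately show "d 2 j (phi 3 c2) = phi 2 (s 1 x)" if "j \<le> 2"
    using that le_Suc_eq by (auto simp: numeral_2_eq_2)
  have "d 3 0 (phi 4 c3) = phi 3 c2" using d0_phi[of c3 3] c3 by (simp add: c2_def c3_def d0_s)
  moreover have "d 3 1 (phi 4 c3) = phi 3 c2"
    using d_phi[of c3 3 1] c3 d1_s[of c2 3] c2 by (simp add: c2_def c3_def)
  moreover have "d 3 2 (phi 4 c3) = phi 3 c2"
    using d_phi[of c3 3 2] c3 d_s[of c2 2 1] c2 e1
    by (simp add: c2_def c3_def del: One_nat_def)
  moreover have "d 3 3 (phi 4 c3) = phi 3 c2"
    using d_phi[of c3 3 3] c3 d_s[of c2 2 2] c2 e2 by (simp add: c2_def c3_def)
  ultimately show "d 3 j (phi 4 c3) = phi 3 c2" if "j \<le> 3"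
    using that le_Suc_eq by (auto simp: numeral_3_eq_3 numeral_2_eq_2)
qed

text \<open>In a slice regard a vertex as an object and an edge as a morphism, so that \<open>phi\<close> acts by
  precomposition with an automorphism and \<open>slice_deg\<close> of \<open>b\<close> is a morphism from \<open>b\<close> to \<open>phi b\<close>.
  The edges \<open>phi (s b)\<close> are then right units for morphisms in the image of \<open>phi\<close>, and a right
  fibration provides right inverses. The proof that a semigroup with right units and right inverses
  is a group gives the left inverse \<open>r\<close> of \<open>phi f\<close>, as a 2-simplex \<open>t\<close>.\<close>

lemma left_inverse:
  assumes J: "fin_complex J" and x: "x \<in> A 1" and dx: "d 1 0 (s 1 x) = x"
    and f: "f \<in> slice A d J 2" "f {} = s 1 x"
    and b0: "b0 \<in> slice A d J 1" "slice_face d J 1 1 f = b0"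
    and b1: "b1 \<in> slice A d J 1" "slice_face d J 1 0 f = deg_shift (slice_face d J) (slice_deg s J) 1 b1"
      "b1 {} = x"
  obtains t where "t \<in> slice A d J 3"
    "slice_face d J 2 2 t = deg_shift (slice_face d J) (slice_deg s J) 2 f"
    "slice_face d J 2 1 t = deg_shift (slice_face d J) (slice_deg s J) 2 (slice_deg s J 1 b0)"
proof -
  note [simp del] = One_nat_def
  interpret F: left_degeneracy "slice A d J" "slice_face d J" "slice_deg s J"
    by (rule left_degeneracy_slice) fact
  let ?A = "slice A d J" and ?d = "slice_face d J" and ?s = "slice_deg s J"
  define c1 c2 c3 where "c1 = s 1 x" and "c2 = s 2 c1" and "c3 = s 3 c2"
  note c = constant_simplex[OF x dx, folded c1_def, folded c2_def, folded c3_def]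
  note sp = slice_point[where A = A and d = d]
  have J0: "{{}} \<subseteq> J" using fin_complexD(2)[OF J] by simp
  have at0: "?d k j u {} = d k j (u {})" "?s k u {} = s k (u {})"
    "F.phi k u {} = phi k (u {})" for k j u
    using J0 by (auto simp: slice_face_def slice_deg_def deg_shift_slice)
  have face2: "?d 1 i (?d 2 (Suc j) u) = ?d 1 j (?d 2 i u)"
    if "u \<in> ?A 3" "i \<le> j" "j \<le> 1" for i j u
    using F.face_face[of u 1 i "Suc j"] that by (simp add: numeral_2_eq_2 numeral_3_eq_3)
  have face3: "?d 2 i (?d 3 (Suc j) u) = ?d 2 j (?d 3 i u)"
    if "u \<in> ?A 4" "i \<le> j" "j \<le> 2" for i j u
    using F.face_face[of u 2 i "Suc j"] that by simp
  have cl2: "?d 2 i u \<in> ?A 2" if "u \<in> ?A 3" "i \<le> 2" for u i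
    using F.face_closed[of u 2 i] that by simp
  have cl3: "?d 3 i u \<in> ?A 3" if "u \<in> ?A 4" "i \<le> 3" for u i
    using F.face_closed[of u 3 i] that by simp
  have s1: "?s 1 u \<in> ?A 2" if "u \<in> ?A 1" for u
    using F.s_closed[OF that] by (simp add: numeral_2_eq_2)
  have s2: "?s 2 u \<in> ?A 3" if "u \<in> ?A 2" for u
    using F.s_closed[OF that] by simp
  have p2: "F.phi 2 u \<in> ?A 2" if "u \<in> ?A 2" for u
    using F.phi_closed[OF that] by simp
  have p3: "F.phi 3 u \<in> ?A 3" if "u \<in> ?A 3" for u
    using F.phi_closed[OF that] by simp
  have p2_0: "?d 1 0 (F.phi 2 u) = ?d 1 0 u" if "u \<in> ?A 2" for u
    using F.d0_phi[of u 1] that by (simp add: numeral_2_eq_2)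
  have p2_1: "?d 1 1 (F.phi 2 u) = F.phi 1 (?d 1 1 u)" if "u \<in> ?A 2" for u
    using F.d_phi[of u 1 1] that by (simp add: numeral_2_eq_2)
  have p3_0: "?d 2 0 (F.phi 3 u) = ?d 2 0 u" if "u \<in> ?A 3" for u
    using F.d0_phi[of u 2] that by simp
  have p3_j: "?d 2 j (F.phi 3 u) = F.phi 2 (?d 2 j u)"
    if "u \<in> ?A 3" "0 < j" "j \<le> 2" for u j
    using F.d_phi[of u 2 j] that by simp
  have s2_2: "?d 2 2 (?s 2 u) = ?s 1 (?d 1 1 u)"
    if "u \<in> ?A 2" for u
    using F.d_s[of u 1 1] that by (simp add: numeral_2_eq_2)
  have s2_1: "?d 2 1 (?s 2 u) = u" if "u \<in> ?A 2" for u
    using F.d1_s[OF that] by simp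
  have s1_1: "?d 1 1 (?s 1 u) = u" if "u \<in> ?A 1" for u
    using F.d1_s[OF that] by simp
  have f0: "f {} = c1" using f by (simp add: c1_def)
  define g where "g = F.phi 2 f"
  define e0 where "e0 = F.phi 2 (?s 1 b0)"
  have g: "g \<in> ?A 2" "?d 1 0 g = F.phi 1 b1" "?d 1 1 g = F.phi 1 b0"
    "g {} = phi 2 c1"
    using p2 p2_0 p2_1 f b0 b1 f0 unfolding g_def by (auto simp: at0)
  have b0_0: "b0 {} = x" using b0(2) f0 c(4) at0(1) by metis
  have pt: "restrict w {{}} = (\<lambda>W\<in>{{}}. c) \<Longrightarrow> w {} = c" for w c by (simp add: restrict_point)

  \<comment> \<open>From here on a 2-simplex is read as an equation: face 0 composed with face 2 is
    face 1. The lift \<open>T0\<close> over \<open>c2\<close> reads \<open>g r0 = s b1\<close>; it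
    is a horn with face 2 missing, hence a right lift.\<close>
  have "?d 1 0 (?s 1 b1) = ?d 1 0 g" by (simp add: g F.d0_s)
  then obtain T0 where T0: "T0 \<in> ?A 3" "restrict T0 {{}} = (\<lambda>W\<in>{{}}. c2)"
    "?d 2 0 T0 = g" "?d 2 1 T0 = ?s 1 b1"
    by (rule slice_fill_2_2[OF J fin_complex_point J0 sp[OF c(2)] g(1) s1[OF b1(1)]])
      (simp_all add: slice_face_point c g at0 b1(3) c1_def[symmetric])
  define r0 where "r0 = ?d 2 2 T0"
  have r0: "r0 \<in> ?A 2" "?d 1 0 r0 = F.phi 1 b0" "?d 1 1 r0 = b1"
    unfolding r0_def using cl2[OF T0(1)] face2[OF T0(1), of 0 1] face2[OF T0(1), of 1 1] T0 g s1_1[OF b1(1)]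
    by auto
  have r0_0: "r0 {} = c1" unfolding r0_def using pt[OF T0(2)] c by (simp add: at0)
  \<comment> \<open>Applying \<open>phi\<close> keeps face 0 and changes the other faces, so
    \<open>T1\<close> reads \<open>g r = e1\<close>: \<open>r\<close> is a right inverse of
    \<open>g\<close>, now in the image of \<open>phi\<close>.\<close>
  define T1 where "T1 = F.phi 3 T0"
  define r where "r = F.phi 2 r0"
  define e1 where "e1 = F.phi 2 (?s 1 b1)"
  have T1: "T1 \<in> ?A 3" "?d 2 0 T1 = g" "?d 2 1 T1 = e1"
    "?d 2 2 T1 = r" "T1 {} = phi 3 c2"
    unfolding T1_def r_def e1_def r0_def
    using p3[OF T0(1)] p3_0[OF T0(1)] p3_j[OF T0(1)] T0 pt[OF T0(2)] by (auto simp: at0)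
  have r: "r \<in> ?A 2" "?d 1 0 r = F.phi 1 b0" "r {} = phi 2 c1"
    unfolding r_def using p2 r0 p2_0 r0_0 by (auto simp: at0)
  have e0: "e0 \<in> ?A 2" "?d 1 0 e0 = F.phi 1 b0" "e0 {} = phi 2 c1"
    unfolding e0_def using p2 s1 b0 p2_0 b0_0 by (auto simp: at0 F.d0_s c1_def)

  \<comment> \<open>A right inverse of the right inverse: \<open>T2\<close> reads
    \<open>r r' = e0\<close>.\<close>
  obtain T2 where T2: "T2 \<in> ?A 3" "restrict T2 {{}} = (\<lambda>W\<in>{{}}. phi 3 c2)"
    "?d 2 0 T2 = r" "?d 2 1 T2 = e0"
    by (rule slice_fill_2_2[OF J fin_complex_point J0 sp[where c = "phi 3 c2" and k = 3] r(1) e0(1)])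
      (use phi_closed[OF c(2)] in \<open>simp_all add: slice_face_point c e0 r\<close>)
  define r' where "r' = ?d 2 2 T2"
  \<comment> \<open>The right unit law \<open>g e0 = g\<close>, obtained as \<open>phi\<close> of
    the degenerate triangle on \<open>f\<close>.\<close>
  define S where "S = F.phi 3 (?s 2 f)"
  have S: "S \<in> ?A 3" "?d 2 0 S = g" "?d 2 1 S = g"
    "?d 2 2 S = e0" "S {} = phi 3 c2"
    unfolding S_def g_def e0_def c2_def
    using p3 s2 f p3_0 p3_j F.d0_s s2_1 s2_2 b0 by (auto simp: at0 f0)

  \<comment> \<open>Associativity: \<open>(g r) r' = g (r r')\<close>. Face 2 of \<open>M1\<close>,
    named \<open>T3\<close>, therefore reads \<open>e1 r' = g\<close>.\<close>
  obtain M1 where M1: "M1 \<in> ?A 4" "restrict M1 {{}} = (\<lambda>W\<in>{{}}. phi 4 c3)"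
    "?d 3 0 M1 = T1" "?d 3 1 M1 = S" "?d 3 3 M1 = T2"
    by (rule slice_fill_3_2[OF J fin_complex_point J0 sp[where c = "phi 4 c3" and k = 4] T1(1) S(1) T2(1)])
      (use phi_closed[OF c(3)] pt[OF T2(2)] in \<open>simp_all add: slice_face_point c S T1 T2\<close>)
  define T3 where "T3 = ?d 3 2 M1"
  have T3: "T3 \<in> ?A 3" "?d 2 0 T3 = e1" "?d 2 1 T3 = g"
    "?d 2 2 T3 = r'" "T3 {} = phi 3 c2"
    unfolding T3_def r'_def
    using cl3[OF M1(1)] face3[OF M1(1), of 0 1] face3[OF M1(1), of 1 1] face3[OF M1(1), of 2 2] M1 T1 S T2
      pt[OF M1(2)] c by (auto simp: at0)

  \<comment> \<open>The right unit law \<open>r e1 = r\<close>, available because \<open>r\<close>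
    is \<open>phi r0\<close>.\<close>
  define R where "R = F.phi 3 (?s 2 r0)"
  have R: "R \<in> ?A 3" "?d 2 0 R = r" "?d 2 1 R = r"
    "?d 2 2 R = e1" "R {} = phi 3 c2"
    unfolding R_def r_def e1_def c2_def
    using p3 s2 r0 p3_0 p3_j F.d0_s s2_1 s2_2 by (auto simp: at0 r0_0)
  \<comment> \<open>Associativity again: \<open>r g = r (e1 r') = (r e1) r' = r r' = e0\<close>. The
    missing face 1 of \<open>M2\<close> reads \<open>r g = e0\<close>.\<close>
  obtain M2 where M2: "M2 \<in> ?A 4" "restrict M2 {{}} = (\<lambda>W\<in>{{}}. phi 4 c3)"
    "?d 3 0 M2 = R" "?d 3 2 M2 = T2" "?d 3 3 M2 = T3"
    by (rule slice_fill_3_1[OF J fin_complex_point J0 sp[where c = "phi 4 c3" and k = 4] R(1) T2(1) T3(1)])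
      (use phi_closed[OF c(3)] pt[OF T2(2)] in \<open>simp_all add: slice_face_point c R T2 T3 r'_def\<close>)
  show thesis
  proof (rule that[of "?d 3 1 M2"])
    show "?d 3 1 M2 \<in> ?A 3" using cl3[OF M2(1)] by simp
    show "?d 2 2 (?d 3 1 M2) = F.phi 2 f"
      using face3[OF M2(1), of 1 2] M2 T3 g_def by simp
    show "?d 2 1 (?d 3 1 M2) = F.phi 2 (?s 1 b0)"
      using face3[OF M2(1), of 1 1] M2 T2 e0_def by simp
  qed
qed

text \<open>Let \<open>r\<close> be the left inverse of \<open>phi f\<close> over \<open>J\<close>,
  exhibited by \<open>t\<close>. First \<open>r\<close> is lifted to \<open>E\<close> from its
  target \<open>phi b0\<close>, then \<open>t\<close> is lifted with this lift and the unit edge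
  \<open>e\<close> as faces 0 and 1. Face 2 is a lift of \<open>phi f\<close> with source
  \<open>phi b0\<close>. Both lifts are right lifts.\<close>

lemma outer_fill_slice:
  assumes E: "fin_complex E" and J: "fin_complex J" "J \<subseteq> E"
    and x: "x \<in> A 1" and dx: "d 1 0 (s 1 x) = x"
    and f: "f \<in> slice A d J 2" "f {} = s 1 x"
    and b0: "b0 \<in> slice A d E 1" "slice_face d J 1 1 f = restrict b0 J"
    and b1: "b1 \<in> slice A d J 1" "slice_face d J 1 0 f = deg_shift (slice_face d J) (slice_deg s J) 1 b1"
      "b1 {} = x"
  obtains w where "w \<in> slice A d E 2"
    "restrict w J = deg_shift (slice_face d J) (slice_deg s J) 2 f"
    "slice_face d E 1 1 w = deg_shift (slice_face d E) (slice_deg s E) 1 b0"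
proof -
  note [simp del] = One_nat_def
  interpret F: left_degeneracy "slice A d J" "slice_face d J" "slice_deg s J"
    by (rule left_degeneracy_slice) fact
  interpret E: left_degeneracy "slice A d E" "slice_face d E" "slice_deg s E"
    by (rule left_degeneracy_slice) fact
  have b0J: "restrict b0 J \<in> slice A d J 1" by (rule slice_restrict) fact+
  obtain t where t: "t \<in> slice A d J 3" "slice_face d J 2 2 t = F.phi 2 f"
    "slice_face d J 2 1 t = F.phi 2 (slice_deg s J 1 (restrict b0 J))"
    by (rule left_inverse[OF J(1) x dx f b0J b0(2) b1])
  \<comment> \<open>The unit edge at \<open>phi b0\<close>, with both ends equal to
    \<open>phi b0\<close>; over \<open>J\<close> it is face 1 of \<open>t\<close>.\<close>
  define e where "e = E.phi 2 (slice_deg s E 1 b0)"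
  have sb: "slice_deg s E 1 b0 \<in> slice A d E 2" using E.s_closed[OF b0(1)] by (simp add: numeral_2_eq_2)
  have sbJ: "slice_deg s J 1 (restrict b0 J) \<in> slice A d J 2"
    using F.s_closed[OF b0J] by (simp add: numeral_2_eq_2)
  have e: "e \<in> slice A d E 2" "slice_face d E 1 0 e = E.phi 1 b0" "slice_face d E 1 1 e = E.phi 1 b0"
    using E.phi_closed[OF sb] E.d0_phi[of "slice_deg s E 1 b0" 1] E.d_phi[of "slice_deg s E 1 b0" 1 1]
      E.d1_s[OF b0(1)] sb unfolding e_def by (simp_all add: numeral_2_eq_2 E.d0_s)
  have eJ: "restrict e J = F.phi 2 (slice_deg s J 1 (restrict b0 J))"
    unfolding e_def using J(2) by (simp add: deg_shift_restrict slice_deg_restrict)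
  have pJ: "restrict (E.phi 1 b0) J = F.phi 1 (restrict b0 J)"
    using J(2) by (simp add: deg_shift_restrict)
  have t0: "slice_face d J 2 0 t \<in> slice A d J 2" using F.face_closed[of t 2 0] t(1) by simp
  have "slice_face d J 1 0 (slice_face d J 2 0 t) = slice_face d J 1 0 (slice_face d J 2 1 t)"
    using F.face_face[of t 1 0 1] t(1) by (simp add: numeral_2_eq_2 numeral_3_eq_3)
  also have "\<dots> = restrict (E.phi 1 b0) J"
    unfolding t pJ using F.d0_phi[of _ 1] sbJ by (simp add: numeral_2_eq_2 F.d0_s)
  finally have t00: "slice_face d J 1 0 (slice_face d J 2 0 t) = restrict (E.phi 1 b0) J" .
  obtain r where r: "r \<in> slice A d E 2" "restrict r J = slice_face d J 2 0 t" "slice_face d E 1 0 r = E.phi 1 b0"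
    by (rule slice_fill_1_1[OF E J t0 _ t00]) (use E.phi_closed[OF b0(1)] in simp)
  obtain D where D: "D \<in> slice A d E 3" "restrict D J = t" "slice_face d E 2 0 D = r" "slice_face d E 2 1 D = e"
    by (rule slice_fill_2_2[OF E J t(1) r(1) e(1)]) (simp_all add: r e t eJ)
  show thesis
  proof (rule that[of "slice_face d E 2 2 D"])
    show "slice_face d E 2 2 D \<in> slice A d E 2" using E.face_closed[of D 2 2] D(1) by simp
    show "restrict (slice_face d E 2 2 D) J = F.phi 2 f"
      using slice_face_restrict[OF J(2), of d 2 2 D] D t by simp
    have "slice_face d E 1 1 (slice_face d E 2 2 D) = slice_face d E 1 1 (slice_face d E 2 1 D)"
      using E.face_face[of D 1 1 2] D(1) by (simp add: numeral_2_eq_2 numeral_3_eq_3 One_nat_def)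
    then show "slice_face d E 1 1 (slice_face d E 2 2 D) = E.phi 1 b0" using D e by simp
  qed
qed

end

section \<open>Path lifting\<close>

lemma equivclp_map:
  assumes step: "\<And>x y. r x y \<Longrightarrow> r' (f x) (f y)" and "equivclp r x y"
  shows "equivclp r' (f x) (f y)"
  using assms(2)
proof (induction rule: equivclp_induct)
  case (step y z)
  then have "equivclp r' (f y) (f z)" using assms(1) by (blast intro: r_into_equivclp equivclp_sym)
  with step.IH show ?case by (rule equivclp_trans)
qed simp

text \<open>\<open>P n\<close> is the set of paths in the space whose points are \<open>A n\<close>, with endpoints given by
  \<open>bd 0\<close> and \<open>bd 1\<close>.\<close>

locale path_space = A: face_set A d + P: face_set P e
  for A :: "nat \<Rightarrow> 'a set" and d and P :: "nat \<Rightarrow> 'a set" and e +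
  fixes bd :: "nat \<Rightarrow> nat \<Rightarrow> 'a \<Rightarrow> 'a"
  assumes A0: "x \<in> A 0 \<Longrightarrow> y \<in> A 0 \<Longrightarrow> x = y"
    and P0: "p \<in> P 0 \<Longrightarrow> q \<in> P 0 \<Longrightarrow> p = q"
    and bd_closed: "q \<in> P n \<Longrightarrow> k \<le> 1 \<Longrightarrow> bd k n q \<in> A n"
    and bd_face: "q \<in> P (Suc n) \<Longrightarrow> k \<le> 1 \<Longrightarrow> i \<le> n \<Longrightarrow> d n i (bd k (Suc n) q) = bd k n (e n i q)"
    and lift: "k \<le> 1 \<Longrightarrow> x \<in> A (Suc n) \<Longrightarrow>
      (\<And>j. j \<le> n \<Longrightarrow> r j \<in> P n \<and> bd k n (r j) = d n j x) \<Longrightarrow>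
      (\<And>a b. a < b \<Longrightarrow> b \<le> n \<Longrightarrow> e (n - 1) a (r b) = e (n - 1) (b - 1) (r a)) \<Longrightarrow>
      \<exists>Q\<in>P (Suc n). bd k (Suc n) Q = x \<and> (\<forall>j\<le>n. e n j Q = r j)"
begin

text \<open>The paths on the given faces prescribe a path on the boundary of face \<open>i\<close>.
  Lifting that one first completes the boundary, and a second lift gives the path of the whole
  simplex.\<close>

lemma lift_horn:
  assumes k: "k \<le> 1" and x: "x \<in> A (Suc (Suc m))" and i: "i \<le> Suc m"
    and q: "\<And>j. j \<le> Suc m \<Longrightarrow> j \<noteq> i \<Longrightarrow> q j \<in> P (Suc m) \<and> bd k (Suc m) (q j) = d (Suc m) j x"
    and comp: "\<And>a b. a < b \<Longrightarrow> b \<le> Suc m \<Longrightarrow> a \<noteq> i \<Longrightarrow> b \<noteq> i \<Longrightarrow> e m a (q b) = e m (b - 1) (q a)"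
  shows "\<exists>Q\<in>P (Suc (Suc m)). bd k (Suc (Suc m)) Q = x \<and> (\<forall>j\<le>Suc m. j \<noteq> i \<longrightarrow> e (Suc m) j Q = q j)"
proof -
  \<comment> \<open>Face \<open>a\<close> of face \<open>i\<close> is face \<open>i - 1\<close> of
    face \<open>a\<close> when \<open>a < i\<close>, and face \<open>i\<close> of face
    \<open>Suc a\<close> otherwise.\<close>
  define r where "r a = (if a < i then e m (i - 1) (q a) else e m i (q (Suc a)))" for a
  have pf: "e (m - 1) a (e m b p) = e (m - 1) (b - 1) (e m a p)"
    if "p \<in> P (Suc m)" "a < b" "b \<le> m" for a b p
    using P.face_face[of p "m - 1" a b] that by (cases m) auto
  have "\<exists>Q\<in>P (Suc m). bd k (Suc m) Q = d (Suc m) i x \<and> (\<forall>j\<le>m. e m j Q = r j)"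
  proof (rule lift)
    show "d (Suc m) i x \<in> A (Suc m)" using A.face_closed[OF x i] .
  next
    fix j assume j: "j \<le> m"
    show "r j \<in> P m \<and> bd k m (r j) = d m j (d (Suc m) i x)"
    proof (cases "j < i")
      case True
      then have "d m (i - 1) (d (Suc m) j x) = d m j (d (Suc m) i x)"
        using A.face_face[OF x True] i by simp
      then show ?thesis
        unfolding r_def using True i q[of j] P.face_closed[of "q j" m "i - 1"]
          bd_face[of "q j" m k "i - 1"] k j by auto
    next
      case False
      then have "d m i (d (Suc m) (Suc j) x) = d m j (d (Suc m) i x)"
        using A.face_face[OF x, of i "Suc j"] j by simp
      then show ?thesis
        unfolding r_def using False i q[of "Suc j"] P.face_closed[of "q (Suc j)" m i]
          bd_face[of "q (Suc j)" m k i] k j by auto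
    qed
  next
    fix a b assume ab: "a < b" "b \<le> m"
    consider "b < i" | "a < i" "i \<le> b" | "i \<le> a" by linarith
    then show "e (m - 1) a (r b) = e (m - 1) (b - 1) (r a)"
    proof cases
      case 1
      have "e (m - 1) a (e m (i - 1) (q b)) = e (m - 1) (i - 1 - 1) (e m a (q b))"
        using pf[of "q b" a "i - 1"] q[of b] 1 ab i by auto
      also have "\<dots> = e (m - 1) (i - 1 - 1) (e m (b - 1) (q a))" using comp[of a b] 1 ab by simp
      also have "\<dots> = e (m - 1) (b - 1) (e m (i - 1) (q a))"
        using pf[of "q a" "b - 1" "i - 1"] q[of a] 1 ab i by auto
      finally show ?thesis unfolding r_def using 1 ab by simp
    next
      case 2
      have "e (m - 1) a (e m i (q (Suc b))) = e (m - 1) (i - 1) (e m a (q (Suc b)))"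
        using pf[of "q (Suc b)" a i] q[of "Suc b"] 2 ab i by auto
      also have "\<dots> = e (m - 1) (i - 1) (e m b (q a))" using comp[of a "Suc b"] 2 ab by simp
      also have "\<dots> = e (m - 1) (b - 1) (e m (i - 1) (q a))"
        using pf[of "q a" "i - 1" b] q[of a] 2 ab i by auto
      finally show ?thesis unfolding r_def using 2 ab by simp
    next
      case 3
      have "e (m - 1) a (e m i (q (Suc b))) = e (m - 1) i (e m (Suc a) (q (Suc b)))"
        using pf[of "q (Suc b)" i "Suc a"] q[of "Suc b"] 3 ab i by auto
      also have "\<dots> = e (m - 1) i (e m b (q (Suc a)))" using comp[of "Suc a" "Suc b"] 3 ab by simp
      also have "\<dots> = e (m - 1) (b - 1) (e m i (q (Suc a)))"
        using pf[of "q (Suc a)" i b] q[of "Suc a"] 3 ab i by auto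
      finally show ?thesis unfolding r_def using 3 ab by simp
    qed
  qed (use k in auto)
  then obtain R where R: "R \<in> P (Suc m)" "bd k (Suc m) R = d (Suc m) i x"
    "\<And>j. j \<le> m \<Longrightarrow> e m j R = r j" by blast
  have "\<exists>Q\<in>P (Suc (Suc m)). bd k (Suc (Suc m)) Q = x \<and> (\<forall>j\<le>Suc m. e (Suc m) j Q = (q(i := R)) j)"
  proof (rule lift[OF k x])
    show "(q(i := R)) j \<in> P (Suc m) \<and> bd k (Suc m) ((q(i := R)) j) = d (Suc m) j x"
      if "j \<le> Suc m" for j using q[OF that] R by auto
    fix a b assume ab: "a < b" "b \<le> Suc m"
    consider "a = i" | "b = i" | "a \<noteq> i" "b \<noteq> i" by blast
    then show "e (Suc m - 1) a ((q(i := R)) b) = e (Suc m - 1) (b - 1) ((q(i := R)) a)"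
      by cases (use ab R(3)[of "b - 1"] R(3)[of a] comp[OF ab] in \<open>auto simp: r_def\<close>)
  qed
  then show ?thesis by auto
qed

text \<open>Faces are added one at a time: on the boundary of a new face \<open>W\<close> the path
  is already chosen, so \<open>lift\<close> extends it over \<open>W\<close> with end
  \<open>U W\<close>. The number \<open>k\<close> says which end of the paths is prescribed.\<close>

lemma homotopy_extension:
  assumes L: "fin_complex L" and K: "fin_complex K" "K \<subseteq> L" and k: "k \<le> 1"
    and U: "U \<in> fam A d L" and q: "q \<in> fam P e K"
    and bq: "\<And>S. S \<in> K \<Longrightarrow> bd k (card S) (q S) = U S"
  shows "\<exists>Q\<in>fam P e L. restrict Q K = q \<and> (\<forall>S\<in>L. bd k (card S) (Q S) = U S)"
  using K q bq
proof (induction "card (L - K)" arbitrary: K q rule: less_induct)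
  case less
  note K = less.prems(1) and KL = less.prems(2) and q = less.prems(3) and bq = less.prems(4)
  show ?case
  proof (cases "K = L")
    case True
    have "restrict q K = q" using sliceD(1)[OF q] by (simp add: extensional_restrict)
    then show ?thesis using q bq True by (intro bexI[of _ q]) auto
  next
    case False
    then obtain W where W: "W \<in> L - K" "W \<noteq> {}" "\<And>a. a \<in> W \<Longrightarrow> W - {a} \<in> K" "fin_complex (insert W K)"
      using fin_complex_add_cell[OF L K] KL by blast
    have fin: "finite W" using W fin_complexD[OF L] by auto
    obtain w where w: "card W = Suc w" using W(2) fin by (metis card_eq_0_iff not0_implies_Suc)
    have cw: "card (W - {a}) = w" if "a \<in> W" for a using that w by simp
    obtain el where el: "\<And>r. r \<le> w \<Longrightarrow> el r \<in> W \<and> rank W (el r) = r"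
      and elr: "\<And>a. a \<in> W \<Longrightarrow> el (rank W a) = a"
      using rank_enumeration[OF fin] w less_Suc_eq_le by metis
    have UW: "U W \<in> A (Suc w)" using sliceD(2)[OF U, of W] W w by simp
    have "\<exists>Q\<in>P (Suc w). bd k (Suc w) Q = U W \<and> (\<forall>j\<le>w. e w j Q = q (W - {el j}))"
    proof (rule lift[OF k UW])
      fix j assume "j \<le> w"
      then have j: "el j \<in> W" "rank W (el j) = j" using el by auto
      then show "q (W - {el j}) \<in> P w \<and> bd k w (q (W - {el j})) = d w j (U W)"
        using sliceD(2)[OF q W(3)[OF j(1)]] cw[OF j(1)] bq[OF W(3)[OF j(1)]]
          sliceD(3)[OF U _ j(1)] W(1) by simp
    next
      fix a b assume ab: "a < b" "b \<le> w"
      then have el': "el a \<in> W" "rank W (el a) = a" "el b \<in> W" "rank W (el b) = b" using el by auto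
      then have "el a < el b" using rank_less_iff[OF fin, of "el a" "el b"] ab by simp
      then show "e (w - 1) a (q (W - {el b})) = e (w - 1) (b - 1) (q (W - {el a}))"
        using slice_faces_compatible[OF q fin w W(3) W(3), of "el a" "el b"] el' by simp
    qed
    then obtain Q where Q: "Q \<in> P (Suc w)" "bd k (Suc w) Q = U W"
      "\<And>j. j \<le> w \<Longrightarrow> e w j Q = q (W - {el j})" by blast
    have "\<exists>Q'\<in>fam P e L. restrict Q' (insert W K) = q(W := Q) \<and> (\<forall>S\<in>L. bd k (card S) (Q' S) = U S)"
    proof (rule less.hyps)
      show "card (L - insert W K) < card (L - K)"
        by (rule psubset_card_mono) (use W fin_complexD(1)[OF L] in auto)
      show "insert W K \<subseteq> L" using KL W by auto
      show "q(W := Q) \<in> fam P e (insert W K)"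
      proof (rule slice_add_cell[OF q K])
        show "e (0 + card (W - {a})) (0 + rank W a) Q = q (W - {a})" if "a \<in> W" for a
          using Q(3)[of "rank W a"] rank_less_card[OF fin that] w cw[OF that] elr[OF that] by simp
      qed (use W Q w in auto)
    qed (use W bq Q w in auto)
    then obtain Q' where Q': "Q' \<in> fam P e L" "restrict Q' (insert W K) = q(W := Q)"
      "\<forall>S\<in>L. bd k (card S) (Q' S) = U S" by blast
    have "restrict Q' K = restrict (restrict Q' (insert W K)) K" by (auto simp: fun_eq_iff restrict_def)
    also have "\<dots> = q" unfolding Q'(2) using W(1) sliceD(1)[OF q]
      by (auto simp: fun_eq_iff restrict_def extensional_def)
    finally show ?thesis using Q' by blast
  qed
qed

definition fam_path :: "nat set set \<Rightarrow> (nat set \<Rightarrow> 'a) \<Rightarrow> (nat set \<Rightarrow> 'a) \<Rightarrow> bool" where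
  "fam_path L U V \<longleftrightarrow> (\<exists>Q\<in>fam P e L. U = (\<lambda>S\<in>L. bd 0 (card S) (Q S)) \<and> V = (\<lambda>S\<in>L. bd 1 (card S) (Q S)))"

abbreviation fam_conn :: "nat set set \<Rightarrow> (nat set \<Rightarrow> 'a) \<Rightarrow> (nat set \<Rightarrow> 'a) \<Rightarrow> bool" where
  "fam_conn L \<equiv> equivclp (fam_path L)"

definition pt_path :: "nat \<Rightarrow> 'a \<Rightarrow> 'a \<Rightarrow> bool" where
  "pt_path n x y \<longleftrightarrow> (\<exists>q\<in>P n. bd 0 n q = x \<and> bd 1 n q = y)"

abbreviation pt_conn :: "nat \<Rightarrow> 'a \<Rightarrow> 'a \<Rightarrow> bool" where
  "pt_conn n \<equiv> equivclp (pt_path n)"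

lemma bd_fam:
  assumes Q: "Q \<in> fam P e L" and L: "fin_complex L" and k: "k \<le> 1"
  shows "(\<lambda>S\<in>L. bd k (card S) (Q S)) \<in> fam A d L"
proof (rule sliceI)
  fix W a assume W: "W \<in> L" "a \<in> W"
  have fin: "finite W" and Wa: "W - {a} \<in> L" using W fin_complexD[OF L] by auto
  obtain w where w: "card W = Suc w" "card (W - {a}) = w" using W fin by (metis card_Suc_Diff1)
  have "d w (rank W a) (bd k (Suc w) (Q W)) = bd k w (e w (rank W a) (Q W))"
    by (rule bd_face) (use sliceD(2)[OF Q W(1)] w k rank_less_card[OF fin W(2)] in auto)
  then show "d (0 + card (W - {a})) (0 + rank W a) ((\<lambda>S\<in>L. bd k (card S) (Q S)) W)
      = (\<lambda>S\<in>L. bd k (card S) (Q S)) (W - {a})"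
    using W Wa w sliceD(3)[OF Q W] by simp
qed (use bd_closed[OF _ k] sliceD(2)[OF Q] in auto)

text \<open>A zigzag is extended path by path. The end \<open>k\<close> is the one at which the next
  path meets the family reached so far, so both orientations are treated alike.\<close>

lemma fam_conn_extension:
  assumes L: "fin_complex L" and K: "fin_complex K" "K \<subseteq> L"
    and U: "U \<in> fam A d L" and conn: "fam_conn K (restrict U K) W"
  shows "\<exists>V\<in>fam A d L. restrict V K = W \<and> fam_conn L U V"
  using conn
proof (induction rule: equivclp_induct)
  case base
  show ?case using U by (intro bexI[of _ U]) auto
next
  case (step W1 W2)
  then obtain V where V: "V \<in> fam A d L" "restrict V K = W1" "fam_conn L U V" by blast
  obtain q k where q: "q \<in> fam P e K" and k: "k \<le> 1"
    and W1: "W1 = (\<lambda>S\<in>K. bd k (card S) (q S))" and W2: "W2 = (\<lambda>S\<in>K. bd (1 - k) (card S) (q S))"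
  proof -
    from step(2) show thesis
    proof
      assume "fam_path K W1 W2"
      then show thesis using that[of _ 0] unfolding fam_path_def by auto
    next
      assume "fam_path K W2 W1"
      then show thesis using that[of _ 1] unfolding fam_path_def by auto
    qed
  qed
  have "bd k (card S) (q S) = V S" if "S \<in> K" for S
    using fun_cong[OF V(2), of S] W1 that by simp
  then obtain Q where Q: "Q \<in> fam P e L" "restrict Q K = q" "\<And>S. S \<in> L \<Longrightarrow> bd k (card S) (Q S) = V S"
    using homotopy_extension[OF L K k V(1) q] by blast
  let ?V = "\<lambda>S\<in>L. bd (1 - k) (card S) (Q S)"
  have Ve: "V = (\<lambda>S\<in>L. bd k (card S) (Q S))"
    using Q(3) sliceD(1)[OF V(1)] by (auto simp: fun_eq_iff extensional_def)
  have "fam_path L V ?V \<or> fam_path L ?V V"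
    using k Q(1) Ve unfolding fam_path_def by (cases "k = 0") (auto simp: le_Suc_eq)
  then have "fam_conn L V ?V" by (metis r_into_equivclp equivclp_sym)
  then have "fam_conn L U ?V" using V(3) by (rule equivclp_trans[rotated])
  moreover have "Q S = q S" if "S \<in> K" for S
    using fun_cong[OF Q(2), of S] that by simp
  then have "restrict ?V K = W2"
    using K(2) unfolding W2 by (auto simp: fun_eq_iff restrict_def)
  moreover have "?V \<in> fam A d L" using bd_fam[OF Q(1) L] by simp
  ultimately show ?case by blast
qed

end

section \<open>Strictification of one of the two homotopies\<close>

text \<open>Naturality is required for faces of positive index only: the structure maps of the free
  slice under the first vertex never delete that vertex. The index \<open>Suc j\<close> accounts for
  the vertex added by \<open>s0\<close>.\<close>

locale homotopy_degeneracy = path_space A d P e bd + inner_kan_set A d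
  for A :: "nat \<Rightarrow> 'a set" and d P e bd +
  fixes s0 :: "nat \<Rightarrow> 'a \<Rightarrow> 'a" and h :: "nat \<Rightarrow> nat \<Rightarrow> 'a \<Rightarrow> 'a"
  assumes s0_closed: "x \<in> A n \<Longrightarrow> 0 < n \<Longrightarrow> s0 n x \<in> A (Suc n)"
    and s0_face: "x \<in> A (Suc n) \<Longrightarrow> 0 < n \<Longrightarrow> 0 < j \<Longrightarrow> j \<le> n \<Longrightarrow>
      d (Suc n) (Suc j) (s0 (Suc n) x) = s0 n (d n j x)"
    and h_closed: "i \<le> 1 \<Longrightarrow> x \<in> A n \<Longrightarrow> 0 < n \<Longrightarrow> h i n x \<in> P n"
    and h_bd0: "i \<le> 1 \<Longrightarrow> x \<in> A n \<Longrightarrow> 0 < n \<Longrightarrow> bd 0 n (h i n x) = d n i (s0 n x)"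
    and h_bd1: "i \<le> 1 \<Longrightarrow> x \<in> A n \<Longrightarrow> 0 < n \<Longrightarrow> bd 1 n (h i n x) = x"
    and h_face: "i \<le> 1 \<Longrightarrow> x \<in> A (Suc n) \<Longrightarrow> 0 < n \<Longrightarrow> 0 < j \<Longrightarrow> j \<le> n \<Longrightarrow>
      e n j (h i (Suc n) x) = h i n (d n j x)"
begin

text \<open>\<open>G n x\<close> is a path of \<open>n\<close>-simplices that starts at
  \<open>s0 n x\<close> and follows the homotopy \<open>h 1\<close> on face 1; its other end will be
  the strict degeneracy. Face 0 is prescribed for vertices only.\<close>

definition is_strictification :: "(nat \<Rightarrow> 'a \<Rightarrow> 'a) \<Rightarrow> bool" where
  "is_strictification G \<longleftrightarrow>
    (\<forall>n>0. \<forall>x\<in>A n. G n x \<in> P (Suc n) \<and> bd 0 (Suc n) (G n x) = s0 n x \<and> e n 1 (G n x) = h 1 n x) \<and>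
    (\<forall>x\<in>A 1. e 1 0 (G 1 x) = h 0 1 x) \<and>
    (\<forall>n>0. \<forall>x\<in>A (Suc n). \<forall>j>0. j \<le> n \<longrightarrow> e (Suc n) (Suc j) (G (Suc n) x) = G n (d n j x))"

text \<open>Face 1 is prescribed by \<open>h 1\<close> and the higher faces by the previous stage
  \<open>g\<close>. Face 0 is left free, so the path comes from lifting a horn.\<close>

lemma strictification_step:
  assumes g: "\<And>x. x \<in> A (Suc n) \<Longrightarrow> g x \<in> P (Suc (Suc n)) \<and> bd 0 (Suc (Suc n)) (g x) = s0 (Suc n) x
      \<and> e (Suc n) 1 (g x) = h 1 (Suc n) x"
    and comp: "\<And>x a b. x \<in> A (Suc (Suc n)) \<Longrightarrow> 2 \<le> a \<Longrightarrow> a < b \<Longrightarrow> b \<le> Suc (Suc n) \<Longrightarrow>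
      e (Suc n) a (g (d (Suc n) (b - 1) x)) = e (Suc n) (b - 1) (g (d (Suc n) (a - 1) x))"
    and x: "x \<in> A (Suc (Suc n))"
  shows "\<exists>Q\<in>P (Suc (Suc (Suc n))). bd 0 (Suc (Suc (Suc n))) Q = s0 (Suc (Suc n)) x
      \<and> e (Suc (Suc n)) 1 Q = h 1 (Suc (Suc n)) x
      \<and> (\<forall>j>0. j \<le> Suc n \<longrightarrow> e (Suc (Suc n)) (Suc j) Q = g (d (Suc n) j x))"
proof -
  define q where "q j = (if j = 1 then h 1 (Suc (Suc n)) x else g (d (Suc n) (j - 1) x))" for j
  have fc: "d (Suc n) j x \<in> A (Suc n)" if "j \<le> Suc n" for j
    using A.face_closed[OF x that] .
  have "\<exists>Q\<in>P (Suc (Suc (Suc n))). bd 0 (Suc (Suc (Suc n))) Q = s0 (Suc (Suc n)) x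
      \<and> (\<forall>j\<le>Suc (Suc n). j \<noteq> 0 \<longrightarrow> e (Suc (Suc n)) j Q = q j)"
  proof (rule lift_horn)
    show "s0 (Suc (Suc n)) x \<in> A (Suc (Suc (Suc n)))" using s0_closed[OF x] by simp
  next
    fix j assume j: "j \<le> Suc (Suc n)" "j \<noteq> 0"
    show "q j \<in> P (Suc (Suc n)) \<and> bd 0 (Suc (Suc n)) (q j) = d (Suc (Suc n)) j (s0 (Suc (Suc n)) x)"
    proof (cases "j = 1")
      case True
      then show ?thesis using h_closed[of 1 x] h_bd0[of 1 x] x unfolding q_def by simp
    next
      case False
      then show ?thesis using g[OF fc, of "j - 1"] s0_face[of x "Suc n" "j - 1"] x j
        unfolding q_def by auto
    qed
  next
    fix a b assume ab: "a < b" "b \<le> Suc (Suc n)" "a \<noteq> 0" "b \<noteq> 0"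
    show "e (Suc n) a (q b) = e (Suc n) (b - 1) (q a)"
    proof (cases "a = 1")
      case True
      then show ?thesis using g[OF fc, of "b - 1"] h_face[of 1 x "Suc n" "b - 1"] x ab
        unfolding q_def by auto
    next
      case False
      then show ?thesis using comp[OF x, of a b] ab unfolding q_def by auto
    qed
  qed auto
  then obtain Q where Q: "Q \<in> P (Suc (Suc (Suc n)))" "bd 0 (Suc (Suc (Suc n))) Q = s0 (Suc (Suc n)) x"
    "\<And>j. j \<le> Suc (Suc n) \<Longrightarrow> j \<noteq> 0 \<Longrightarrow> e (Suc (Suc n)) j Q = q j" by blast
  show ?thesis
    using Q(1,2) Q(3)[of 1] Q(3) unfolding q_def by (intro bexI[of _ Q]) auto
qed

lemma strictification_exists: "\<exists>G. is_strictification G"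
proof -
  \<comment> \<open>The last clause says that the values of \<open>g\<close> on the faces of one
    simplex fit together, as the next stage requires. It passes on to that stage because
    \<open>ext\<close> reduces it to the face identities of \<open>A\<close>.\<close>
  define good where "good n g \<longleftrightarrow>
      (\<forall>x\<in>A (Suc n). g x \<in> P (Suc (Suc n)) \<and> bd 0 (Suc (Suc n)) (g x) = s0 (Suc n) x
        \<and> e (Suc n) 1 (g x) = h 1 (Suc n) x \<and> (n = 0 \<longrightarrow> e 1 0 (g x) = h 0 1 x)) \<and>
      (\<forall>x\<in>A (Suc (Suc n)). \<forall>a b. 2 \<le> a \<longrightarrow> a < b \<longrightarrow> b \<le> Suc (Suc n) \<longrightarrow>
        e (Suc n) a (g (d (Suc n) (b - 1) x)) = e (Suc n) (b - 1) (g (d (Suc n) (a - 1) x)))"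
    for n g
  define ext where "ext n g g' \<longleftrightarrow> (\<forall>x\<in>A (Suc (Suc n)). \<forall>j>0. j \<le> Suc n \<longrightarrow>
      e (Suc (Suc n)) (Suc j) (g' x) = g (d (Suc n) j x))" for n and g g' :: "'a \<Rightarrow> 'a"
  have "\<exists>f. \<forall>n. good n (f n) \<and> ext n (f n) (f (Suc n))"
  proof (rule dependent_nat_choice)
    \<comment> \<open>Over a vertex both faces of the edge can follow their homotopies:
      compatibility is an equation in \<open>P 0\<close>, which has at most one element.\<close>
    have "\<exists>Q\<in>P (Suc 1). bd 0 (Suc 1) Q = s0 1 x \<and> (\<forall>j\<le>1. e 1 j Q = h j 1 x)" if x: "x \<in> A 1" for x
    proof (rule lift)
      show "s0 1 x \<in> A (Suc 1)" using s0_closed[OF x] by simp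
      show "h j 1 x \<in> P 1 \<and> bd 0 1 (h j 1 x) = d 1 j (s0 1 x)" if "j \<le> 1" for j
        using h_closed[OF that x] h_bd0[OF that x] by simp
      show "e (1 - 1) a (h b 1 x) = e (1 - 1) (b - 1) (h a 1 x)" if "a < b" "b \<le> 1" for a b
      proof -
        have "a = 0" "b = 1" using that by auto
        moreover have "e 0 0 (h i 1 x) \<in> P 0" if "i \<le> 1" for i
          using P.face_closed[of "h i 1 x" 0 0] h_closed[OF that x] by simp
        ultimately show ?thesis using P0 by simp
      qed
    qed simp
    then have "\<forall>x\<in>A 1. \<exists>Q. Q \<in> P (Suc 1) \<and> bd 0 (Suc 1) Q = s0 1 x \<and> (\<forall>j\<le>1. e 1 j Q = h j 1 x)"
      by blast
    from bchoice[OF this] obtain g where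
      g: "\<forall>x\<in>A 1. g x \<in> P (Suc 1) \<and> bd 0 (Suc 1) (g x) = s0 1 x \<and> (\<forall>j\<le>1. e 1 j (g x) = h j 1 x)" ..
    then have "good 0 g" unfolding good_def by auto
    then show "\<exists>g. good 0 g" by blast
  next
    fix g n assume g: "good n g"
    have "\<forall>x\<in>A (Suc (Suc n)). \<exists>Q. Q \<in> P (Suc (Suc (Suc n))) \<and> bd 0 (Suc (Suc (Suc n))) Q = s0 (Suc (Suc n)) x
      \<and> e (Suc (Suc n)) 1 Q = h 1 (Suc (Suc n)) x
      \<and> (\<forall>j>0. j \<le> Suc n \<longrightarrow> e (Suc (Suc n)) (Suc j) Q = g (d (Suc n) j x))"
      using strictification_step[of n g] g unfolding good_def by blast
    from bchoice[OF this] obtain g' where g': "\<And>x. x \<in> A (Suc (Suc n)) \<Longrightarrow> g' x \<in> P (Suc (Suc (Suc n)))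
      \<and> bd 0 (Suc (Suc (Suc n))) (g' x) = s0 (Suc (Suc n)) x
      \<and> e (Suc (Suc n)) 1 (g' x) = h 1 (Suc (Suc n)) x
      \<and> (\<forall>j>0. j \<le> Suc n \<longrightarrow> e (Suc (Suc n)) (Suc j) (g' x) = g (d (Suc n) j x))" by blast
    have ext': "e (Suc (Suc n)) (Suc j) (g' y) = g (d (Suc n) j y)"
      if "y \<in> A (Suc (Suc n))" "0 < j" "j \<le> Suc n" for y j using g' that by blast
    then have ext: "ext n g g'" unfolding ext_def by blast
    have "e (Suc (Suc n)) a (g' (d (Suc (Suc n)) (b - 1) x))
        = e (Suc (Suc n)) (b - 1) (g' (d (Suc (Suc n)) (a - 1) x))"
      if x: "x \<in> A (Suc (Suc (Suc n)))" and ab: "2 \<le> a" "a < b" "b \<le> Suc (Suc (Suc n))" for x a b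
    proof -
      have "e (Suc (Suc n)) (Suc (a - 1)) (g' (d (Suc (Suc n)) (b - 1) x))
          = g (d (Suc n) (a - 1) (d (Suc (Suc n)) (b - 1) x))"
        by (rule ext') (use A.face_closed[OF x, of "b - 1"] ab in auto)
      also have "\<dots> = g (d (Suc n) (b - 1 - 1) (d (Suc (Suc n)) (a - 1) x))"
        using A.face_face[OF x, of "a - 1" "b - 1"] ab by simp
      also have "\<dots> = e (Suc (Suc n)) (Suc (b - 1 - 1)) (g' (d (Suc (Suc n)) (a - 1) x))"
        by (rule ext'[symmetric]) (use A.face_closed[OF x, of "a - 1"] ab in auto)
      finally show ?thesis using ab by (simp add: Suc_diff_Suc)
    qed
    then have "good (Suc n) g'" unfolding good_def using g' by blast
    then show "\<exists>g'. good (Suc n) g' \<and> ext n g g'" using ext by blast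
  qed
  then obtain f where f: "\<And>n. good n (f n)" "\<And>n. ext n (f n) (f (Suc n))" by blast
  have "is_strictification (\<lambda>n. f (n - 1))"
    unfolding is_strictification_def
  proof (intro conjI allI impI ballI)
    fix n :: nat and x assume n: "0 < n" and x: "x \<in> A n"
    show "f (n - 1) x \<in> P (Suc n)" "bd 0 (Suc n) (f (n - 1) x) = s0 n x" "e n 1 (f (n - 1) x) = h 1 n x"
      using f(1)[of "n - 1"] n x unfolding good_def by auto
  next
    fix x assume "x \<in> A 1"
    then show "e 1 0 (f (1 - 1) x) = h 0 1 x" using f(1)[of 0] unfolding good_def by simp
  next
    fix n j :: nat and x assume "0 < n" "x \<in> A (Suc n)" "0 < j" "j \<le> n"
    then show "e (Suc n) (Suc j) (f (Suc n - 1) x) = f (n - 1) (d n j x)"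
      using f(2)[of "n - 1"] unfolding ext_def by auto
  qed
  then show ?thesis by blast
qed

definition G :: "nat \<Rightarrow> 'a \<Rightarrow> 'a" where
  "G = (SOME G. is_strictification G)"

lemma G:
  shows "x \<in> A n \<Longrightarrow> 0 < n \<Longrightarrow> G n x \<in> P (Suc n)"
    and "x \<in> A n \<Longrightarrow> 0 < n \<Longrightarrow> bd 0 (Suc n) (G n x) = s0 n x"
    and "x \<in> A n \<Longrightarrow> 0 < n \<Longrightarrow> e n 1 (G n x) = h 1 n x"
    and "x \<in> A 1 \<Longrightarrow> e 1 0 (G 1 x) = h 0 1 x"
    and "x \<in> A (Suc n) \<Longrightarrow> 0 < n \<Longrightarrow> 0 < j \<Longrightarrow> j \<le> n \<Longrightarrow> e (Suc n) (Suc j) (G (Suc n) x) = G n (d n j x)"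
proof -
  have st: "is_strictification G" using someI_ex[OF strictification_exists] unfolding G_def .
  note st1 = st[unfolded is_strictification_def, THEN conjunct1, rule_format]
  note st2 = st[unfolded is_strictification_def, THEN conjunct2, THEN conjunct1, rule_format]
  note st3 = st[unfolded is_strictification_def, THEN conjunct2, THEN conjunct2, rule_format]
  show "x \<in> A n \<Longrightarrow> 0 < n \<Longrightarrow> G n x \<in> P (Suc n)"
    and "x \<in> A n \<Longrightarrow> 0 < n \<Longrightarrow> bd 0 (Suc n) (G n x) = s0 n x"
    and "x \<in> A n \<Longrightarrow> 0 < n \<Longrightarrow> e n 1 (G n x) = h 1 n x"
    using st1[of n x] by simp_all
  show "x \<in> A 1 \<Longrightarrow> e 1 0 (G 1 x) = h 0 1 x"
    by (rule st2)
  show "x \<in> A (Suc n) \<Longrightarrow> 0 < n \<Longrightarrow> 0 < j \<Longrightarrow> j \<le> n \<Longrightarrow> e (Suc n) (Suc j) (G (Suc n) x) = G n (d n j x)"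
    by (rule st3)
qed

definition s :: "nat \<Rightarrow> 'a \<Rightarrow> 'a" where
  "s n x = bd 1 (Suc n) (G n x)"

sublocale inner_kan_degeneracy A d s
proof
  fix x n assume x: "x \<in> A n" and n: "0 < n"
  show "s n x \<in> A (Suc n)" unfolding s_def using bd_closed[OF G(1)[OF x n]] by simp
  have "d n 1 (bd 1 (Suc n) (G n x)) = bd 1 n (e n 1 (G n x))"
    by (rule bd_face) (use G(1)[OF x n] n in auto)
  then show "d n 1 (s n x) = x" unfolding s_def using G(3)[OF x n] h_bd1[OF _ x n] by simp
next
  fix x n j assume *: "x \<in> A (Suc n)" "0 < n" "0 < j" "j \<le> n"
  have "d (Suc n) (Suc j) (bd 1 (Suc (Suc n)) (G (Suc n) x)) = bd 1 (Suc n) (e (Suc n) (Suc j) (G (Suc n) x))"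
    by (rule bd_face) (use G(1)[of x "Suc n"] * in auto)
  then show "d (Suc n) (Suc j) (s (Suc n) x) = s n (d n j x)"
    unfolding s_def using G(5)[OF *] by simp
qed

text \<open>A natural homotopy from \<open>d 0 s0\<close> to \<open>phi\<close>, while \<open>h 0\<close> is one from \<open>d 0 s0\<close> to the identity. They
  agree on vertices.\<close>

definition kappa :: "nat \<Rightarrow> 'a \<Rightarrow> 'a" where
  "kappa n x = e n 0 (G n x)"

text \<open>What \<open>h 0\<close> and \<open>kappa\<close> have in common. By the last clause both
  move a vertex along the same path, face 0 of \<open>G 1 x\<close>, so an edge ending at that
  vertex can follow along \<open>G 1 x\<close> in either case.\<close>

definition natural_path :: "(nat \<Rightarrow> 'a \<Rightarrow> 'a) \<Rightarrow> bool" where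
  "natural_path \<eta> \<longleftrightarrow>
    (\<forall>n>0. \<forall>x\<in>A n. \<eta> n x \<in> P n \<and> bd 0 n (\<eta> n x) = d n 0 (s0 n x)) \<and>
    (\<forall>n>0. \<forall>x\<in>A (Suc n). \<forall>j>0. j \<le> n \<longrightarrow> e n j (\<eta> (Suc n) x) = \<eta> n (d n j x)) \<and>
    (\<forall>x\<in>A 1. \<eta> 1 x = e 1 0 (G 1 x))"

lemma natural_path_h: "natural_path (h 0)"
  unfolding natural_path_def using h_closed h_bd0 h_face G(4) by simp

text \<open>Naturality is inherited from \<open>G\<close>, since taking face 0 turns its faces of
  index \<open>Suc j\<close> into faces of index \<open>j\<close>.\<close>

lemma natural_path_kappa: "natural_path kappa"
  unfolding natural_path_def
proof (intro conjI allI impI ballI)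
  fix n :: nat and x assume n: "0 < n" and x: "x \<in> A n"
  show "kappa n x \<in> P n" unfolding kappa_def using P.face_closed[OF G(1)[OF x n]] by simp
  show "bd 0 n (kappa n x) = d n 0 (s0 n x)"
    unfolding kappa_def using bd_face[OF G(1)[OF x n], of 0 0] G(2)[OF x n] by simp
next
  fix n j :: nat and x assume *: "0 < n" "x \<in> A (Suc n)" "0 < j" "j \<le> n"
  have "e n 0 (e (Suc n) (Suc j) (G (Suc n) x)) = e n j (e (Suc n) 0 (G (Suc n) x))"
    using P.face_face[OF G(1)[OF *(2)], of 0 "Suc j"] * by simp
  then show "e n j (kappa (Suc n) x) = kappa n (d n j x)"
    unfolding kappa_def using G(5)[OF *(2,1,3,4)] by simp
qed (simp add: kappa_def)

lemma bd1_kappa: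
  assumes "x \<in> A n" "0 < n"
  shows "bd 1 n (kappa n x) = phi n x"
  unfolding kappa_def s_def deg_shift_def using bd_face[OF G(1)[OF assms], of 1 0] by simp

text \<open>On vertices \<open>kappa\<close> is \<open>h 0\<close>, which ends at the identity;
  hence \<open>phi\<close> fixes vertices.\<close>

lemma d0_s1:
  assumes "x \<in> A 1"
  shows "d 1 0 (s 1 x) = x"
  using bd1_kappa[OF assms] h_bd1[of 0 x 1] G(4) assms unfolding kappa_def deg_shift_def by simp

end

section \<open>Outer horns on a degenerate edge\<close>

lemma rank_union:
  assumes "finite T" "finite W" "\<And>t w. t \<in> T \<Longrightarrow> w \<in> W \<Longrightarrow> t < w"
  shows "w \<in> W \<Longrightarrow> rank (T \<union> W) w = card T + rank W w" and "t \<in> T \<Longrightarrow> rank (T \<union> W) t = rank T t"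
proof -
  assume w: "w \<in> W"
  have "{v \<in> T \<union> W. v < w} = T \<union> {v \<in> W. v < w}" using assms(3) w by auto
  moreover have "T \<inter> {v \<in> W. v < w} = {}" using assms(3) by blast
  ultimately show "rank (T \<union> W) w = card T + rank W w"
    unfolding rank_def using assms by (simp add: card_Un_disjoint)
next
  assume t: "t \<in> T"
  have "{v \<in> T \<union> W. v < t} = {v \<in> T. v < t}" using assms(3)[OF t] by (auto dest: less_asym)
  then show "rank (T \<union> W) t = rank T t" unfolding rank_def by simp
qed

lemma card_union_less:
  assumes "finite T" "finite W" "\<And>t w. t \<in> T \<Longrightarrow> w \<in> W \<Longrightarrow> (t :: nat) < w"
  shows "card (T \<union> W) = card T + card W"
proof -
  have "T \<inter> W = {}" using assms(3) by blast
  then show ?thesis using assms by (simp add: card_Un_disjoint)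
qed

text \<open>The adjunction between joins and slices, for a simplex \<open>T\<close> whose vertices
  precede all vertices of \<open>J\<close>.\<close>

lemma fam_to_slice:
  assumes U: "U \<in> fam A d L" and J: "fin_complex J" and T: "finite T"
    and TW: "\<And>W. W \<in> J \<Longrightarrow> T \<union> W \<in> L" "\<And>t w W. t \<in> T \<Longrightarrow> w \<in> W \<Longrightarrow> W \<in> J \<Longrightarrow> t < w"
  shows "(\<lambda>W\<in>J. U (T \<union> W)) \<in> slice A d J (card T)"
proof (rule sliceI)
  fix W assume W: "W \<in> J"
  have fin: "finite W" using fin_complexD(3)[OF J W] .
  show "(\<lambda>W\<in>J. U (T \<union> W)) W \<in> A (card T + card W)"
    using sliceD(2)[OF U TW(1)[OF W]] card_union_less[OF T fin] TW(2) W by auto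
  fix a assume a: "a \<in> W"
  have Wa: "W - {a} \<in> J" using fin_complexD(5)[OF J W] .
  have "a \<notin> T" using TW(2) a W by blast
  then have "T \<union> W - {a} = T \<union> (W - {a})" by auto
  moreover have "card (T \<union> (W - {a})) = card T + card (W - {a})"
    using card_union_less[OF T, of "W - {a}"] fin TW(2)[OF _ _ Wa] by simp
  moreover have "rank (T \<union> W) a = card T + rank W a"
    using rank_union(1)[OF T fin _ a] TW(2)[OF _ _ W] by simp
  ultimately show "d (card T + card (W - {a})) (card T + rank W a) ((\<lambda>W\<in>J. U (T \<union> W)) W)
      = (\<lambda>W\<in>J. U (T \<union> W)) (W - {a})"
    using sliceD(3)[OF U TW(1)[OF W], of a] a W Wa by simp
qed simp

lemma slice_face_fam:
  assumes U: "U \<in> fam A d L" and J: "fin_complex J" and T: "finite T" "t \<in> T" "card T = Suc k"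
    and TW: "\<And>W. W \<in> J \<Longrightarrow> T \<union> W \<in> L" "\<And>t w W. t \<in> T \<Longrightarrow> w \<in> W \<Longrightarrow> W \<in> J \<Longrightarrow> t < w"
  shows "slice_face d J k (rank T t) (\<lambda>W\<in>J. U (T \<union> W)) = (\<lambda>W\<in>J. U ((T - {t}) \<union> W))"
proof
  fix W
  show "slice_face d J k (rank T t) (\<lambda>W\<in>J. U (T \<union> W)) W = (\<lambda>W\<in>J. U ((T - {t}) \<union> W)) W"
  proof (cases "W \<in> J")
    case W: True
    have fin: "finite W" using fin_complexD(3)[OF J W] .
    have "t \<notin> W" using TW(2)[OF T(2) _ W] by blast
    then have "T \<union> W - {t} = (T - {t}) \<union> W" by auto
    moreover have "card ((T - {t}) \<union> W) = k + card W"
      using card_union_less[of "T - {t}" W] fin TW(2)[OF _ _ W] T by simp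
    moreover have "rank (T \<union> W) t = rank T t"
      using rank_union(2)[OF T(1) fin _ T(2)] TW(2)[OF _ _ W] by simp
    ultimately show ?thesis
      using sliceD(3)[OF U TW(1)[OF W], of t] T W by (simp add: slice_face_def)
  qed (simp add: slice_face_def)
qed

context homotopy_degeneracy
begin

text \<open>A natural path is natural in faces of positive index, so it fits together on the
  simplices with first vertex \<open>v\<close>. A simplex without the apex moves along face 0 of the
  path of its cone.\<close>

definition cone_path :: "(nat \<Rightarrow> 'a \<Rightarrow> 'a) \<Rightarrow> nat \<Rightarrow> nat set set \<Rightarrow> (nat set \<Rightarrow> 'a) \<Rightarrow> nat set \<Rightarrow> 'a" where
  "cone_path \<eta> v K U = (\<lambda>S\<in>K. if v \<in> S then \<eta> (card S) (U S)
     else e (card S) 0 (\<eta> (Suc (card S)) (U (insert v S))))"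

definition cone_complex :: "nat \<Rightarrow> nat set set \<Rightarrow> bool" where
  "cone_complex v K \<longleftrightarrow> fin_complex K \<and> (\<forall>S\<in>K. insert v S \<in> K \<and> (\<forall>w\<in>S. v \<le> w))"

lemma cone_complexD:
  assumes "cone_complex v K"
  shows "fin_complex K" "S \<in> K \<Longrightarrow> insert v S \<in> K" "S \<in> K \<Longrightarrow> w \<in> S \<Longrightarrow> v \<le> w"
  using assms unfolding cone_complex_def by auto

text \<open>Deleting the apex is the definition, deleting another vertex of a simplex with apex is
  naturality. Without the apex, the face identity of \<open>P\<close> reduces the claim to
  naturality on the cone.\<close>

lemma cone_path_fam:
  assumes \<eta>: "natural_path \<eta>" and K: "cone_complex v K" and U: "U \<in> fam A d K"
  shows "cone_path \<eta> v K U \<in> fam P e K"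
proof (rule sliceI)
  have \<eta>P: "\<eta> n x \<in> P n" if "x \<in> A n" "0 < n" for n x using \<eta> that unfolding natural_path_def by blast
  have \<eta>f: "e n j (\<eta> (Suc n) x) = \<eta> n (d n j x)" if "x \<in> A (Suc n)" "0 < n" "0 < j" "j \<le> n" for n x j
    using \<eta> that unfolding natural_path_def by blast
  note fin = fin_complexD(3)[OF cone_complexD(1)[OF K]]
  have mem: "U S \<in> A (card S)" if "S \<in> K" for S using sliceD(2)[OF U that] by simp
  have ins: "insert v S \<in> K" "card (insert v S) = Suc (card S)" "U (insert v S) \<in> A (Suc (card S))"
    if "S \<in> K" "v \<notin> S" for S
    using cone_complexD(2)[OF K that(1)] fin[OF that(1)] that mem[of "insert v S"] by auto
  fix S assume S: "S \<in> K"
  show "cone_path \<eta> v K U S \<in> P (0 + card S)"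
  proof (cases "v \<in> S")
    case True
    then have "0 < card S" using fin[OF S] card_gt_0_iff by blast
    then show ?thesis using \<eta>P[OF mem[OF S]] S True by (simp add: cone_path_def)
  next
    case False
    then show ?thesis using P.face_closed[OF \<eta>P[OF ins(3)[OF S False]]] S by (simp add: cone_path_def)
  qed
  fix a assume a: "a \<in> S"
  have Sa: "S - {a} \<in> K" using fin_complexD(5)[OF cone_complexD(1)[OF K] S] .
  obtain w where w: "card S = Suc w" "card (S - {a}) = w" using a fin[OF S] by (metis card_Suc_Diff1)
  have r: "rank S a \<le> w" using rank_less_card[OF fin[OF S] a] w by simp
  have Ua: "d w (rank S a) (U S) = U (S - {a})" using sliceD(3)[OF U S a] w by simp
  have "e w (rank S a) (cone_path \<eta> v K U S) = cone_path \<eta> v K U (S - {a})"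
  proof (cases "v \<in> S")
    case v: True
    show ?thesis
    proof (cases "a = v")
      case True
      have "rank S a = 0" unfolding True by (rule rank_min) (rule cone_complexD(3)[OF K S])
      moreover have "insert v (S - {a}) = S" "v \<notin> S - {a}" using v True by auto
      moreover from this have "cone_path \<eta> v K U (S - {a}) = e w 0 (\<eta> (Suc w) (U S))"
        unfolding cone_path_def using Sa w(2) by (simp only: restrict_apply' if_False)
      moreover have "cone_path \<eta> v K U S = \<eta> (Suc w) (U S)" using S v w(1) by (simp add: cone_path_def)
      ultimately show ?thesis by simp
    next
      case False
      have va: "v < a" using cone_complexD(3)[OF K S a] False by simp
      have "0 < rank S a" using rank_less[OF fin[OF S] v va] by simp
      moreover have "0 < w" using r calculation by simp
      ultimately show ?thesis using \<eta>f[of "U S" w "rank S a"] mem[OF S] w r Ua S Sa v False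
        by (simp add: cone_path_def)
    qed
  next
    case v: False
    have va: "v < a" using cone_complexD(3)[OF K S a] v a by (metis le_neq_implies_less)
    let ?S = "insert v S"
    have rS: "rank ?S a = Suc (rank S a)" using rank_insert_min[OF fin[OF S] v va] .
    have ve: "?S - {a} = insert v (S - {a})" using va by auto
    have Uv: "U ?S \<in> A (Suc (Suc w))" using ins(3)[OF S v] w by simp
    have "card (?S - {a}) = Suc w" using ve v w fin[OF S] by simp
    then have dU: "d (Suc w) (Suc (rank S a)) (U ?S) = U (insert v (S - {a}))"
      using sliceD(3)[OF U ins(1)[OF S v], of a] a rS ve by simp
    have "e w (rank S a) (e (Suc w) 0 (\<eta> (Suc (Suc w)) (U ?S)))
        = e w 0 (e (Suc w) (Suc (rank S a)) (\<eta> (Suc (Suc w)) (U ?S)))"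
      using P.face_face[of "\<eta> (Suc (Suc w)) (U ?S)" w 0 "Suc (rank S a)"] \<eta>P[OF Uv] r by simp
    also have "\<dots> = e w 0 (\<eta> (Suc w) (U (insert v (S - {a}))))"
      using \<eta>f[OF Uv, of "Suc (rank S a)"] r dU by simp
    finally show ?thesis using S Sa v w by (simp add: cone_path_def)
  qed
  then show "e (0 + card (S - {a})) (0 + rank S a) (cone_path \<eta> v K U S) = cone_path \<eta> v K U (S - {a})"
    using w by simp
qed (simp add: cone_path_def)

text \<open>The end of the movement along \<open>kappa\<close>. Since \<open>phi\<close> preserves
  face 0, the simplices without the apex come back to their original values.\<close>

definition cone_shift :: "nat \<Rightarrow> nat set set \<Rightarrow> (nat set \<Rightarrow> 'a) \<Rightarrow> nat set \<Rightarrow> 'a" where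
  "cone_shift v K U = (\<lambda>S\<in>K. if v \<in> S then phi (card S) (U S) else U S)"

lemma cone_path_ends:
  assumes K: "cone_complex v K" and U: "U \<in> fam A d K" and S: "S \<in> K"
  shows "bd 0 (card S) (cone_path (h 0) v K U S) = bd 0 (card S) (cone_path kappa v K U S)"
    and "bd 1 (card S) (cone_path (h 0) v K U S) = U S"
    and "bd 1 (card S) (cone_path kappa v K U S) = cone_shift v K U S"
proof -
  have fin: "finite S" using fin_complexD(3)[OF cone_complexD(1)[OF K] S] .
  have US: "U S \<in> A (card S)" using sliceD(2)[OF U S] by simp
  note n1 = natural_path_h and n2 = natural_path_kappa
  have "bd 0 (card S) (cone_path (h 0) v K U S) = bd 0 (card S) (cone_path kappa v K U S)
    \<and> bd 1 (card S) (cone_path (h 0) v K U S) = U S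
    \<and> bd 1 (card S) (cone_path kappa v K U S) = cone_shift v K U S"
  proof (cases "v \<in> S")
    case True
    then have "0 < card S" using fin card_gt_0_iff by blast
    then show ?thesis
      using n1 n2 True US S h_bd1[OF _ US] bd1_kappa[OF US]
      unfolding natural_path_def by (simp add: cone_path_def cone_shift_def)
  next
    case False
    let ?x = "U (insert v S)"
    have iS: "insert v S \<in> K" using cone_complexD(2)[OF K S] .
    have x: "?x \<in> A (Suc (card S))" using sliceD(2)[OF U iS] fin False by simp
    have "rank (insert v S) v = 0" by (rule rank_min) (rule cone_complexD(3)[OF K iS])
    then have dx: "d (card S) 0 ?x = U S"
      using sliceD(3)[OF U iS, of v] False by simp
    have p: "\<eta> (Suc (card S)) ?x \<in> P (Suc (card S))
       \<and> bd 0 (Suc (card S)) (\<eta> (Suc (card S)) ?x) = d (Suc (card S)) 0 (s0 (Suc (card S)) ?x)"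
      if "natural_path \<eta>" for \<eta>
      using that x unfolding natural_path_def by blast
    have b: "bd k (card S) (e (card S) 0 (\<eta> (Suc (card S)) ?x))
        = d (card S) 0 (bd k (Suc (card S)) (\<eta> (Suc (card S)) ?x))" if "natural_path \<eta>" "k \<le> 1" for \<eta> k
      using bd_face[of "\<eta> (Suc (card S)) ?x" "card S" k 0] p[OF that(1)] that(2) by simp
    show ?thesis
      using False S p[OF n1] p[OF n2] b[OF n1] b[OF n2] h_bd1[OF _ x] bd1_kappa[OF x] d0_phi[OF x] dx
      by (simp add: cone_path_def cone_shift_def)
  qed
  then show "bd 0 (card S) (cone_path (h 0) v K U S) = bd 0 (card S) (cone_path kappa v K U S)"
    "bd 1 (card S) (cone_path (h 0) v K U S) = U S"
    "bd 1 (card S) (cone_path kappa v K U S) = cone_shift v K U S" by auto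
qed

lemma fam_conn_common_start:
  assumes "Q1 \<in> fam P e K" "Q2 \<in> fam P e K"
    and "\<And>S. S \<in> K \<Longrightarrow> bd 0 (card S) (Q1 S) = bd 0 (card S) (Q2 S)"
    and "\<And>S. S \<in> K \<Longrightarrow> bd 1 (card S) (Q1 S) = U S" "\<And>S. S \<in> K \<Longrightarrow> bd 1 (card S) (Q2 S) = V S"
  shows "fam_conn K (restrict U K) (restrict V K)"
proof -
  let ?W = "\<lambda>S\<in>K. bd 0 (card S) (Q1 S)"
  have p1: "fam_path K ?W (restrict U K)"
    unfolding fam_path_def using assms by (intro bexI[of _ Q1] conjI restrict_ext) simp_all
  have p2: "fam_path K ?W (restrict V K)"
    unfolding fam_path_def using assms by (intro bexI[of _ Q2] conjI restrict_ext) simp_all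
  show ?thesis
    using equivclp_trans[OF equivclp_sym[OF r_into_equivclp[of "fam_path K", OF p1]] r_into_equivclp[of "fam_path K", OF p2]] .
qed

text \<open>The movements along \<open>h 0\<close> and along \<open>kappa\<close> have the same
  start; the first ends at \<open>U\<close>, the second at the shifted family.\<close>

lemma fam_conn_cone_shift:
  assumes K: "cone_complex v K" and U: "U \<in> fam A d K"
  shows "fam_conn K U (cone_shift v K U)"
proof -
  have "fam_conn K (restrict U K) (restrict (cone_shift v K U) K)"
    by (rule fam_conn_common_start[OF cone_path_fam[OF natural_path_h K U] cone_path_fam[OF natural_path_kappa K U]])
       (use cone_path_ends[OF K U] in auto)
  moreover have "restrict U K = U" using sliceD(1)[OF U] by (simp add: extensional_restrict)
  moreover have "restrict (cone_shift v K U) K = cone_shift v K U" by (simp add: cone_shift_def fun_eq_iff)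
  ultimately show ?thesis by simp
qed

end

section \<open>Families on a single edge\<close>

definition edge_fam :: "(nat \<Rightarrow> nat \<Rightarrow> 'a \<Rightarrow> 'a) \<Rightarrow> 'a \<Rightarrow> nat set \<Rightarrow> 'a" where
  "edge_fam d y = (\<lambda>S\<in>Pow {0, 1}. if S = {0, 1} then y else if S = {0} then d 1 1 y
     else if S = {1} then d 1 0 y else d 0 0 (d 1 0 y))"

lemma edge_fam_simps:
  "edge_fam d y {0, 1} = y" "edge_fam d y {0} = d 1 1 y" "edge_fam d y {1} = d 1 0 y"
  "edge_fam d y {} = d 0 0 (d 1 0 y)"
  by (auto simp: edge_fam_def doubleton_eq_iff)

lemma rank_edge: "rank {0, 1} 0 = 0" "rank {0, 1} 1 = 1" "rank {v} v = 0"
proof -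
  have "{v \<in> {0, 1}. v < (1 :: nat)} = {0}" "{w \<in> {v}. w < v} = {}" by auto
  then show "rank {0, 1} 0 = 0" "rank {0, 1} 1 = 1" "rank {v} v = 0" by (simp_all add: rank_def)
qed

lemma edge_remove: "{0, 1} - {0} = {1 :: nat}" "{0, 1} - {1} = {0 :: nat}"
  by auto

lemma Pow_edge_cases:
  assumes "S \<in> Pow {0, 1 :: nat}"
  obtains "S = {0, 1}" | "S = {0}" | "S = {1}" | "S = {}"
  using assms by blast

lemma fin_complex_Pow: "finite V \<Longrightarrow> fin_complex (Pow V)"
  unfolding fin_complex_def by (auto intro: finite_subset)

lemma (in face_set) edge_fam_closed:
  assumes y: "y \<in> A 2"
  shows "edge_fam d y \<in> fam A d (Pow {0, 1})"
proof (rule sliceI)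
  have y': "y \<in> A (Suc 1)" using y by (simp add: numeral_2_eq_2)
  have c: "d 1 i y \<in> A 1" if "i \<le> 1" for i using face_closed[OF y' that] .
  have c': "d 1 i y \<in> A (Suc 0)" if "i \<le> 1" for i using c[OF that] by simp
  have p: "d 0 0 (d 1 0 y) \<in> A 0" using face_closed[OF c'] by simp
  have q: "d 0 0 (d 1 1 y) = d 0 0 (d 1 0 y)" using face_face[of y 0 0 1] y by (simp add: numeral_2_eq_2)
  fix S assume S: "S \<in> Pow {0, 1 :: nat}"
  then show "edge_fam d y S \<in> A (0 + card S)"
  proof (cases rule: Pow_edge_cases)
    case 1
    then show ?thesis using y by (simp only: edge_fam_simps) (simp add: numeral_2_eq_2)
  qed (use y c p in \<open>simp_all only: edge_fam_simps, simp_all\<close>)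
  fix a assume a: "a \<in> S"
  from S show "d (0 + card (S - {a})) (0 + rank S a) (edge_fam d y S) = edge_fam d y (S - {a})"
  proof (cases rule: Pow_edge_cases)
    case 1
    then have "a = 0 \<or> a = 1" using a by auto
    then show ?thesis
    proof
      assume "a = 0"
      show ?thesis unfolding 1 \<open>a = 0\<close> edge_remove edge_fam_simps rank_edge by simp
    next
      assume "a = 1"
      show ?thesis unfolding 1 \<open>a = 1\<close> edge_remove edge_fam_simps rank_edge by simp
    qed
  next
    case 2
    then have "a = 0" using a by simp
    show ?thesis unfolding 2 \<open>a = 0\<close> Diff_cancel edge_fam_simps rank_edge using q by simp
  next
    case 3
    then have "a = 1" using a by simp
    show ?thesis unfolding 3 \<open>a = 1\<close> Diff_cancel edge_fam_simps rank_edge by simp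
  next
    case 4
    then show ?thesis using a by simp
  qed
qed (simp add: edge_fam_def)

lemma edge_fam_restrict:
  assumes U: "U \<in> fam A d L" and L: "Pow {0, 1} \<subseteq> L"
  shows "restrict U (Pow {0, 1}) = edge_fam d (U {0, 1})"
proof
  fix S
  have m: "{0, 1} \<in> L" "{0} \<in> L" "{1} \<in> L" using L by auto
  have e1: "d 1 0 (U {0, 1}) = U {1}"
    using sliceD(3)[OF U m(1), of 0] unfolding edge_remove rank_edge by simp
  have e2: "d 1 1 (U {0, 1}) = U {0}"
    using sliceD(3)[OF U m(1), of 1] unfolding edge_remove rank_edge by simp
  have e3: "d 0 0 (U {1}) = U {}"
    using sliceD(3)[OF U m(3), of 1] unfolding Diff_cancel rank_edge by simp
  show "restrict U (Pow {0, 1}) S = edge_fam d (U {0, 1}) S"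
  proof (cases "S \<in> Pow {0, 1}")
    case True
    then show ?thesis
    proof (cases rule: Pow_edge_cases)
    qed (use True e1 e2 e3 in \<open>simp_all only: restrict_apply' edge_fam_simps\<close>)
  qed (simp add: edge_fam_def)
qed

context path_space
begin

lemma fam_conn_edge:
  assumes "pt_conn 2 y z"
  shows "fam_conn (Pow {0, 1}) (edge_fam d y) (edge_fam d z)"
proof -
  have step: "fam_path (Pow {0, 1}) (edge_fam d y) (edge_fam d z)" if yz: "pt_path 2 y z" for y z
  proof -
    obtain q where q: "q \<in> P 2" "bd 0 2 q = y" "bd 1 2 q = z" using yz unfolding pt_path_def by blast
    have bd: "edge_fam d (bd k 2 q) = (\<lambda>S\<in>Pow {0, 1}. bd k (card S) (edge_fam e q S))" if k: "k \<le> 1" for k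
    proof -
      let ?V = "\<lambda>S\<in>Pow {0, 1}. bd k (card S) (edge_fam e q S)"
      have "?V \<in> fam A d (Pow {0, 1})"
        by (rule bd_fam[OF P.edge_fam_closed[OF q(1)] _ k]) (simp add: fin_complex_Pow)
      then have "restrict ?V (Pow {0, 1}) = edge_fam d (?V {0, 1})" by (rule edge_fam_restrict) simp
      also have "?V {0, 1} = bd k 2 q" by (simp add: edge_fam_simps del: One_nat_def flip: numeral_2_eq_2)
      also have "restrict ?V (Pow {0, 1}) = ?V" by (rule ext) simp
      finally show ?thesis ..
    qed
    show ?thesis unfolding fam_path_def
      by (rule bexI[of _ "edge_fam e q"]) (use bd[of 0] bd[of 1] q P.edge_fam_closed in simp_all)
  qed
  show ?thesis by (rule equivclp_map[where r = "pt_path 2" and f = "edge_fam d"], rule step) (use assms in simp_all)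
qed

end

section \<open>Deforming and filling an outer horn\<close>

definition horn_complex :: "nat \<Rightarrow> nat \<Rightarrow> nat set set" where
  "horn_complex N i = {S. S \<subseteq> {..N} \<and> (\<exists>j\<le>N. j \<noteq> i \<and> j \<notin> S)}"

lemma fin_complex_horn: "0 < N \<Longrightarrow> fin_complex (horn_complex N i)"
proof -
  assume N: "0 < N"
  have "horn_complex N i \<subseteq> Pow {..N}" unfolding horn_complex_def by auto
  then have "finite (horn_complex N i)" by (rule finite_subset) simp
  moreover have "{} \<in> horn_complex N i"
    unfolding horn_complex_def using N by (auto intro: exI[of _ "if i = 0 then 1 else 0"])
  ultimately show ?thesis unfolding fin_complex_def horn_complex_def
    by (auto intro: finite_subset[of _ "{..N}"])
qed

context homotopy_degeneracy
begin

text \<open>Vertex 1 moves along \<open>\<eta> 1 x\<close>, which is face 0 of \<open>G 1 x\<close>.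
  So the edge \<open>{0, 1}\<close> may move along \<open>G 1 x\<close> and vertex 0 along its face
  1.\<close>

lemma edge_homotopy:
  assumes K: "cone_complex 1 K" "{0} \<notin> K" "{0, 1} \<notin> K" "{1} \<in> K" and U: "U \<in> fam A d K"
    and x: "x \<in> A 1" and \<eta>: "natural_path \<eta>" and Ux: "U {1} = x"
  shows "(cone_path \<eta> 1 K U)({0} := e 1 1 (G 1 x), {0, 1} := G 1 x) \<in> fam P e (insert {0, 1} (insert {0} K))"
proof -
  have Kc: "fin_complex K" using cone_complexD(1)[OF K(1)] .
  have K': "fin_complex (insert {0} K)"
    using Kc unfolding fin_complex_def by (auto simp: subset_singleton_iff)
  have g: "G 1 x \<in> P (Suc 1)" using G(1)[OF x] by simp
  have g1: "e 1 1 (G 1 x) \<in> P 1" using P.face_closed[OF g, of 1] by simp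
  have cp: "cone_path \<eta> 1 K U \<in> fam P e K" using cone_path_fam[OF \<eta> K(1) U] .
  have a1: "(cone_path \<eta> 1 K U)({0} := e 1 1 (G 1 x)) \<in> fam P e (insert {0} K)"
  proof (rule slice_add_cell[OF cp Kc K(2)])
    show "{0} - {a} \<in> K" if "a \<in> {0}" for a :: nat using that fin_complexD(2)[OF Kc] by simp
    fix a :: nat assume "a \<in> {0}"
    then have a: "a = 0" by simp
    have "e 0 0 (e 1 1 (G 1 x)) \<in> P 0" using P.face_closed[of "e 1 1 (G 1 x)" 0 0] g1 by simp
    moreover have "cone_path \<eta> 1 K U {} \<in> P 0" using sliceD(2)[OF cp fin_complexD(2)[OF Kc]] by simp
    ultimately show "e (0 + card ({0} - {a})) (0 + rank {0} a) (e 1 1 (G 1 x)) = cone_path \<eta> 1 K U ({0} - {a})"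
      unfolding a Diff_cancel rank_edge using P0 by simp
  qed (use g1 in simp)
  show ?thesis
  proof (rule slice_add_cell[OF a1 K'])
    show "{0, 1} \<notin> insert {0} K" using K(3) by auto
    show "{0, 1} - {a} \<in> insert {0} K" if "a \<in> {0, 1}" for a :: nat
    proof -
      have "a = 0 \<or> a = 1" using that by blast
      then show ?thesis using K(4) by (elim disjE) (simp_all only: edge_remove insertI1 insertI2)
    qed
    show "G 1 x \<in> P (0 + card {0, 1 :: nat})" using g by simp
    fix a :: nat assume "a \<in> {0, 1}"
    then consider "a = 0" | "a = 1" by blast
    then show "e (0 + card ({0, 1} - {a})) (0 + rank {0, 1} a) (G 1 x)
        = ((cone_path \<eta> 1 K U)({0} := e 1 1 (G 1 x))) ({0, 1} - {a})"
    proof cases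
      case 1
      have "\<eta> 1 x = e 1 0 (G 1 x)" using \<eta> x unfolding natural_path_def by blast
      then show ?thesis unfolding 1 edge_remove rank_edge using K(4) Ux by (simp add: cone_path_def)
    next
      case 2
      show ?thesis unfolding 2 edge_remove rank_edge by simp
    qed
  qed
qed

text \<open>Moves a cone with apex 1 into the image of \<open>phi\<close>. Meanwhile the edge from 0 to 1 runs along \<open>G x\<close>
  and back, so that it is \<open>s x\<close> again in the end.\<close>

lemma shift_second_vertex:
  assumes L: "fin_complex L" "insert {0, 1} (insert {0} K) \<subseteq> L"
    and K: "cone_complex 1 K" "{0} \<notin> K" "{0, 1} \<notin> K" "{1} \<in> K"
    and U: "U \<in> fam A d L" and x: "x \<in> A 1" and U01: "U {0, 1} = s 1 x"
  shows "\<exists>V\<in>fam A d L. fam_conn L U V \<and> V {0, 1} = s 1 x \<and> (\<forall>S\<in>K. V S = cone_shift 1 K U S)"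
proof -
  let ?K = "insert {0, 1} (insert {0} K)"
  have Kc: "fin_complex K" using cone_complexD(1)[OF K(1)] .
  have K': "fin_complex ?K"
  proof -
    have "V \<in> ?K" if "V \<subseteq> {0, 1}" for V
    proof -
      have "V \<in> Pow {0, 1}" using that by simp
      then show ?thesis by (cases rule: Pow_edge_cases) (use K fin_complexD(2)[OF Kc] in auto)
    qed
    then show ?thesis using Kc unfolding fin_complex_def by (auto simp: subset_singleton_iff)
  qed
  define U' where "U' = restrict U K"
  have U': "U' \<in> fam A d K" unfolding U'_def by (rule slice_restrict[OF U Kc]) (use L in auto)
  have m: "{0, 1} \<in> L" "{0} \<in> L" using L(2) by auto
  have Ux: "U {1} = x" using sliceD(3)[OF U m(1), of 0] d0_s1[OF x]
    unfolding U01 edge_remove rank_edge by simp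
  have d1: "d 1 1 (s 1 x) = x" using d1_s[OF x] by simp
  have U0: "U {0} = x" using sliceD(3)[OF U m(1), of 1] d1
    unfolding U01 edge_remove rank_edge by simp
  have U'x: "U' {1} = x" using Ux K(4) by (simp add: U'_def)
  have g: "G 1 x \<in> P (Suc 1)" using G(1)[OF x] by simp
  let ?Q = "\<lambda>\<eta>. (cone_path \<eta> 1 K U')({0} := e 1 1 (G 1 x), {0, 1} := G 1 x)"
  \<comment> \<open>The end of the movement along \<open>kappa\<close>: vertex 0 and the edge
    \<open>{0, 1}\<close> have the values \<open>x\<close> and \<open>s 1 x\<close> that they have
    in \<open>U\<close>.\<close>
  let ?W = "(cone_shift 1 K U')({0} := x, {0, 1} := s 1 x)"
  have bd1: "bd 1 (card {0, 1 :: nat}) (G 1 x) = s 1 x" "bd 1 (card {0 :: nat}) (e 1 1 (G 1 x)) = x"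
    using bd_face[OF g, of 1 1] d1 by (simp_all add: s_def)
  have "fam_conn ?K (restrict U ?K) (restrict ?W ?K)"
  proof (rule fam_conn_common_start)
    show "?Q (h 0) \<in> fam P e ?K" "?Q kappa \<in> fam P e ?K"
      by (intro edge_homotopy K U' x natural_path_h natural_path_kappa U'x)+
    fix S assume "S \<in> ?K"
    then consider "S = {0, 1}" | "S = {0}" "S \<noteq> {0, 1}" | "S \<in> K" "S \<noteq> {0, 1}" "S \<noteq> {0}" using K by blast
    then have "bd 0 (card S) (?Q (h 0) S) = bd 0 (card S) (?Q kappa S)
      \<and> bd 1 (card S) (?Q (h 0) S) = U S \<and> bd 1 (card S) (?Q kappa S) = ?W S"
    proof cases
      case 1
      then show ?thesis using bd1 U01 by simp
    next
      case 2
      then show ?thesis using bd1 U0 by auto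
    next
      case 3
      then show ?thesis using cone_path_ends[OF K(1) U' 3(1)] by (auto simp: U'_def)
    qed
    then show "bd 0 (card S) (?Q (h 0) S) = bd 0 (card S) (?Q kappa S)"
      "bd 1 (card S) (?Q (h 0) S) = U S" "bd 1 (card S) (?Q kappa S) = ?W S" by blast+
  qed
  then obtain V where V: "V \<in> fam A d L" "restrict V ?K = restrict ?W ?K" "fam_conn L U V"
    using fam_conn_extension[OF L(1) K' L(2) U] by blast
  have VW: "V S = ?W S" if "S \<in> ?K" for S using fun_cong[OF V(2), of S] that by simp
  have "V {0, 1} = s 1 x" using VW by simp
  moreover have "V S = cone_shift 1 K U S" if "S \<in> K" for S
    using VW[of S] that K by (auto simp: cone_shift_def U'_def)
  ultimately show ?thesis using V by blast
qed

text \<open>The given horn is deformed three times until it consists of \<open>phi\<close> of an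
  edge \<open>f\<close> in the slice over \<open>J\<close> and \<open>phi\<close> of a lift
  \<open>b0\<close> of its source to \<open>E\<close>; then \<open>outer_fill_slice\<close>
  applies.\<close>

theorem outer_horn:
  assumes N: "2 \<le> N" and U: "U \<in> fam A d (horn_complex N 0)" and x: "x \<in> A 1"
    and conn: "pt_conn 2 (U {0, 1}) (s0 1 x)"
  obtains V v where "V \<in> fam A d (horn_complex N 0)" "fam_conn (horn_complex N 0) U V"
    "v \<in> A (Suc N)" "\<And>j. 1 \<le> j \<Longrightarrow> j \<le> N \<Longrightarrow> d N j v = V ({..N} - {j})"
proof -
  let ?L = "horn_complex N 0"
  have L: "fin_complex ?L" using fin_complex_horn N by simp
  have coneL: "cone_complex 0 ?L"
    unfolding cone_complex_def using L by (auto simp: horn_complex_def)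
  have edgeL: "Pow {0, 1} \<subseteq> ?L"
    unfolding horn_complex_def using N by (auto intro!: exI[of _ 2])
  have "pt_path 2 (s0 1 x) (s 1 x)"
    unfolding pt_path_def using G(1,2)[OF x] by (auto simp: s_def numeral_2_eq_2)
  \<comment> \<open>First deformation: the edge \<open>{0, 1}\<close> becomes equal to
    \<open>s 1 x\<close>, and homotopy extension carries the rest of the horn along.\<close>
  then have "pt_conn 2 (U {0, 1}) (s 1 x)" using conn by (metis equivclp_trans r_into_equivclp)
  then have "fam_conn (Pow {0, 1}) (restrict U (Pow {0, 1})) (edge_fam d (s 1 x))"
    unfolding edge_fam_restrict[OF U edgeL] by (rule fam_conn_edge)
  then obtain U1 where U1: "U1 \<in> fam A d ?L" "restrict U1 (Pow {0, 1}) = edge_fam d (s 1 x)"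
    "fam_conn ?L U U1"
    using fam_conn_extension[OF L _ edgeL U] fin_complex_Pow[of "{0, 1}"] by blast
  have U1_01: "U1 {0, 1} = s 1 x" using fun_cong[OF U1(2), of "{0, 1}"] by (simp add: edge_fam_simps del: One_nat_def)
  have U1_1: "U1 {1} = x"
  proof -
    have "{0, 1} \<in> ?L" using edgeL by auto
    from sliceD(3)[OF U1(1) this, of 0] show ?thesis
      unfolding U1_01 edge_remove rank_edge using d0_s1[OF x] by simp
  qed

  \<comment> \<open>\<open>J\<close> is the boundary of the simplex on \<open>{2..N}\<close>,
    \<open>E\<close> is that simplex with all its faces, and \<open>K\<close> is the cone on
    \<open>J\<close> with apex 1.\<close>
  define J where "J = Pow {2..N} - {{2..N}}"
  define E where "E = Pow {2..N}"
  define K where "K = {S. S \<subseteq> {1..N} \<and> S \<inter> {2..N} \<noteq> {2..N}}"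
  have E: "fin_complex E" unfolding E_def by (rule fin_complex_Pow) simp
  have J: "fin_complex J" unfolding J_def fin_complex_def using N by (auto intro: finite_subset)
  have JE: "J \<subseteq> E" unfolding J_def E_def by auto
  have "K \<subseteq> Pow {1..N}" unfolding K_def by auto
  then have "finite K" by (rule finite_subset) simp
  then have "fin_complex K"
    unfolding fin_complex_def K_def using N by (auto intro: finite_subset[of _ "{Suc 0..N}"])
  then have K: "cone_complex 1 K" unfolding cone_complex_def K_def using N by auto
  have K': "{0} \<notin> K" "{0, 1} \<notin> K" "{1} \<in> K" unfolding K_def using N by auto
  have KL: "insert {0, 1} (insert {0} K) \<subseteq> ?L"
  proof -
    have "S \<in> ?L" if S: "S \<in> K" for S
    proof -
      obtain j where "j \<in> {2..N}" "j \<notin> S" using S unfolding K_def by blast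
      then show ?thesis using S unfolding K_def horn_complex_def by (auto intro!: exI[of _ j])
    qed
    then show ?thesis using edgeL by auto
  qed
  \<comment> \<open>Second deformation: the target of the edge \<open>f\<close> takes the form
    \<open>phi b1\<close>, where \<open>b1\<close> is read off from \<open>U1\<close>.\<close>
  obtain U2 where U2: "U2 \<in> fam A d ?L" "fam_conn ?L U1 U2" "U2 {0, 1} = s 1 x"
    "\<And>S. S \<in> K \<Longrightarrow> U2 S = cone_shift 1 K U1 S"
    using shift_second_vertex[OF L KL K K' U1(1) x U1_01] by blast
  \<comment> \<open>Third deformation: \<open>phi\<close> on all faces containing 0. It is needed
    because \<open>outer_fill_slice\<close> lifts \<open>phi f\<close> rather than
    \<open>f\<close>.\<close>
  define V where "V = cone_shift 0 ?L U2"
  have UV: "fam_conn ?L U V"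
    unfolding V_def
    by (rule equivclp_trans[OF U1(3) equivclp_trans[OF U2(2) fam_conn_cone_shift[OF coneL U2(1)]]])
  have V: "V \<in> fam A d ?L"
  proof -
    have "cone_path kappa 0 ?L U2 \<in> fam P e ?L" by (rule cone_path_fam[OF natural_path_kappa coneL U2(1)])
    then have "(\<lambda>S\<in>?L. bd 1 (card S) (cone_path kappa 0 ?L U2 S)) \<in> fam A d ?L" by (rule bd_fam[OF _ L]) simp
    moreover have "(\<lambda>S\<in>?L. bd 1 (card S) (cone_path kappa 0 ?L U2 S)) = (\<lambda>S\<in>?L. V S)"
      unfolding V_def by (rule restrict_ext) (rule cone_path_ends(3)[OF coneL U2(1)])
    moreover have "(\<lambda>S\<in>?L. V S) = V" unfolding V_def cone_shift_def by (rule ext) simp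
    ultimately show ?thesis by simp
  qed

  have L01: "{0, 1} \<union> W \<in> ?L" if W: "W \<in> J" for W
  proof -
    obtain j where "j \<in> {2..N}" "j \<notin> W" using W unfolding J_def by blast
    then show ?thesis using W N unfolding J_def horn_complex_def by (auto intro!: exI[of _ j])
  qed
  have L0: "{0} \<union> W \<in> ?L" if "W \<in> E" for W
    using that N unfolding E_def horn_complex_def by (auto intro!: exI[of _ 1])
  have K1: "{1} \<union> W \<in> K" if "W \<in> J" for W
    using that N unfolding J_def K_def by auto
  have L1: "{1} \<union> W \<in> ?L" if "W \<in> J" for W using K1[OF that] KL by auto
  have ltE: "t < w" if "t \<le> 1" "w \<in> W" "W \<in> E" for t w W using that unfolding E_def by auto
  have ltJ: "t < w" if "t \<le> 1" "w \<in> W" "W \<in> J" for t w W using that JE ltE by blast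
  have c2: "card {0, 1 :: nat} = 2" by simp
  define f where "f = (\<lambda>W\<in>J. U2 ({0, 1} \<union> W))"
  define b0 where "b0 = (\<lambda>W\<in>E. U2 ({0} \<union> W))"
  define b1 where "b1 = (\<lambda>W\<in>J. U1 ({1} \<union> W))"
  have f: "f \<in> slice A d J 2"
    unfolding f_def c2[symmetric] by (rule fam_to_slice[OF U2(1) J]) (use L01 ltJ in auto)
  have "b0 \<in> slice A d E (card {0 :: nat})"
    unfolding b0_def by (rule fam_to_slice[OF U2(1) E]) (use L0 ltE in auto)
  then have b0: "b0 \<in> slice A d E 1" by simp
  have "b1 \<in> slice A d J (card {1 :: nat})"
    unfolding b1_def by (rule fam_to_slice[OF U1(1) J]) (use L1 ltJ in auto)
  then have b1: "b1 \<in> slice A d J 1" by simp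
  have sf: "slice_face d J 1 (rank {0, 1} t) f = (\<lambda>W\<in>J. U2 (({0, 1} - {t}) \<union> W))" if "t \<in> {0, 1}" for t
    unfolding f_def by (rule slice_face_fam[OF U2(1) J]) (use L01 ltJ that in auto)
  have f1: "slice_face d J 1 1 f = restrict b0 J"
    using sf[of 1] JE unfolding rank_edge edge_remove b0_def by (auto simp: fun_eq_iff restrict_def)
  have fin: "finite W" if "W \<in> J" for W using fin_complexD(3)[OF J that] .
  have "U2 ({1} \<union> W) = phi (1 + card W) (U1 ({1} \<union> W))" if W: "W \<in> J" for W
  proof -
    have "1 \<notin> W" using ltJ[of 1 1 W] W by auto
    then show ?thesis using U2(4)[OF K1[OF W]] K1[OF W] fin[OF W] by (simp add: cone_shift_def)
  qed
  then have f0: "slice_face d J 1 0 f = deg_shift (slice_face d J) (slice_deg s J) 1 b1"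
    using sf[of 0] unfolding rank_edge edge_remove deg_shift_slice b1_def
    by (auto simp: fun_eq_iff restrict_def)
  have J0: "{} \<in> J" using fin_complexD(2)[OF J] .
  have fx: "f {} = s 1 x" using J0 U2(3) by (simp add: f_def)
  have bx: "b1 {} = x" using J0 U1_1 by (simp add: b1_def)
  obtain w where w: "w \<in> slice A d E 2"
    "restrict w J = deg_shift (slice_face d J) (slice_deg s J) 2 f"
    "slice_face d E 1 1 w = deg_shift (slice_face d E) (slice_deg s E) 1 b0"
    by (rule outer_fill_slice[OF E J JE x d0_s1[OF x] f fx b0 f1 b1 f0 bx])
  let ?T = "{2..N}"
  have TE: "?T \<in> E" unfolding E_def by simp
  have cT: "card ?T = N - 1" by simp
  show thesis
  proof (rule that[OF V UV])
    show "w ?T \<in> A (Suc N)" using sliceD(2)[OF w(1) TE] N by (simp add: cT)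
    fix j assume j: "1 \<le> j" "j \<le> N"
    show "d N j (w ?T) = V ({..N} - {j})"
    \<comment> \<open>Face 1 is the source of the lifted edge. A face \<open>j \<ge> 2\<close>
      deletes a vertex of \<open>{2..N}\<close> and is therefore determined by the restriction to
      \<open>J\<close>.\<close>
    proof (cases "j = 1")
      case True
      have "d (1 + card ?T) 1 (w ?T) = phi (1 + card ?T) (b0 ?T)"
        using fun_cong[OF w(3), of ?T] TE unfolding deg_shift_slice by (simp add: slice_face_def)
      also have "b0 ?T = U2 ({..N} - {1})"
      proof -
        have "{0} \<union> ?T = {..N} - {1}" by auto
        then show ?thesis using TE by (simp add: b0_def)
      qed
      also have "phi (1 + card ?T) (U2 ({..N} - {1})) = V ({..N} - {1})"
      proof -
        have "{..N} - {1} \<in> ?L" using N unfolding horn_complex_def by (auto intro!: exI[of _ 1])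
        then show ?thesis using N unfolding V_def cone_shift_def by simp
      qed
      finally show ?thesis using True N by simp
    next
      case False
      then have jT: "j \<in> ?T" using j by auto
      have TJ: "?T - {j} \<in> J" unfolding J_def using jT by blast
      have cTj: "card (?T - {j}) = N - 2" using jT by simp
      have "{v \<in> ?T. v < j} = {2..<j}" using j by auto
      then have r: "rank ?T j = j - 2" unfolding rank_def by simp
      have "d (2 + card (?T - {j})) (2 + rank ?T j) (w ?T) = w (?T - {j})"
        by (rule sliceD(3)[OF w(1) TE jT])
      moreover have N2: "2 + (N - 2) = N" and "2 + (j - 2) = j" using N jT by auto
      ultimately have "d N j (w ?T) = w (?T - {j})" unfolding cTj r by simp
      also have "\<dots> = phi N (f (?T - {j}))"
        using fun_cong[OF w(2), of "?T - {j}"] TJ unfolding deg_shift_slice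
        by (simp only: restrict_apply' cTj N2)
      also have "f (?T - {j}) = U2 ({..N} - {j})"
      proof -
        have "{0, 1} \<union> (?T - {j}) = {..N} - {j}" using jT by auto
        then show ?thesis using TJ by (simp add: f_def)
      qed
      also have "phi N (U2 ({..N} - {j})) = V ({..N} - {j})"
      proof -
        have "{..N} - {j} \<in> ?L" using j unfolding horn_complex_def by (auto intro!: exI[of _ j])
        then show ?thesis using N j jT unfolding V_def cone_shift_def by simp
      qed
      finally show ?thesis .
    qed
  qed
qed

text \<open>All edges of \<open>phi (s (s x))\<close> are \<open>phi (s x)\<close>, which is homotopic to \<open>s0 x\<close>.\<close>

theorem degenerate_edge_idempotent:
  assumes x: "x \<in> A 1"
  obtains H where "H \<in> A 3" "\<And>i. i \<le> 2 \<Longrightarrow> pt_conn 2 (d 2 i H) (s0 1 x)"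
proof -
  have s1: "s 1 x \<in> A 2" using s_closed[OF x] by (simp add: numeral_2_eq_2)
  have "pt_path 2 (s0 1 x) (s 1 x)"
    unfolding pt_path_def using G(1,2)[OF x] by (auto simp: s_def numeral_2_eq_2)
  moreover have "pt_path 2 (d 2 0 (s0 2 (s 1 x))) (s 1 x)"
    unfolding pt_path_def using h_closed[of 0, OF _ s1] h_bd0[of 0, OF _ s1] h_bd1[of 0, OF _ s1] by auto
  moreover have "pt_path 2 (d 2 0 (s0 2 (s 1 x))) (phi 2 (s 1 x))"
    unfolding pt_path_def using bd1_kappa[OF s1]
      natural_path_kappa[unfolded natural_path_def, THEN conjunct1, rule_format, OF _ s1] by auto
  ultimately have conn: "pt_conn 2 (phi 2 (s 1 x)) (s0 1 x)"
    by (meson equivclp_sym equivclp_trans r_into_equivclp)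
  have "phi 3 (s 2 (s 1 x)) \<in> A 3"
    using phi_closed[OF constant_simplex(2)[OF x d0_s1[OF x]]] by simp
  then show thesis using that conn constant_simplex(8)[OF x d0_s1[OF x]] by metis
qed

end

section \<open>Injective maps and their images\<close>

lemma inj_mapsD:
  assumes "\<mu> \<in> inj_maps atMost m n"
  shows "j \<le> m \<Longrightarrow> \<mu> j \<le> n" "i < j \<Longrightarrow> j \<le> m \<Longrightarrow> \<mu> i < \<mu> j" "\<mu> \<in> extensional {..m}"
  using assms unfolding inj_maps_def by (auto simp: strict_mono_on_def PiE_def)

lemma inj_mapsI:
  assumes "\<And>j. j \<le> m \<Longrightarrow> \<mu> j \<le> n" "\<And>i j. i < j \<Longrightarrow> j \<le> m \<Longrightarrow> \<mu> i < \<mu> j" "\<mu> \<in> extensional {..m}"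
  shows "\<mu> \<in> inj_maps atMost m n"
  using assms unfolding inj_maps_def by (auto simp: strict_mono_on_def PiE_def)

lemma id_map_inj: "id_map atMost n \<in> inj_maps atMost n n"
  by (rule inj_mapsI) (auto simp: id_map_def)

lemma id_map_image: "id_map atMost n ` {..n} = {..n}"
  by (auto simp: id_map_def)

lemma coface_inj: "coface m i \<in> inj_maps atMost m (Suc m)"
  by (rule inj_mapsI) (auto simp: coface_def)

lemma coface_avoids: "i \<notin> coface m i ` {..m}"
  by (auto simp: coface_def)

lemma coface_image: "i \<le> Suc m \<Longrightarrow> coface m i ` {..m} = {..Suc m} - {i}"
proof (intro equalityI subsetI)
  fix x assume "i \<le> Suc m" "x \<in> {..Suc m} - {i}"
  then show "x \<in> coface m i ` {..m}"
    by (intro image_eqI[of _ _ "if x < i then x else x - 1"]) (auto simp: coface_def)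
qed (auto simp: coface_def split: if_splits)

lemma compose_inj:
  assumes "\<mu> \<in> inj_maps atMost m n" "\<nu> \<in> inj_maps atMost l m"
  shows "compose {..l} \<mu> \<nu> \<in> inj_maps atMost l n"
  using inj_mapsD[OF assms(1)] inj_mapsD[OF assms(2)]
  by (intro inj_mapsI) (auto simp: compose_def)

lemma compose_image: "compose {..l} \<mu> \<nu> ` {..l} = \<mu> ` \<nu> ` {..l}"
  by (auto simp: compose_def)

lemma coface_coface:
  assumes "i < j" "j \<le> Suc (Suc m)"
  shows "compose {..m} (coface (Suc m) j) (coface m i) = compose {..m} (coface (Suc m) i) (coface m (j - 1))"
  using assms by (auto simp: compose_def coface_def fun_eq_iff)

lemma inj_maps_inj_on: "\<mu> \<in> inj_maps atMost m n \<Longrightarrow> inj_on \<mu> {..m}"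
  by (rule inj_onI) (metis atMost_iff inj_mapsD(2) less_irrefl linorder_neqE_nat)

lemma rank_image:
  assumes \<mu>: "\<mu> \<in> inj_maps atMost m n" and j: "j \<le> m"
  shows "rank (\<mu> ` {..m}) (\<mu> j) = j"
proof -
  have "{v \<in> \<mu> ` {..m}. v < \<mu> j} = \<mu> ` {..<j}"
  proof (intro equalityI subsetI)
    fix v assume "v \<in> {v \<in> \<mu> ` {..m}. v < \<mu> j}"
    then obtain i where i: "i \<le> m" "v = \<mu> i" "\<mu> i < \<mu> j" by auto
    then have "i < j" using inj_mapsD(2)[OF \<mu>, of j i] by (metis less_asym less_irrefl linorder_neqE_nat)
    then show "v \<in> \<mu> ` {..<j}" using i by auto
  next
    fix v assume "v \<in> \<mu> ` {..<j}"
    then show "v \<in> {v \<in> \<mu> ` {..m}. v < \<mu> j}" using inj_mapsD(2)[OF \<mu> _ j] j by auto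
  qed
  moreover have "inj_on \<mu> {..<j}" using inj_maps_inj_on[OF \<mu>] j by (auto intro: inj_on_subset)
  ultimately show ?thesis unfolding rank_def by (simp add: card_image)
qed

lemma card_image_inj: "\<mu> \<in> inj_maps atMost m n \<Longrightarrow> card (\<mu> ` {..m}) = Suc m"
  using card_image[OF inj_maps_inj_on] by fastforce

lemma inj_maps_eqI:
  assumes \<mu>: "\<mu> \<in> inj_maps atMost m n" and \<nu>: "\<nu> \<in> inj_maps atMost m n'"
    and im: "\<mu> ` {..m} = \<nu> ` {..m}"
  shows "\<mu> = \<nu>"
proof
  fix j show "\<mu> j = \<nu> j"
  proof (cases "j \<le> m")
    case True
    have "\<mu> j \<in> \<nu> ` {..m}" using True im by blast
    then obtain i where i: "i \<le> m" "\<mu> j = \<nu> i" by auto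
    have "i = j" using rank_image[OF \<mu> True] rank_image[OF \<nu> i(1)] im i(2) by simp
    then show ?thesis using i by simp
  next
    case False
    then show ?thesis using inj_mapsD(3)[OF \<mu>] inj_mapsD(3)[OF \<nu>] by (simp add: extensional_def)
  qed
qed

text \<open>The increasing enumeration of \<open>S\<close>, as a map out of
  \<open>[card S - 1]\<close>. Together with taking images it translates between vertex sets and
  simplices of a representable.\<close>

definition enum_set :: "nat set \<Rightarrow> nat \<Rightarrow> nat" where
  "enum_set S = (\<lambda>r\<in>{..card S - 1}. SOME a. a \<in> S \<and> rank S a = r)"

lemma enum_set:
  assumes S: "S \<subseteq> {..n}" "S \<noteq> {}"
  shows "enum_set S \<in> inj_maps atMost (card S - 1) n" "enum_set S ` {..card S - 1} = S"
proof -
  have fin: "finite S" using S(1) by (rule finite_subset) simp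
  have c: "card S > 0" using fin S(2) card_gt_0_iff by blast
  have el: "enum_set S r \<in> S \<and> rank S (enum_set S r) = r" if "r \<le> card S - 1" for r
  proof -
    have "r < card S" using that c by simp
    then have "\<exists>a. a \<in> S \<and> rank S a = r" using rank_surj[OF fin] by blast
    from someI_ex[OF this]
    have "(SOME a. a \<in> S \<and> rank S a = r) \<in> S \<and> rank S (SOME a. a \<in> S \<and> rank S a = r) = r" .
    then show ?thesis using that by (simp add: enum_set_def)
  qed
  show m: "enum_set S \<in> inj_maps atMost (card S - 1) n"
  proof (rule inj_mapsI)
    show "enum_set S j \<le> n" if "j \<le> card S - 1" for j using el[OF that] S(1) by auto
    show "enum_set S i < enum_set S j" if "i < j" "j \<le> card S - 1" for i j
      using el[of i] el[of j] that rank_less_iff[OF fin, of "enum_set S i" "enum_set S j"] by simp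
  qed (simp add: enum_set_def)
  have "card (enum_set S ` {..card S - 1}) = card S" using card_image_inj[OF m] c by simp
  moreover have "enum_set S ` {..card S - 1} \<subseteq> S" using el by auto
  ultimately show "enum_set S ` {..card S - 1} = S" using fin by (simp add: card_subset_eq)
qed

lemma enum_set_image:
  assumes \<mu>: "\<mu> \<in> inj_maps atMost m n"
  shows "enum_set (\<mu> ` {..m}) = \<mu>"
proof (rule inj_maps_eqI[OF _ \<mu>])
  have S: "\<mu> ` {..m} \<subseteq> {..n}" "\<mu> ` {..m} \<noteq> {}" using inj_mapsD(1)[OF \<mu>] by auto
  have c: "card (\<mu> ` {..m}) - 1 = m" using card_image_inj[OF \<mu>] by simp
  show "enum_set (\<mu> ` {..m}) \<in> inj_maps atMost m n" using enum_set(1)[OF S] unfolding c .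
  show "enum_set (\<mu> ` {..m}) ` {..m} = \<mu> ` {..m}" using enum_set(2)[OF S] unfolding c .
qed

text \<open>The factor of \<open>\<mu>\<close> through the coface omitting \<open>j\<close>,
  meaningful when \<open>j\<close> is not in the image of \<open>\<mu>\<close>.\<close>

definition squash :: "nat \<Rightarrow> nat \<Rightarrow> (nat \<Rightarrow> nat) \<Rightarrow> nat \<Rightarrow> nat" where
  "squash m j \<mu> = (\<lambda>i\<in>{..m}. if \<mu> i < j then \<mu> i else \<mu> i - 1)"

lemma squash:
  assumes \<mu>: "\<mu> \<in> inj_maps atMost m (Suc n)" and j: "j \<le> Suc n" "j \<notin> \<mu> ` {..m}"
  shows "squash m j \<mu> \<in> inj_maps atMost m n" "compose {..m} (coface n j) (squash m j \<mu>) = \<mu>"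
proof -
  have nj: "\<mu> i \<noteq> j" if "i \<le> m" for i using j that by auto
  show s: "squash m j \<mu> \<in> inj_maps atMost m n"
  proof (rule inj_mapsI)
    fix i assume i: "i \<le> m"
    show "squash m j \<mu> i \<le> n" using inj_mapsD(1)[OF \<mu> i] nj[OF i] j i by (auto simp: squash_def)
  next
    fix i i' assume i: "i < i'" "i' \<le> m"
    show "squash m j \<mu> i < squash m j \<mu> i'"
      using inj_mapsD(2)[OF \<mu> i] nj[of i] nj[of i'] i by (auto simp: squash_def)
  qed (simp add: squash_def)
  show "compose {..m} (coface n j) (squash m j \<mu>) = \<mu>"
  proof
    fix i show "compose {..m} (coface n j) (squash m j \<mu>) i = \<mu> i"
      using inj_mapsD[OF \<mu>] nj[of i] inj_mapsD(1)[OF s, of i]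
      by (cases "i \<le> m") (auto simp: compose_def coface_def squash_def extensional_def split: if_splits)
  qed
qed

lemma squash_coface: "j \<le> Suc n \<Longrightarrow> squash n j (coface n j) = id_map atMost n"
  by (auto simp: squash_def coface_def id_map_def fun_eq_iff)

lemma squash_squash:
  assumes "\<mu> \<in> inj_maps atMost m (Suc (Suc n))" "a < b" "a \<notin> \<mu> ` {..m}" "b \<notin> \<mu> ` {..m}"
  shows "squash m a (squash m b \<mu>) = squash m (b - 1) (squash m a \<mu>)" "a \<notin> squash m b \<mu> ` {..m}"
    "b - 1 \<notin> squash m a \<mu> ` {..m}"
proof -
  have ne: "\<mu> i \<noteq> a" "\<mu> i \<noteq> b" if "i \<le> m" for i using assms that by auto
  show "squash m a (squash m b \<mu>) = squash m (b - 1) (squash m a \<mu>)"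
  proof
    fix i show "squash m a (squash m b \<mu>) i = squash m (b - 1) (squash m a \<mu>) i"
      using ne[of i] \<open>a < b\<close> by (cases "i \<le> m") (auto simp: squash_def)
  qed
  show "a \<notin> squash m b \<mu> ` {..m}"
  proof
    assume "a \<in> squash m b \<mu> ` {..m}"
    then obtain i where "i \<le> m" "a = squash m b \<mu> i" by auto
    then show False using ne[of i] \<open>a < b\<close> by (auto simp: squash_def split: if_splits)
  qed
  show "b - 1 \<notin> squash m a \<mu> ` {..m}"
  proof
    assume "b - 1 \<in> squash m a \<mu> ` {..m}"
    then obtain i where "i \<le> m" "b - 1 = squash m a \<mu> i" by auto
    then show False using ne[of i] \<open>a < b\<close> by (auto simp: squash_def split: if_splits)
  qed
qed

lemma squash_compose:
  "\<nu> \<in> inj_maps atMost l m \<Longrightarrow> squash l j (compose {..l} \<mu> \<nu>) = compose {..l} (squash m j \<mu>) \<nu>"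
  using inj_mapsD(1)[of \<nu> l m] by (auto simp: squash_def compose_def fun_eq_iff)

section \<open>Semi-simplicial spaces as families of cells\<close>

text \<open>The \<open>p\<close>-simplices of all levels, reindexed by the number of vertices; the
  singleton in degree 0 is the augmentation by a point.\<close>

definition aug_cells :: "'a diagram \<Rightarrow> nat \<Rightarrow> nat \<Rightarrow> 'a set" where
  "aug_cells X p n = (case n of 0 \<Rightarrow> {undefined} | Suc m \<Rightarrow> cells (Lev X m) p)"

definition aug_face :: "'a diagram \<Rightarrow> nat \<Rightarrow> nat \<Rightarrow> nat \<Rightarrow> 'a \<Rightarrow> 'a" where
  "aug_face X p n i = (case n of 0 \<Rightarrow> (\<lambda>_. undefined) | Suc m \<Rightarrow> Res X m (Suc m) (coface m i) p)"

definition aug_end :: "'a diagram \<Rightarrow> nat \<Rightarrow> nat \<Rightarrow> 'a \<Rightarrow> 'a" where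
  "aug_end X k n = (case n of 0 \<Rightarrow> (\<lambda>_. undefined) | Suc m \<Rightarrow> act (Lev X m) 0 1 (\<lambda>_\<in>{..0}. k))"

lemma aug_simps [simp]:
  "aug_cells X p 0 = {undefined}" "aug_cells X p (Suc m) = cells (Lev X m) p"
  "aug_face X p 0 i = (\<lambda>_. undefined)" "aug_face X p (Suc m) i = Res X m (Suc m) (coface m i) p"
  "aug_end X k 0 = (\<lambda>_. undefined)" "aug_end X k (Suc m) = act (Lev X m) 0 1 (\<lambda>_\<in>{..0}. k)"
  by (simp_all add: aug_cells_def aug_face_def aug_end_def)

definition ss_of :: "nat \<Rightarrow> nat set set \<Rightarrow> nat \<Rightarrow> (nat \<Rightarrow> nat) set" where
  "ss_of N K m = {\<mu> \<in> inj_maps atMost m N. \<mu> ` {..m} \<in> K}"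

lemma ss_horn_eq: "ss_horn N i = ss_of N (horn_complex N i)"
  unfolding ss_horn_def ss_of_def horn_complex_def using inj_mapsD(1) by fastforce

lemma ss_boundary_eq: "ss_boundary N m = {\<mu> \<in> inj_maps atMost m N. \<exists>j\<in>{..N}. j \<notin> \<mu> ` {..m}}"
  unfolding ss_boundary_def by auto

definition fam_to_map :: "nat \<Rightarrow> nat set set \<Rightarrow> (nat set \<Rightarrow> 'a) \<Rightarrow> nat \<Rightarrow> (nat \<Rightarrow> nat) \<Rightarrow> 'a" where
  "fam_to_map N K U m = (\<lambda>\<mu>\<in>ss_of N K m. U (\<mu> ` {..m}))"

text \<open>At the empty face the value has to be the only element of
  \<open>aug_cells X p 0\<close>.\<close>

definition map_to_fam :: "nat set set \<Rightarrow> (nat \<Rightarrow> (nat \<Rightarrow> nat) \<Rightarrow> 'a) \<Rightarrow> nat set \<Rightarrow> 'a" where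
  "map_to_fam K u = (\<lambda>S\<in>K. if S = {} then undefined else u (card S - 1) (enum_set S))"

locale presheaf =
  fixes X :: "'a diagram"
  assumes presheaf: "space_presheaf atMost X"
begin

lemma Lev_kan: "kan_complex (Lev X n)"
  using presheaf unfolding space_presheaf_def by blast

lemma Lev_sset: "simplicial_set (Lev X n)"
  using Lev_kan unfolding kan_complex_def by blast

lemma Res_map: "\<mu> \<in> inj_maps atMost m n \<Longrightarrow> simplicial_map (Lev X n) (Lev X m) (Res X m n \<mu>)"
  using presheaf unfolding space_presheaf_def by blast

lemma Res_closed: "\<mu> \<in> inj_maps atMost m n \<Longrightarrow> x \<in> cells (Lev X n) p \<Longrightarrow> Res X m n \<mu> p x \<in> cells (Lev X m) p"
  using Res_map unfolding simplicial_map_def by blast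

lemma Res_act: "\<mu> \<in> inj_maps atMost m n \<Longrightarrow> \<theta> \<in> mono_maps p q \<Longrightarrow> x \<in> cells (Lev X n) q \<Longrightarrow>
    Res X m n \<mu> p (act (Lev X n) p q \<theta> x) = act (Lev X m) p q \<theta> (Res X m n \<mu> q x)"
  using Res_map unfolding simplicial_map_def by blast

lemma Res_id: "x \<in> cells (Lev X n) p \<Longrightarrow> Res X n n (id_map atMost n) p x = x"
  using presheaf unfolding space_presheaf_def by blast

lemma Res_compose: "\<nu> \<in> inj_maps atMost l m \<Longrightarrow> \<mu> \<in> inj_maps atMost m n \<Longrightarrow> x \<in> cells (Lev X n) p \<Longrightarrow>
    Res X l n (compose {..l} \<mu> \<nu>) p x = Res X l m \<nu> p (Res X m n \<mu> p x)"
  using presheaf unfolding space_presheaf_def by blast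

lemma act_closed: "\<theta> \<in> mono_maps p q \<Longrightarrow> x \<in> cells (Lev X n) q \<Longrightarrow> act (Lev X n) p q \<theta> x \<in> cells (Lev X n) p"
  using Lev_sset[of n] unfolding simplicial_set_def by blast

lemma face_set_aug: "face_set (aug_cells X p) (aug_face X p)"
proof
  fix x n i assume "x \<in> aug_cells X p (Suc n)" "i \<le> n"
  then show "aug_face X p n i x \<in> aug_cells X p n"
    using Res_closed coface_inj by (cases n) auto
next
  fix x n i j assume *: "x \<in> aug_cells X p (Suc (Suc n))" "i < j" "j \<le> Suc n"
  show "aug_face X p n i (aug_face X p (Suc n) j x) = aug_face X p n (j - 1) (aug_face X p (Suc n) i x)"
  proof (cases n)
    case (Suc m)
    have "Res X m (Suc (Suc m)) (compose {..m} (coface (Suc m) j) (coface m i)) p x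
      = Res X m (Suc (Suc m)) (compose {..m} (coface (Suc m) i) (coface m (j - 1))) p x"
      using coface_coface[of i j m] * Suc by simp
    then show ?thesis using Res_compose[OF coface_inj coface_inj] * Suc by simp
  qed simp
qed

text \<open>A family is required to respect the deletion of single vertices only. A proper injection
  \<open>\<nu>\<close> misses some \<open>j\<close>, so it factors through a coface, and induction
  on \<open>m\<close> handles the remaining factor.\<close>

lemma fam_Res:
  assumes U: "U \<in> fam (aug_cells X p) (aug_face X p) K" and K: "fin_complex K"
    and \<mu>: "\<mu> \<in> inj_maps atMost m N" "\<mu> ` {..m} \<in> K" and \<nu>: "\<nu> \<in> inj_maps atMost l m"
  shows "U (\<mu> ` \<nu> ` {..l}) = Res X l m \<nu> p (U (\<mu> ` {..m}))"
  using \<mu> \<nu>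
proof (induction m arbitrary: \<mu> \<nu>)
  case 0
  have U0: "U (\<mu> ` {..0}) \<in> cells (Lev X 0) p"
    using sliceD(2)[OF U 0(2)] card_image_inj[OF 0(1)] by simp
  have "card (\<nu> ` {..l}) \<le> card {..(0::nat)}"
    by (rule card_mono) (use inj_mapsD(1)[OF 0(3)] in auto)
  then have l: "l = 0" using card_image_inj[OF 0(3)] by simp
  have "\<nu> = id_map atMost 0"
    using inj_mapsD[OF 0(3)] l by (auto simp: id_map_def fun_eq_iff extensional_def)
  then show ?case using Res_id[OF U0] unfolding l by (simp only: id_map_image)
next
  case (Suc m)
  have c: "card (\<mu> ` {..Suc m}) = Suc (Suc m)" using card_image_inj[OF Suc.prems(1)] .
  have U0: "U (\<mu> ` {..Suc m}) \<in> cells (Lev X (Suc m)) p"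
    using sliceD(2)[OF U Suc.prems(2)] c by simp
  have sub: "\<nu> ` {..l} \<subseteq> {..Suc m}" using inj_mapsD(1)[OF Suc.prems(3)] by auto
  show ?case
  proof (cases "\<nu> ` {..l} = {..Suc m}")
    case True
    have l: "l = Suc m" using card_image_inj[OF Suc.prems(3)] True by simp
    have "\<nu> = id_map atMost (Suc m)"
      by (rule inj_maps_eqI[OF _ id_map_inj]) (use Suc.prems(3) True l in \<open>auto simp: id_map_def\<close>)
    then show ?thesis using Res_id[OF U0] unfolding l by (simp only: id_map_image)
  next
    case False
    then obtain j where j: "j \<le> Suc m" "j \<notin> \<nu> ` {..l}" using sub by auto
    define \<nu>' where "\<nu>' = squash l j \<nu>"
    have \<nu>': "\<nu>' \<in> inj_maps atMost l m" and comp: "\<nu> = compose {..l} (coface m j) \<nu>'"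
      unfolding \<nu>'_def using squash[OF Suc.prems(3) j] by auto
    let ?\<mu> = "compose {..m} \<mu> (coface m j)"
    have \<mu>': "?\<mu> \<in> inj_maps atMost m N" by (rule compose_inj[OF Suc.prems(1) coface_inj])
    have im: "?\<mu> ` {..m} = \<mu> ` {..Suc m} - {\<mu> j}"
      unfolding compose_image coface_image[OF j(1)]
      using inj_maps_inj_on[OF Suc.prems(1)] j(1) by (subst inj_on_image_set_diff[of \<mu> "{..Suc m}"]) auto
    have mK: "?\<mu> ` {..m} \<in> K" unfolding im by (rule fin_complexD(5)[OF K Suc.prems(2)])
    have jm: "\<mu> j \<in> \<mu> ` {..Suc m}" using j by simp
    have "card (\<mu> ` {..Suc m} - {\<mu> j}) = Suc m" using c jm by simp
    then have f: "Res X m (Suc m) (coface m j) p (U (\<mu> ` {..Suc m})) = U (?\<mu> ` {..m})"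
      using sliceD(3)[OF U Suc.prems(2) jm] rank_image[OF Suc.prems(1) j(1)] im by simp
    have "\<mu> ` \<nu> ` {..l} = ?\<mu> ` \<nu>' ` {..l}"
      using inj_mapsD(1)[OF \<nu>'] unfolding comp by (auto simp: compose_def image_iff)
    then have "U (\<mu> ` \<nu> ` {..l}) = Res X l m \<nu>' p (U (?\<mu> ` {..m}))"
      using Suc.IH[OF \<mu>' mK \<nu>'] by simp
    also have "\<dots> = Res X l (Suc m) \<nu> p (U (\<mu> ` {..Suc m}))"
      using Res_compose[OF \<nu>' coface_inj U0, of j] f comp by simp
    finally show ?thesis .
  qed
qed

lemma fam_to_map_cell:
  assumes U: "U \<in> fam (aug_cells X p) (aug_face X p) K" and K: "fin_complex K"
  shows "fam_to_map N K U \<in> cells (mapping_space (ss_of N K) X) p"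
proof -
  have "fam_to_map N K U m \<in> ss_of N K m \<rightarrow>\<^sub>E cells (Lev X m) p" for m
  proof
    fix \<mu> assume \<mu>: "\<mu> \<in> ss_of N K m"
    then show "fam_to_map N K U m \<mu> \<in> cells (Lev X m) p"
      using sliceD(2)[OF U, of "\<mu> ` {..m}"] card_image_inj[of \<mu> m N]
      unfolding ss_of_def fam_to_map_def by auto
  qed (simp add: fam_to_map_def)
  moreover have "fam_to_map N K U l (compose {..l} \<mu> \<nu>) = Res X l m \<nu> p (fam_to_map N K U m \<mu>)"
    if \<nu>: "\<nu> \<in> inj_maps atMost l m" and \<mu>: "\<mu> \<in> ss_of N K m" for l m \<mu> \<nu>
  proof -
    have sub: "\<mu> ` \<nu> ` {..l} \<subseteq> \<mu> ` {..m}" using inj_mapsD(1)[OF \<nu>] by auto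
    have m: "\<mu> \<in> inj_maps atMost m N" "\<mu> ` {..m} \<in> K" using \<mu> unfolding ss_of_def by auto
    have "compose {..l} \<mu> \<nu> \<in> ss_of N K l"
      unfolding ss_of_def mem_Collect_eq compose_image
      using compose_inj[OF m(1) \<nu>] fin_complexD(4)[OF K m(2) sub] by (rule conjI)
    then show ?thesis
      using fam_Res[OF U K m \<nu>] \<mu> unfolding fam_to_map_def by (simp only: restrict_apply' compose_image)
  qed
  ultimately show ?thesis unfolding mapping_space_def by simp
qed

lemma mapping_spaceD:
  assumes "u \<in> cells (mapping_space K X) p"
  shows "\<mu> \<in> K m \<Longrightarrow> u m \<mu> \<in> cells (Lev X m) p" "\<mu> \<notin> K m \<Longrightarrow> u m \<mu> = undefined"
    "\<nu> \<in> inj_maps atMost l m \<Longrightarrow> \<mu> \<in> K m \<Longrightarrow> u l (compose {..l} \<mu> \<nu>) = Res X l m \<nu> p (u m \<mu>)"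
  using assms unfolding mapping_space_def by (auto simp: PiE_iff extensional_def)

lemma map_to_fam_closed:
  assumes u: "u \<in> cells (mapping_space (ss_of N K) X) p" and K: "fin_complex K" "K \<subseteq> Pow {..N}"
  shows "map_to_fam K u \<in> fam (aug_cells X p) (aug_face X p) K"
proof (rule sliceI)
  have enum: "enum_set S \<in> ss_of N K (card S - 1)" if "S \<in> K" "S \<noteq> {}" for S
  proof -
    have "S \<subseteq> {..N}" using that(1) K(2) by auto
    from enum_set[OF this that(2)] show ?thesis using that(1) unfolding ss_of_def by simp
  qed
  fix S assume S: "S \<in> K"
  have fin: "finite S" using fin_complexD(3)[OF K(1) S] .
  show "map_to_fam K u S \<in> aug_cells X p (0 + card S)"
  proof (cases "S = {}")
    case False
    then obtain m where "card S = Suc m" using fin by (metis card_eq_0_iff not0_implies_Suc)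
    then show ?thesis using mapping_spaceD(1)[OF u enum[OF S False]] False S by (simp add: map_to_fam_def)
  qed (use S in \<open>simp add: map_to_fam_def\<close>)
  fix a assume a: "a \<in> S"
  obtain w where w: "card S = Suc w" "card (S - {a}) = w" using a fin by (metis card_Suc_Diff1)
  have Sa: "S - {a} \<in> K" using fin_complexD(5)[OF K(1) S] .
  show "aug_face X p (0 + card (S - {a})) (0 + rank S a) (map_to_fam K u S) = map_to_fam K u (S - {a})"
  proof (cases w)
    case 0
    then have "S - {a} = {}" using w fin by simp
    then have "map_to_fam K u (S - {a}) = undefined" using Sa by (simp add: map_to_fam_def)
    then show ?thesis using w 0 by simp
  next
    case (Suc m)
    have ne: "S \<noteq> {}" "S - {a} \<noteq> {}" using a w(2) Suc by (blast, metis card.empty nat.distinct(1))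
    have SN: "S \<subseteq> {..N}" "S - {a} \<subseteq> {..N}" using S K by auto
    have c: "card S - 1 = Suc m" "card (S - {a}) - 1 = m" using w Suc by simp_all
    have e1: "enum_set S \<in> inj_maps atMost (Suc m) N" "enum_set S ` {..Suc m} = S"
      using enum_set[OF SN(1) ne(1)] unfolding c by auto
    have e2: "enum_set (S - {a}) \<in> inj_maps atMost m N" "enum_set (S - {a}) ` {..m} = S - {a}"
      using enum_set[OF SN(2) ne(2)] unfolding c by auto
    obtain j where j: "j \<le> Suc m" "enum_set S j = a" using a e1(2) by (metis atMost_iff imageE)
    have r: "rank S a = j" using rank_image[OF e1(1) j(1)] e1(2) j(2) by simp
    have im: "enum_set S ` ({..Suc m} - {j}) = S - {a}"
      using inj_maps_inj_on[OF e1(1)] j e1(2) by (subst inj_on_image_set_diff[of _ "{..Suc m}"]) auto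
    have "compose {..m} (enum_set S) (coface m j) = enum_set (S - {a})"
      by (rule inj_maps_eqI[OF compose_inj[OF e1(1) coface_inj] e2(1)])
         (simp only: compose_image coface_image[OF j(1)] im e2(2))
    then have "u m (enum_set (S - {a})) = Res X m (Suc m) (coface m j) p (u (Suc m) (enum_set S))"
      using mapping_spaceD(3)[OF u coface_inj, of "enum_set S" m j] enum[OF S ne(1)] unfolding c by simp
    then show ?thesis using S Sa ne r w Suc unfolding map_to_fam_def c by simp
  qed
qed (simp add: map_to_fam_def)

lemma map_to_fam_image:
  assumes "\<mu> \<in> inj_maps atMost m N" "\<mu> ` {..m} \<in> K"
  shows "map_to_fam K u (\<mu> ` {..m}) = u m \<mu>"
  using assms card_image_inj[OF assms(1)] enum_set_image[OF assms(1)] by (auto simp: map_to_fam_def)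

lemma fam_to_map_to_fam:
  assumes u: "u \<in> cells (mapping_space (ss_of N K) X) p"
  shows "fam_to_map N K (map_to_fam K u) = u"
proof (intro ext)
  fix m \<mu> show "fam_to_map N K (map_to_fam K u) m \<mu> = u m \<mu>"
    using map_to_fam_image[of \<mu> m N K u] mapping_spaceD(2)[OF u, of \<mu> m]
    by (cases "\<mu> \<in> ss_of N K m") (auto simp: fam_to_map_def ss_of_def)
qed

end

section \<open>Lifting paths along Kan fibrations\<close>

lemma const_mono: "k \<le> n \<Longrightarrow> (\<lambda>_\<in>{..p}. k) \<in> mono_maps p n"
  unfolding mono_maps_def by (auto simp: mono_on_def)

lemma id_map_mono: "id_map atMost n \<in> mono_maps n n"
  unfolding mono_maps_def id_map_def by (auto simp: mono_on_def)

lemma compose_const: "\<phi> \<in> mono_maps l m \<Longrightarrow> compose {..l} (\<lambda>_\<in>{..m}. k) \<phi> = (\<lambda>_\<in>{..l}. k)"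
  unfolding mono_maps_def by (auto simp: compose_def fun_eq_iff)

text \<open>The horn of dimension 1 with index \<open>k\<close> is the vertex \<open>k\<close>,
  whose simplices are the constant maps; it is sent to the degeneracies of \<open>x\<close>. The
  lifted path is the value of the filler at the identity of \<open>[1]\<close>.\<close>

lemma path_lifting:
  assumes f: "kan_fibration E B f" and E: "simplicial_set E" and B: "simplicial_set B"
    and k: "k \<le> 1" and x: "x \<in> cells E 0" and q: "q \<in> cells B 1"
    and qx: "act B 0 1 (\<lambda>_\<in>{..0}. k) q = f 0 x"
  shows "\<exists>Q\<in>cells E 1. act E 0 1 (\<lambda>_\<in>{..0}. k) Q = x \<and> f 1 Q = q"
proof -
  have E_closed: "act E m n \<theta> y \<in> cells E m" if "\<theta> \<in> mono_maps m n" "y \<in> cells E n" for m n \<theta> y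
    using E that unfolding simplicial_set_def by blast
  have B_closed: "act B m n \<theta> y \<in> cells B m" if "\<theta> \<in> mono_maps m n" "y \<in> cells B n" for m n \<theta> y
    using B that unfolding simplicial_set_def by blast
  have E_comp: "act E l n (compose {..l} \<theta> \<phi>) y = act E l m \<phi> (act E m n \<theta> y)"
    if "\<phi> \<in> mono_maps l m" "\<theta> \<in> mono_maps m n" "y \<in> cells E n" for l m n \<theta> \<phi> y
    using E that unfolding simplicial_set_def by blast
  have B_comp: "act B l n (compose {..l} \<theta> \<phi>) y = act B l m \<phi> (act B m n \<theta> y)"
    if "\<phi> \<in> mono_maps l m" "\<theta> \<in> mono_maps m n" "y \<in> cells B n" for l m n \<theta> \<phi> y
    using B that unfolding simplicial_set_def by blast
  have f_map: "f m (act E m n \<theta> y) = act B m n \<theta> (f n y)" "f n y \<in> cells B n"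
    if "\<theta> \<in> mono_maps m n" "y \<in> cells E n" for m n \<theta> y
    using f that unfolding kan_fibration_def simplicial_map_def by blast+
  define h where "h p \<theta> = act E p 0 (\<lambda>_\<in>{..p}. 0) x" for p and \<theta> :: "nat \<Rightarrow> nat"
  define b where "b p \<theta> = act B p 1 \<theta> q" for p \<theta>
  have h: "simplicial_map (std_horn 1 k) E h"
    unfolding simplicial_map_def
  proof (intro conjI allI ballI)
    show "h n \<in> cells (std_horn 1 k) n \<rightarrow> cells E n" for n
      unfolding h_def using E_closed[OF const_mono x] by simp
    fix m n \<phi> \<theta> assume "\<phi> \<in> mono_maps m n"
    then show "h m (act (std_horn 1 k) m n \<phi> \<theta>) = act E m n \<phi> (h n \<theta>)"
      unfolding h_def using E_comp[OF _ const_mono x, of \<phi> m n 0] by (simp add: compose_const)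
  qed
  have b: "simplicial_map (std_simplex 1) B b"
    unfolding simplicial_map_def b_def std_simplex_def
    using B_closed[OF _ q] B_comp[OF _ _ q] by simp
  have horn: "\<theta> = (\<lambda>_\<in>{..p}. k)" if th: "\<theta> \<in> cells (std_horn 1 k) p" for p \<theta>
  proof
    fix i
    have \<theta>: "\<theta> \<in> {..p} \<rightarrow>\<^sub>E {..1}" using th unfolding std_horn_def mono_maps_def by auto
    obtain j where j: "j \<le> 1" "j \<noteq> k" "j \<notin> \<theta> ` {..p}" using th unfolding std_horn_def by auto
    have "\<theta> i = k" if "i \<le> p"
    proof -
      have "\<theta> i \<le> 1" "\<theta> i \<noteq> j" using \<theta> j that by auto
      then show ?thesis using j k by linarith
    qed
    moreover have "\<not> i \<le> p \<Longrightarrow> \<theta> i = undefined" using \<theta> by (auto simp: PiE_iff extensional_def)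
    ultimately show "\<theta> i = (\<lambda>_\<in>{..p}. k) i" by simp
  qed
  have "f p (h p \<theta>) = b p \<theta>" if "\<theta> \<in> cells (std_horn 1 k) p" for p \<theta>
  proof -
    have c: "(\<lambda>_\<in>{..p}. 0) \<in> mono_maps p 0" by (rule const_mono) simp
    have "f p (h p \<theta>) = act B p 0 (\<lambda>_\<in>{..p}. 0) (act B 0 1 (\<lambda>_\<in>{..0}. k) q)"
      unfolding h_def using f_map(1)[OF c x] qx by simp
    also have "\<dots> = act B p 1 (compose {..p} (\<lambda>_\<in>{..0}. k) (\<lambda>_\<in>{..p}. 0 :: nat)) q"
      by (rule B_comp[OF c const_mono[OF k] q, symmetric])
    also have "\<dots> = b p \<theta>" unfolding b_def horn[OF that] compose_const[OF c] ..
    finally show ?thesis .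
  qed
  then obtain g where g: "simplicial_map (std_simplex 1) E g"
    "\<And>p \<theta>. \<theta> \<in> cells (std_horn 1 k) p \<Longrightarrow> g p \<theta> = h p \<theta>"
    "\<And>p \<theta>. \<theta> \<in> cells (std_simplex 1) p \<Longrightarrow> f p (g p \<theta>) = b p \<theta>"
    using f[unfolded kan_fibration_def, THEN conjunct2, rule_format, of 1 k h b] h b k by auto
  have id: "id_map atMost 1 \<in> cells (std_simplex 1) 1" using id_map_mono by (simp add: std_simplex_def)
  show ?thesis
  proof (intro bexI conjI)
    show "g 1 (id_map atMost 1) \<in> cells E 1" using g(1) id unfolding simplicial_map_def by blast
    show "f 1 (g 1 (id_map atMost 1)) = q"
      using g(3)[OF id] B q unfolding b_def simplicial_set_def by simp
    have c: "(\<lambda>_\<in>{..0}. k) \<in> mono_maps 0 1" by (rule const_mono[OF k])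
    have "g 0 (act (std_simplex 1) 0 1 (\<lambda>_\<in>{..0}. k) (id_map atMost 1))
        = act E 0 1 (\<lambda>_\<in>{..0}. k) (g 1 (id_map atMost 1))"
      using g(1) id c unfolding simplicial_map_def by blast
    moreover have "act (std_simplex 1) 0 1 (\<lambda>_\<in>{..0}. k) (id_map atMost 1) = (\<lambda>_\<in>{..0}. k)"
      using k by (auto simp: std_simplex_def compose_def id_map_def fun_eq_iff)
    ultimately have "act E 0 1 (\<lambda>_\<in>{..0}. k) (g 1 (id_map atMost 1)) = g 0 (\<lambda>_\<in>{..0}. k)" by simp
    also have "\<dots> = h 0 (\<lambda>_\<in>{..0}. k)"
    proof (rule g(2))
      have "1 - k \<le> 1" "1 - k \<noteq> k" using k by arith+
      then show "(\<lambda>_\<in>{..0}. k) \<in> cells (std_horn 1 k) 0"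
        using c unfolding std_horn_def by (auto intro!: exI[of _ "1 - k"])
    qed
    also have "\<dots> = x"
    proof -
      have "(\<lambda>_\<in>{..0}. 0) = id_map atMost (0::nat)" by (auto simp: id_map_def fun_eq_iff)
      then show ?thesis unfolding h_def using E x unfolding simplicial_set_def by simp
    qed
    finally show "act E 0 1 (\<lambda>_\<in>{..0}. k) (g 1 (id_map atMost 1)) = x" .
  qed
qed

section \<open>Assembling a map from compatible faces\<close>

context presheaf
begin

lemma act_id: "x \<in> cells (Lev X n) p \<Longrightarrow> act (Lev X n) p p (id_map atMost p) x = x"
  using Lev_sset[of n] unfolding simplicial_set_def by blast

lemma act_compose: "\<phi> \<in> mono_maps l m \<Longrightarrow> \<theta> \<in> mono_maps m p \<Longrightarrow> x \<in> cells (Lev X n) p \<Longrightarrow>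
    act (Lev X n) l p (compose {..l} \<theta> \<phi>) x = act (Lev X n) l m \<phi> (act (Lev X n) m p \<theta> x)"
  using Lev_sset[of n] unfolding simplicial_set_def by blast

lemma mapping_space_act:
  "act (mapping_space K X) p q \<theta> u = (\<lambda>m. \<lambda>\<mu>\<in>K m. act (Lev X m) p q \<theta> (u m \<mu>))"
  unfolding mapping_space_def restrict_family_def by (simp add: fun_eq_iff)

lemma mapping_spaceI:
  assumes "\<And>m \<mu>. \<mu> \<in> K m \<Longrightarrow> u m \<mu> \<in> cells (Lev X m) p" "\<And>m. u m \<in> extensional (K m)"
    "\<And>l m \<nu> \<mu>. \<nu> \<in> inj_maps atMost l m \<Longrightarrow> \<mu> \<in> K m \<Longrightarrow> u l (compose {..l} \<mu> \<nu>) = Res X l m \<nu> p (u m \<mu>)"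
  shows "u \<in> cells (mapping_space K X) p"
  using assms unfolding mapping_space_def by (auto simp: PiE_iff)

lemma simplicial_set_mapping_space:
  assumes K: "\<And>l m \<nu> \<mu>. \<nu> \<in> inj_maps atMost l m \<Longrightarrow> \<mu> \<in> K m \<Longrightarrow> compose {..l} \<mu> \<nu> \<in> K l"
    and inj: "\<And>m. K m \<subseteq> inj_maps atMost m N"
  shows "simplicial_set (mapping_space K X)"
  unfolding simplicial_set_def mapping_space_act
proof (intro conjI allI ballI funcsetI)
  fix p q \<theta> u assume \<theta>: "\<theta> \<in> mono_maps p q" and u: "u \<in> cells (mapping_space K X) q"
  show "(\<lambda>m. \<lambda>\<mu>\<in>K m. act (Lev X m) p q \<theta> (u m \<mu>)) \<in> cells (mapping_space K X) p"
  proof (rule mapping_spaceI)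
    fix l m \<nu> \<mu> assume \<nu>: "\<nu> \<in> inj_maps atMost l m" and \<mu>: "\<mu> \<in> K m"
    show "(\<lambda>\<mu>\<in>K l. act (Lev X l) p q \<theta> (u l \<mu>)) (compose {..l} \<mu> \<nu>)
        = Res X l m \<nu> p ((\<lambda>\<mu>\<in>K m. act (Lev X m) p q \<theta> (u m \<mu>)) \<mu>)"
      using K[OF \<nu> \<mu>] \<mu> mapping_spaceD(3)[OF u \<nu> \<mu>] Res_act[OF \<nu> \<theta> mapping_spaceD(1)[OF u \<mu>]] by simp
  qed (use act_closed[OF \<theta>] mapping_spaceD(1)[OF u] in auto)
next
  fix p u assume u: "u \<in> cells (mapping_space K X) p"
  show "(\<lambda>m. \<lambda>\<mu>\<in>K m. act (Lev X m) p p (id_map atMost p) (u m \<mu>)) = u"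
  proof (intro ext)
    fix m \<mu>
    show "(\<lambda>\<mu>\<in>K m. act (Lev X m) p p (id_map atMost p) (u m \<mu>)) \<mu> = u m \<mu>"
      using act_id mapping_spaceD(1,2)[OF u] by (cases "\<mu> \<in> K m") auto
  qed
next
  fix l p q \<phi> \<theta> u
  assume "\<phi> \<in> mono_maps l p" "\<theta> \<in> mono_maps p q" and u: "u \<in> cells (mapping_space K X) q"
  then show "(\<lambda>m. \<lambda>\<mu>\<in>K m. act (Lev X m) l q (compose {..l} \<theta> \<phi>) (u m \<mu>))
      = (\<lambda>m. \<lambda>\<mu>\<in>K m. act (Lev X m) l p \<phi> ((\<lambda>\<mu>\<in>K m. act (Lev X m) p q \<theta> (u m \<mu>)) \<mu>))"
    using act_compose mapping_spaceD(1)[OF u] by (intro ext) (auto simp: restrict_def)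
qed

text \<open>On an injection that misses \<open>j\<close> the value is forced by \<open>y j\<close>.
  If two vertices are missed, both prescriptions factor through the common face of the two simplices
  and agree by \<open>comp\<close>. With \<open>T\<close> all vertices this describes maps out of a
  boundary, with one vertex left out maps out of a horn.\<close>

lemma faces_to_map:
  assumes y: "\<And>j. j \<in> T \<Longrightarrow> y j \<in> cells (Lev X n) p" and T: "T \<subseteq> {..Suc n}"
    and comp: "\<And>a b. a \<in> T \<Longrightarrow> b \<in> T \<Longrightarrow> a < b \<Longrightarrow> aug_face X p n a (y b) = aug_face X p n (b - 1) (y a)"
  defines "K \<equiv> (\<lambda>m. {\<mu> \<in> inj_maps atMost m (Suc n). \<exists>j\<in>T. j \<notin> \<mu> ` {..m}})"
  obtains u where "u \<in> cells (mapping_space K X) p" "\<And>j. j \<in> T \<Longrightarrow> u n (coface n j) = y j"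
proof -
  define v where "v m \<mu> j = Res X m n (squash m j \<mu>) p (y j)" for m \<mu> j
  have lt: "v m \<mu> a = v m \<mu> b"
    if \<mu>: "\<mu> \<in> inj_maps atMost m (Suc n)" and ab: "a \<in> T" "b \<in> T" "a < b" "a \<notin> \<mu> ` {..m}" "b \<notin> \<mu> ` {..m}"
    for m \<mu> a b
  proof -
    have le: "a \<le> Suc n" "b \<le> Suc n" using ab T by auto
    \<comment> \<open>A map from a nonempty set to \<open>[1]\<close> cannot miss both
      vertices.\<close>
    have "n \<noteq> 0"
    proof
      assume "n = 0"
      then have "a = 0" "b = 1" "\<mu> 0 \<le> 1" using ab le inj_mapsD(1)[OF \<mu>, of 0] by auto
      moreover have "\<mu> 0 \<noteq> a" "\<mu> 0 \<noteq> b" using ab(4,5) by (metis atMost_iff image_eqI le0)+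
      ultimately show False by linarith
    qed
    then obtain n' where n: "n = Suc n'" by (cases n) auto
    note sq = squash_squash[OF \<mu>[unfolded n] ab(3-5)]
    have sa: "squash m a \<mu> \<in> inj_maps atMost m (Suc n')" and sb: "squash m b \<mu> \<in> inj_maps atMost m (Suc n')"
      using squash(1)[OF \<mu>] le ab n by auto
    have ba: "b - 1 \<le> Suc n'" "a \<le> Suc n'" using le ab n by auto
    have "v m \<mu> b = Res X m (Suc n') (compose {..m} (coface n' a) (squash m a (squash m b \<mu>))) p (y b)"
      unfolding v_def using squash(2)[OF sb ba(2) sq(2)] n by simp
    also have "\<dots> = Res X m n' (squash m a (squash m b \<mu>)) p (Res X n' (Suc n') (coface n' a) p (y b))"
      by (rule Res_compose[OF squash(1)[OF sb ba(2) sq(2)] coface_inj]) (use y ab n in auto)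
    also have "Res X n' (Suc n') (coface n' a) p (y b) = Res X n' (Suc n') (coface n' (b - 1)) p (y a)"
      using comp[OF ab(1-3)] n by simp
    also have "Res X m n' (squash m a (squash m b \<mu>)) p \<dots>
        = Res X m (Suc n') (compose {..m} (coface n' (b - 1)) (squash m (b - 1) (squash m a \<mu>))) p (y a)"
      unfolding sq(1)
      by (rule Res_compose[OF squash(1)[OF sa ba(1) sq(3)] coface_inj, symmetric]) (use y ab n in auto)
    also have "\<dots> = v m \<mu> a"
      unfolding v_def using squash(2)[OF sa ba(1) sq(3)] n by simp
    finally show ?thesis ..
  qed
  have eq: "v m \<mu> a = v m \<mu> b"
    if "\<mu> \<in> inj_maps atMost m (Suc n)" "a \<in> T" "b \<in> T" "a \<notin> \<mu> ` {..m}" "b \<notin> \<mu> ` {..m}" for m \<mu> a b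
    using lt[OF that(1), of a b] lt[OF that(1), of b a] that by (metis linorder_neqE_nat)
  define u where "u m = (\<lambda>\<mu>\<in>K m. v m \<mu> (SOME j. j \<in> T \<and> j \<notin> \<mu> ` {..m}))" for m
  have uv: "u m \<mu> = v m \<mu> j" if "\<mu> \<in> inj_maps atMost m (Suc n)" "j \<in> T" "j \<notin> \<mu> ` {..m}" for m \<mu> j
  proof -
    define c where "c = (SOME j. j \<in> T \<and> j \<notin> \<mu> ` {..m})"
    have c: "c \<in> T \<and> c \<notin> \<mu> ` {..m}" unfolding c_def by (rule someI[of _ j]) (use that in simp)
    have "\<mu> \<in> K m" unfolding K_def using that by blast
    then have "u m \<mu> = v m \<mu> c" unfolding u_def c_def by simp
    also have "\<dots> = v m \<mu> j" by (rule eq[OF that(1)]) (use c that in simp_all)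
    finally show ?thesis .
  qed
  have vc: "v m \<mu> j \<in> cells (Lev X m) p" if "\<mu> \<in> inj_maps atMost m (Suc n)" "j \<in> T" "j \<notin> \<mu> ` {..m}" for m \<mu> j
    unfolding v_def by (rule Res_closed[OF squash(1)]) (use that T y in auto)
  show thesis
  proof (rule that)
    show "u \<in> cells (mapping_space K X) p"
    proof (rule mapping_spaceI)
      fix m \<mu> assume "\<mu> \<in> K m"
      then obtain j where "\<mu> \<in> inj_maps atMost m (Suc n)" "j \<in> T" "j \<notin> \<mu> ` {..m}" unfolding K_def by blast
      then show "u m \<mu> \<in> cells (Lev X m) p" using uv vc by simp
    next
      fix l m \<nu> \<mu> assume \<nu>: "\<nu> \<in> inj_maps atMost l m" and "\<mu> \<in> K m"
      then obtain j where j: "\<mu> \<in> inj_maps atMost m (Suc n)" "j \<in> T" "j \<notin> \<mu> ` {..m}" unfolding K_def by blast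
      have "j \<notin> compose {..l} \<mu> \<nu> ` {..l}"
        using j(3) inj_mapsD(1)[OF \<nu>] unfolding compose_image by auto
      then have "u l (compose {..l} \<mu> \<nu>) = v l (compose {..l} \<mu> \<nu>) j"
        using uv[OF compose_inj[OF j(1) \<nu>] j(2)] by simp
      also have "\<dots> = Res X l m \<nu> p (v m \<mu> j)"
        unfolding v_def squash_compose[OF \<nu>]
        by (rule Res_compose[OF \<nu> squash(1)[OF j(1)]]) (use j T y in auto)
      finally show "u l (compose {..l} \<mu> \<nu>) = Res X l m \<nu> p (u m \<mu>)" using uv[OF j] by simp
    qed (simp add: u_def)
    fix j assume j: "j \<in> T"
    then have "u n (coface n j) = v n (coface n j) j" by (rule uv[OF coface_inj _ coface_avoids])
    then show "u n (coface n j) = y j"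
      unfolding v_def using j T y squash_coface Res_id by auto
  qed
qed

end

section \<open>Consequences of Reedy fibrancy\<close>

locale ss_space =
  fixes X :: "'a diagram"
  assumes ss_space: "semi_simplicial_space X"

sublocale ss_space \<subseteq> presheaf X
  using ss_space unfolding semi_simplicial_space_def presheaf_def by blast

context ss_space
begin

lemma ss_boundary_closed:
  "\<nu> \<in> inj_maps atMost l m \<Longrightarrow> \<mu> \<in> ss_boundary n m \<Longrightarrow> compose {..l} \<mu> \<nu> \<in> ss_boundary n l"
  unfolding ss_boundary_def using compose_inj inj_mapsD(1) by (fastforce simp: compose_image)

lemma lift_matching:
  assumes k: "k \<le> 1" and x: "x \<in> cells (Lev X n) 0" and u: "u \<in> cells (mapping_space (ss_boundary n) X) 1"
    and ux: "\<And>m \<mu>. \<mu> \<in> ss_boundary n m \<Longrightarrow> act (Lev X m) 0 1 (\<lambda>_\<in>{..0}. k) (u m \<mu>) = Res X m n \<mu> 0 x"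
  obtains Q where "Q \<in> cells (Lev X n) 1" "act (Lev X n) 0 1 (\<lambda>_\<in>{..0}. k) Q = x"
    "\<And>m \<mu>. \<mu> \<in> ss_boundary n m \<Longrightarrow> Res X m n \<mu> 1 Q = u m \<mu>"
proof -
  have fib: "kan_fibration (Lev X n) (mapping_space (ss_boundary n) X) (matching_map X n)"
    using ss_space unfolding semi_simplicial_space_def by blast
  have B: "simplicial_set (mapping_space (ss_boundary n) X)"
    by (rule simplicial_set_mapping_space[OF ss_boundary_closed]) (auto simp: ss_boundary_def)
  have "act (mapping_space (ss_boundary n) X) 0 1 (\<lambda>_\<in>{..0}. k) u = matching_map X n 0 x"
    unfolding mapping_space_act matching_map_def restrict_family_def
    by (rule ext, rule restrict_ext, rule ux)
  then obtain Q where Q: "Q \<in> cells (Lev X n) 1" "act (Lev X n) 0 1 (\<lambda>_\<in>{..0}. k) Q = x"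
    "matching_map X n 1 Q = u"
    using path_lifting[OF fib Lev_sset B k x u] by blast
  have "Res X m n \<mu> 1 Q = u m \<mu>" if "\<mu> \<in> ss_boundary n m" for m \<mu>
    unfolding Q(3)[symmetric] matching_map_def restrict_family_def using that by simp
  with Q show thesis using that by blast
qed

text \<open>Path lifting is the lifting property of the matching maps: compatible paths on the faces
  form a path in the space of boundaries, and \<open>lift_matching\<close> lifts it.\<close>

lemma path_space_aug:
  "path_space (aug_cells X 0) (aug_face X 0) (aug_cells X 1) (aug_face X 1) (aug_end X)"
proof -
  interpret A: face_set "aug_cells X 0" "aug_face X 0" by (rule face_set_aug)
  interpret P: face_set "aug_cells X 1" "aug_face X 1" by (rule face_set_aug)
  show ?thesis
  proof
    show "x = y" if "x \<in> aug_cells X 0 0" "y \<in> aug_cells X 0 0" for x y using that by simp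
    show "p = q" if "p \<in> aug_cells X 1 0" "q \<in> aug_cells X 1 0" for p q using that by simp
    show "aug_end X k n q \<in> aug_cells X 0 n" if "q \<in> aug_cells X 1 n" "k \<le> 1" for q n k
      using that act_closed[OF const_mono[OF that(2), of 0]] by (cases n) auto
    show "aug_face X 0 n i (aug_end X k (Suc n) q) = aug_end X k n (aug_face X 1 n i q)"
      if "q \<in> aug_cells X 1 (Suc n)" "k \<le> 1" "i \<le> n" for q n k i
      using that Res_act[OF coface_inj const_mono[OF that(2), of 0]] by (cases n) auto
  next
    fix k n x and r :: "nat \<Rightarrow> 'a"
    assume k: "k \<le> 1" and x: "x \<in> aug_cells X 0 (Suc n)"
      and r: "\<And>j. j \<le> n \<Longrightarrow> r j \<in> aug_cells X 1 n \<and> aug_end X k n (r j) = aug_face X 0 n j x"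
      and comp: "\<And>a b. a < b \<Longrightarrow> b \<le> n \<Longrightarrow> aug_face X 1 (n - 1) a (r b) = aug_face X 1 (n - 1) (b - 1) (r a)"
    have x': "x \<in> cells (Lev X n) 0" using x by simp
    show "\<exists>Q\<in>aug_cells X 1 (Suc n). aug_end X k (Suc n) Q = x \<and> (\<forall>j\<le>n. aug_face X 1 n j Q = r j)"
    proof (cases n)
      case 0
      \<comment> \<open>The boundary of a point is empty, so any path with the prescribed end
        \<open>x\<close> will do; \<open>r 0\<close> is the only element of degree 0.\<close>
      have empty: "ss_boundary 0 m = {}" for m
        unfolding ss_boundary_def inj_maps_def by (auto simp: PiE_iff)
      have "(\<lambda>_ _. undefined) \<in> cells (mapping_space (ss_boundary n) X) 1"
        by (rule mapping_spaceI) (auto simp: empty 0)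
      then obtain Q where "Q \<in> cells (Lev X n) 1" "act (Lev X n) 0 1 (\<lambda>_\<in>{..0}. k) Q = x"
        by (rule lift_matching[OF k x']) (auto simp: empty 0)
      then show ?thesis using r[of 0] 0 by auto
    next
      case (Suc n')
      have r': "r j \<in> cells (Lev X n') 1" "act (Lev X n') 0 1 (\<lambda>_\<in>{..0}. k) (r j) = Res X n' n (coface n' j) 0 x"
        if "j \<le> n" for j using r[OF that] Suc by auto
      obtain u where u: "u \<in> cells (mapping_space (\<lambda>m. {\<mu> \<in> inj_maps atMost m (Suc n').
            \<exists>j\<in>{..Suc n'}. j \<notin> \<mu> ` {..m}}) X) 1"
        "\<And>j. j \<in> {..Suc n'} \<Longrightarrow> u n' (coface n' j) = r j"
        by (rule faces_to_map[of "{..Suc n'}" r n' 1]) (use r' comp Suc in auto)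
      have u1: "u \<in> cells (mapping_space (ss_boundary n) X) 1"
        using u(1) unfolding ss_boundary_eq[symmetric] Suc by simp
      have cof: "coface n' j \<in> ss_boundary n n'" if "j \<le> n" for j
        unfolding ss_boundary_def using coface_inj coface_avoids[of j n'] that Suc by (auto intro!: exI[of _ j])
      have "act (Lev X m) 0 1 (\<lambda>_\<in>{..0}. k) (u m \<mu>) = Res X m n \<mu> 0 x" if "\<mu> \<in> ss_boundary n m" for m \<mu>
      proof -
        obtain j where j: "\<mu> \<in> inj_maps atMost m n" "j \<le> n" "j \<notin> \<mu> ` {..m}"
          using \<open>\<mu> \<in> ss_boundary n m\<close> unfolding ss_boundary_def by blast
        note sq = squash[OF j[unfolded Suc]]
        have "u m \<mu> = Res X m n' (squash m j \<mu>) 1 (r j)"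
          using mapping_spaceD(3)[OF u1 sq(1) cof[OF j(2)]] sq(2) u(2)[of j] j(2) Suc by simp
        then have "act (Lev X m) 0 1 (\<lambda>_\<in>{..0}. k) (u m \<mu>)
            = Res X m n' (squash m j \<mu>) 0 (Res X n' n (coface n' j) 0 x)"
          using Res_act[OF sq(1) const_mono[OF k, of 0] r'(1)[OF j(2)]] r'(2)[OF j(2)] by simp
        also have "\<dots> = Res X m n \<mu> 0 x"
          using Res_compose[OF sq(1) coface_inj, of x 0 j] x' sq(2) Suc by simp
        finally show ?thesis .
      qed
      then obtain Q where Q: "Q \<in> cells (Lev X n) 1" "act (Lev X n) 0 1 (\<lambda>_\<in>{..0}. k) Q = x"
        "\<And>m \<mu>. \<mu> \<in> ss_boundary n m \<Longrightarrow> Res X m n \<mu> 1 Q = u m \<mu>"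
        using lift_matching[OF k x' u1] by blast
      have "aug_face X 1 n j Q = r j" if "j \<le> n" for j
        using Q(3)[OF cof[OF that]] u(2)[of j] that Suc by simp
      then show ?thesis using Q by auto
    qed
  qed
qed

lemma coface_horn: "j \<le> Suc n \<Longrightarrow> j \<noteq> i \<Longrightarrow> coface n j \<in> ss_horn (Suc n) i n"
  unfolding ss_horn_def using coface_inj coface_avoids[of j n] by (auto intro!: exI[of _ j])

text \<open>Reedy fibrancy turns fillers up to homotopy into strict ones.\<close>

lemma inner_kan_aug:
  assumes inner: "inner_Kan_space X"
  shows "inner_kan_set (aug_cells X 0) (aug_face X 0)"
proof -
  interpret path_space "aug_cells X 0" "aug_face X 0" "aug_cells X 1" "aug_face X 1" "aug_end X"
    by (rule path_space_aug)
  show ?thesis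
  proof
    fix i n and y :: "nat \<Rightarrow> 'a"
    assume i: "0 < i" "i \<le> n" and y: "\<And>j. j \<le> Suc n \<Longrightarrow> j \<noteq> i \<Longrightarrow> y j \<in> aug_cells X 0 (Suc n)"
      and comp: "\<And>a b. a < b \<Longrightarrow> b \<le> Suc n \<Longrightarrow> a \<noteq> i \<Longrightarrow> b \<noteq> i \<Longrightarrow>
        aug_face X 0 n a (y b) = aug_face X 0 n (b - 1) (y a)"
    obtain n' where n: "n = Suc n'" using i by (cases n) auto
    let ?T = "{..Suc n} - {i}"
    obtain u where u: "u \<in> cells (mapping_space (\<lambda>m. {\<mu> \<in> inj_maps atMost m (Suc n).
          \<exists>j\<in>?T. j \<notin> \<mu> ` {..m}}) X) 0"
      "\<And>j. j \<in> ?T \<Longrightarrow> u n (coface n j) = y j"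
      by (rule faces_to_map[of ?T y n 0]) (use y comp in auto)
    have horn: "(\<lambda>m. {\<mu> \<in> inj_maps atMost m (Suc n). \<exists>j\<in>?T. j \<notin> \<mu> ` {..m}}) = ss_horn (Suc n) i"
      unfolding ss_horn_def by (intro ext) auto
    let ?M = "mapping_space (ss_horn (Suc n) i) X"
    have "horn_extends X (Suc n) i u"
      using inner u(1) i unfolding inner_Kan_space_def horn by simp
    then obtain v where v: "v \<in> points (mapping_space (ss_simplex (Suc n)) X)"
      and conn: "same_component ?M (restrict_family (ss_horn (Suc n) i) v) u"
      unfolding horn_extends_def by blast
    \<comment> \<open>A strict filler is transported along the zigzag from the restriction of
      \<open>v\<close> to \<open>u\<close>: each path is lifted to a path of simplices by
      \<open>lift_horn\<close>, whose other end is the next filler.\<close>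
    from conn have "\<exists>x\<in>aug_cells X 0 (Suc (Suc n)). \<forall>j\<le>Suc n. j \<noteq> i \<longrightarrow> aug_face X 0 (Suc n) j x = u n (coface n j)"
      unfolding same_component_def
    proof (induction rule: equivclp_induct)
      case base
      have id: "id_map atMost (Suc n) \<in> ss_simplex (Suc n) (Suc n)"
        unfolding ss_simplex_def by (rule id_map_inj)
      have "Res X n (Suc n) (coface n j) 0 (v (Suc n) (id_map atMost (Suc n)))
          = restrict_family (ss_horn (Suc n) i) v n (coface n j)" if "j \<le> Suc n" "j \<noteq> i" for j
      proof -
        have "compose {..n} (id_map atMost (Suc n)) (coface n j) = coface n j"
          using that by (auto simp: compose_def id_map_def coface_def fun_eq_iff)
        then show ?thesis
          using mapping_spaceD(3)[OF v coface_inj id, of j] coface_horn[OF that]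
          by (simp add: restrict_family_def)
      qed
      then show ?case
        using mapping_spaceD(1)[OF v id] by (intro bexI[of _ "v (Suc n) (id_map atMost (Suc n))"]) auto
    next
      case (step w w')
      obtain q k where q: "q \<in> cells ?M 1" and k: "k \<le> 1"
        and w: "w = act ?M 0 1 (\<lambda>_\<in>{..0}. k) q"
        and w': "w' = act ?M 0 1 (\<lambda>_\<in>{..0}. 1 - k) q"
      proof -
        from step(2) show thesis
        proof
          assume "\<exists>e\<in>cells ?M 1.
            act ?M 0 1 (\<lambda>_\<in>{..0}. 0) e = w \<and>
            act ?M 0 1 (\<lambda>_\<in>{..0}. 1) e = w'"
          then show thesis using that[of _ 0] by auto
        next
          assume "\<exists>e\<in>cells ?M 1.
            act ?M 0 1 (\<lambda>_\<in>{..0}. 0) e = w' \<and>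
            act ?M 0 1 (\<lambda>_\<in>{..0}. 1) e = w"
          then show thesis using that[of _ 1] by auto
        qed
      qed
      obtain x where x: "x \<in> aug_cells X 0 (Suc (Suc n))"
        "\<And>j. j \<le> Suc n \<Longrightarrow> j \<noteq> i \<Longrightarrow> aug_face X 0 (Suc n) j x = w n (coface n j)"
        using step.IH by blast
      have "\<exists>Q\<in>aug_cells X 1 (Suc (Suc n)). aug_end X k (Suc (Suc n)) Q = x \<and>
          (\<forall>j\<le>Suc n. j \<noteq> i \<longrightarrow> aug_face X 1 (Suc n) j Q = q n (coface n j))"
      proof (rule lift_horn[OF k x(1)])
        show "i \<le> Suc n" using i by simp
        show "q n (coface n j) \<in> aug_cells X 1 (Suc n) \<and>
            aug_end X k (Suc n) (q n (coface n j)) = aug_face X 0 (Suc n) j x" if "j \<le> Suc n" "j \<noteq> i" for j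
          using mapping_spaceD(1)[OF q coface_horn[OF that]] coface_horn[OF that] x(2)[OF that] w
          by (simp add: mapping_space_act)
        show "aug_face X 1 n a (q n (coface n b)) = aug_face X 1 n (b - 1) (q n (coface n a))"
          if ab: "a < b" "b \<le> Suc n" "a \<noteq> i" "b \<noteq> i" for a b
        proof -
          have "compose {..n'} (coface n b) (coface n' a) = compose {..n'} (coface n a) (coface n' (b - 1))"
            using coface_coface[of a b n'] ab n by simp
          then show ?thesis
            using mapping_spaceD(3)[OF q coface_inj[of n' a, folded n] coface_horn[of b n i]]
              mapping_spaceD(3)[OF q coface_inj[of n' "b - 1", folded n] coface_horn[of a n i]] ab n by simp
        qed
      qed
      then obtain Q where Q: "Q \<in> aug_cells X 1 (Suc (Suc n))"
        "\<And>j. j \<le> Suc n \<Longrightarrow> j \<noteq> i \<Longrightarrow> aug_face X 1 (Suc n) j Q = q n (coface n j)" by blast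
      have "aug_face X 0 (Suc n) j (aug_end X (1 - k) (Suc (Suc n)) Q) = w' n (coface n j)"
        if "j \<le> Suc n" "j \<noteq> i" for j
        using bd_face[OF Q(1), of "1 - k" j] Q(2)[OF that] that coface_horn[OF that] w'
        by (simp add: mapping_space_act)
      then show ?case using bd_closed[OF Q(1), of "1 - k"] by auto
    qed
    then show "\<exists>z\<in>aug_cells X 0 (Suc (Suc n)). \<forall>j\<le>Suc n. j \<noteq> i \<longrightarrow> aug_face X 0 (Suc n) j z = y j"
      using u(2) by auto
  qed
qed

lemma pt_path_component:
  "equivclp (path_space.pt_path (aug_cells X 1) (aug_end X) (Suc m)) = same_component (Lev X m)"
proof -
  interpret path_space "aug_cells X 0" "aug_face X 0" "aug_cells X 1" "aug_face X 1" "aug_end X"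
    by (rule path_space_aug)
  show ?thesis unfolding same_component_def pt_path_def by simp
qed

lemma fam_conn_component:
  assumes K: "fin_complex K"
    and conn: "equivclp (path_space.fam_path (aug_cells X 1) (aug_face X 1) (aug_end X) K) U V"
  shows "same_component (mapping_space (ss_of N K) X) (fam_to_map N K U) (fam_to_map N K V)"
proof -
  interpret path_space "aug_cells X 0" "aug_face X 0" "aug_cells X 1" "aug_face X 1" "aug_end X"
    by (rule path_space_aug)
  let ?M = "mapping_space (ss_of N K) X"
  let ?r = "\<lambda>x y. \<exists>e\<in>cells ?M 1. act ?M 0 1 (\<lambda>_\<in>{..0}. 0) e = x \<and> act ?M 0 1 (\<lambda>_\<in>{..0}. 1) e = y"
  have step: "?r (fam_to_map N K U) (fam_to_map N K V)" if "fam_path K U V" for U V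
  proof -
    obtain Q where Q: "Q \<in> fam (aug_cells X 1) (aug_face X 1) K"
      "U = (\<lambda>S\<in>K. aug_end X 0 (card S) (Q S))" "V = (\<lambda>S\<in>K. aug_end X 1 (card S) (Q S))"
      using \<open>fam_path K U V\<close> unfolding fam_path_def by blast
    have "act ?M 0 1 (\<lambda>_\<in>{..0}. k) (fam_to_map N K Q)
        = fam_to_map N K (\<lambda>S\<in>K. aug_end X k (card S) (Q S))" for k
      unfolding mapping_space_act fam_to_map_def
      by (intro ext restrict_ext) (auto simp: ss_of_def card_image_inj restrict_def)
    then show ?thesis using fam_to_map_cell[OF Q(1) K, of N] Q(2,3) by blast
  qed
  show ?thesis
    unfolding same_component_def by (rule equivclp_map[where f = "fam_to_map N K", OF _ conn]) (rule step)
qed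

end

section \<open>Reversal of the order of the vertices\<close>

definition rev_face :: "(nat \<Rightarrow> nat \<Rightarrow> 'a \<Rightarrow> 'a) \<Rightarrow> nat \<Rightarrow> nat \<Rightarrow> 'a \<Rightarrow> 'a" where
  "rev_face d n i = d n (n - i)"

lemma face_set_rev:
  assumes "face_set A d"
  shows "face_set A (rev_face d)"
proof -
  interpret face_set A d by fact
  show ?thesis
  proof
    fix x n i j assume x: "x \<in> A (Suc (Suc n))" and ij: "i < j" "j \<le> Suc n"
    show "rev_face d n i (rev_face d (Suc n) j x) = rev_face d n (j - 1) (rev_face d (Suc n) i x)"
      using face_face[OF x, of "Suc n - j" "Suc n - i"] ij unfolding rev_face_def
      by (simp add: Suc_diff_le)
  qed (simp add: rev_face_def face_closed)
qed

lemma inner_kan_set_rev: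
  assumes "inner_kan_set A d"
  shows "inner_kan_set A (rev_face d)"
proof -
  interpret inner_kan_set A d by fact
  interpret R: face_set A "rev_face d" by (rule face_set_rev) (rule face_set_axioms)
  show ?thesis
  proof
    fix i n and y :: "nat \<Rightarrow> 'a"
    assume i: "0 < i" "i \<le> n" and y: "\<And>j. j \<le> Suc n \<Longrightarrow> j \<noteq> i \<Longrightarrow> y j \<in> A (Suc n)"
      and comp: "\<And>a b. a < b \<Longrightarrow> b \<le> Suc n \<Longrightarrow> a \<noteq> i \<Longrightarrow> b \<noteq> i \<Longrightarrow>
        rev_face d n a (y b) = rev_face d n (b - 1) (y a)"
    have "\<exists>z\<in>A (Suc (Suc n)). \<forall>j\<le>Suc n. j \<noteq> Suc n - i \<longrightarrow> d (Suc n) j z = y (Suc n - j)"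
    proof (rule inner_fill)
      fix a b assume ab: "a < b" "b \<le> Suc n" "a \<noteq> Suc n - i" "b \<noteq> Suc n - i"
      have "rev_face d n (Suc n - b) (y (Suc n - a)) = rev_face d n (Suc n - a - 1) (y (Suc n - b))"
        using comp[of "Suc n - b" "Suc n - a"] ab i by auto
      moreover have "n - (Suc n - b) = b - 1" "n - (Suc n - a - 1) = a" using ab by auto
      ultimately show "d n a (y (Suc n - b)) = d n (b - 1) (y (Suc n - a))"
        unfolding rev_face_def by simp
    qed (use i y in auto)
    then obtain z where z: "z \<in> A (Suc (Suc n))"
      "\<And>j. j \<le> Suc n \<Longrightarrow> j \<noteq> Suc n - i \<Longrightarrow> d (Suc n) j z = y (Suc n - j)" by blast
    have "rev_face d (Suc n) j z = y j" if "j \<le> Suc n" "j \<noteq> i" for j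
      using z(2)[of "Suc n - j"] that i unfolding rev_face_def by auto
    then show "\<exists>z\<in>A (Suc (Suc n)). \<forall>j\<le>Suc n. j \<noteq> i \<longrightarrow> rev_face d (Suc n) j z = y j" using z(1) by blast
  qed
qed

lemma path_space_rev:
  assumes "path_space A d P e bd"
  shows "path_space A (rev_face d) P (rev_face e) bd"
proof -
  interpret path_space A d P e bd by fact
  interpret RA: face_set A "rev_face d" by (rule face_set_rev) (rule A.face_set_axioms)
  interpret RP: face_set P "rev_face e" by (rule face_set_rev) (rule P.face_set_axioms)
  show ?thesis
  proof
    fix k n x and r :: "nat \<Rightarrow> 'a"
    assume k: "k \<le> 1" and x: "x \<in> A (Suc n)"
      and r: "\<And>j. j \<le> n \<Longrightarrow> r j \<in> P n \<and> bd k n (r j) = rev_face d n j x"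
      and comp: "\<And>a b. a < b \<Longrightarrow> b \<le> n \<Longrightarrow> rev_face e (n - 1) a (r b) = rev_face e (n - 1) (b - 1) (r a)"
    have "\<exists>Q\<in>P (Suc n). bd k (Suc n) Q = x \<and> (\<forall>j\<le>n. e n j Q = r (n - j))"
    proof (rule lift[OF k x])
      show "r (n - j) \<in> P n \<and> bd k n (r (n - j)) = d n j x" if "j \<le> n" for j
        using r[of "n - j"] that unfolding rev_face_def by simp
      fix a b assume ab: "a < b" "b \<le> n"
      have "rev_face e (n - 1) (n - b) (r (n - a)) = rev_face e (n - 1) (n - a - 1) (r (n - b))"
        using comp[of "n - b" "n - a"] ab by auto
      moreover have "n - 1 - (n - b) = b - 1" "n - 1 - (n - a - 1) = a" using ab by auto
      ultimately show "e (n - 1) a (r (n - b)) = e (n - 1) (b - 1) (r (n - a))"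
        unfolding rev_face_def by simp
    qed
    then obtain Q where Q: "Q \<in> P (Suc n)" "bd k (Suc n) Q = x" "\<And>j. j \<le> n \<Longrightarrow> e n j Q = r (n - j)" by blast
    have "rev_face e n j Q = r j" if "j \<le> n" for j using Q(3)[of "n - j"] that unfolding rev_face_def by simp
    then show "\<exists>Q\<in>P (Suc n). bd k (Suc n) Q = x \<and> (\<forall>j\<le>n. rev_face e n j Q = r j)" using Q by blast
  qed (use A0 P0 bd_closed bd_face in \<open>auto simp: rev_face_def\<close>)
qed

definition rev_set :: "nat \<Rightarrow> nat set \<Rightarrow> nat set" where
  "rev_set N S = (\<lambda>v. N - v) ` S"

lemma rev_set:
  assumes "S \<subseteq> {..N}"
  shows "rev_set N S \<subseteq> {..N}" "rev_set N (rev_set N S) = S" "card (rev_set N S) = card S"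
    "v \<le> N \<Longrightarrow> v \<in> rev_set N S \<longleftrightarrow> N - v \<in> S"
    "a \<in> S \<Longrightarrow> rev_set N (S - {a}) = rev_set N S - {N - a}"
    "a \<in> S \<Longrightarrow> rank (rev_set N S) (N - a) = card S - 1 - rank S a"
proof -
  have inj: "inj_on (\<lambda>v. N - v) T" if "T \<subseteq> {..N}" for T using that by (intro inj_onI) (metis atMost_iff diff_diff_cancel subsetD)
  show "rev_set N S \<subseteq> {..N}" by (auto simp: rev_set_def)
  have "rev_set N (rev_set N S) = (\<lambda>v. v) ` S"
    unfolding rev_set_def image_image using assms by (intro image_cong) auto
  then show "rev_set N (rev_set N S) = S" by simp
  show "card (rev_set N S) = card S" unfolding rev_set_def by (rule card_image[OF inj[OF assms]])
  show "v \<in> rev_set N S \<longleftrightarrow> N - v \<in> S" if "v \<le> N" for v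
  proof
    assume "v \<in> rev_set N S"
    then obtain w where "w \<in> S" "v = N - w" by (auto simp: rev_set_def)
    then show "N - v \<in> S" using assms by auto
  next
    assume "N - v \<in> S"
    then show "v \<in> rev_set N S" unfolding rev_set_def using that by (intro image_eqI[of _ _ "N - v"]) auto
  qed
  assume a: "a \<in> S"
  show "rev_set N (S - {a}) = rev_set N S - {N - a}"
    unfolding rev_set_def using a assms
    by (subst inj_on_image_set_diff[OF inj[OF assms]]) auto
  have fin: "finite S" using assms by (rule finite_subset) simp
  have "{v \<in> rev_set N S. v < N - a} = (\<lambda>v. N - v) ` {v \<in> S. a < v}"
    unfolding rev_set_def using assms a by auto
  then have "rank (rev_set N S) (N - a) = card {v \<in> S. a < v}"
    unfolding rank_def using card_image[OF inj[of "{v \<in> S. a < v}"]] assms by auto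
  moreover have "card S = card {v \<in> S. a < v} + rank S a + 1"
  proof -
    have "S = insert a ({v \<in> S. a < v} \<union> {v \<in> S. v < a})" using a by auto
    moreover have "card (insert a ({v \<in> S. a < v} \<union> {v \<in> S. v < a}))
        = Suc (card {v \<in> S. a < v} + card {v \<in> S. v < a})"
      using fin by (subst card_insert_disjoint) (auto intro!: card_Un_disjoint)
    ultimately show ?thesis unfolding rank_def by simp
  qed
  ultimately show "rank (rev_set N S) (N - a) = card S - 1 - rank S a" by simp
qed

text \<open>Stated for an arbitrary \<open>d'\<close> in order to serve in both directions, from
  \<open>d\<close> to \<open>rev_face d\<close> and back.\<close>

lemma fam_rev:
  assumes U: "U \<in> fam A d K" and K: "fin_complex K'" "K' \<subseteq> Pow {..N}"
    and rev: "\<And>S. S \<in> K' \<Longrightarrow> rev_set N S \<in> K"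
    and d': "\<And>n i. i \<le> n \<Longrightarrow> d' n i = d n (n - i)"
  shows "(\<lambda>S\<in>K'. U (rev_set N S)) \<in> fam A d' K'"
proof (rule sliceI)
  fix S assume S: "S \<in> K'"
  then have SN: "S \<subseteq> {..N}" using K(2) by auto
  show "(\<lambda>S\<in>K'. U (rev_set N S)) S \<in> A (0 + card S)"
    using sliceD(2)[OF U rev[OF S]] rev_set(3)[OF SN] S by simp
  fix a assume a: "a \<in> S"
  have fin: "finite S" using fin_complexD(3)[OF K(1) S] .
  have Sa: "S - {a} \<in> K'" using fin_complexD(5)[OF K(1) S] .
  obtain w where w: "card S = Suc w" "card (S - {a}) = w" using a fin by (metis card_Suc_Diff1)
  have r: "rank S a \<le> w" using rank_less_card[OF fin a] w by simp
  have Na: "N - a \<in> rev_set N S" using a by (auto simp: rev_set_def)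
  have "card (rev_set N S - {N - a}) = w"
    using rev_set(5)[OF SN a] rev_set(3)[of "S - {a}" N] SN w(2) by (simp add: subset_iff)
  then have "d w (w - rank S a) (U (rev_set N S)) = U (rev_set N S - {N - a})"
    using sliceD(3)[OF U rev[OF S] Na] rev_set(6)[OF SN a] w by simp
  then show "d' (0 + card (S - {a})) (0 + rank S a) ((\<lambda>S\<in>K'. U (rev_set N S)) S)
      = (\<lambda>S\<in>K'. U (rev_set N S)) (S - {a})"
    using d'[OF r] S Sa w(2) rev_set(5)[OF SN a] by simp
qed simp

lemma horn_complex_subset: "horn_complex N i \<subseteq> Pow {..N}"
  by (auto simp: horn_complex_def)

lemma horn_complex_rev:
  assumes "i \<le> N" "S \<in> horn_complex N i"
  shows "rev_set N S \<in> horn_complex N (N - i)"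
proof -
  have S: "S \<subseteq> {..N}" using assms(2) by (auto simp: horn_complex_def)
  obtain j where j: "j \<le> N" "j \<noteq> i" "j \<notin> S" using assms(2) by (auto simp: horn_complex_def)
  have "N - j \<notin> rev_set N S" using rev_set(4)[OF S, of "N - j"] j by simp
  moreover have "N - j \<noteq> N - i" using j assms(1) by arith
  ultimately show ?thesis using rev_set(1)[OF S] unfolding horn_complex_def by (auto intro!: exI[of _ "N - j"])
qed

lemma fam_conn_rev:
  assumes "path_space A d P e bd" and "path_space A (rev_face d) P (rev_face e) bd"
    and conn: "equivclp (path_space.fam_path P (rev_face e) bd K) U V"
    and K: "fin_complex K'" "K' \<subseteq> Pow {..N}" and rev: "\<And>S. S \<in> K' \<Longrightarrow> rev_set N S \<in> K"
  shows "equivclp (path_space.fam_path P e bd K') (\<lambda>S\<in>K'. U (rev_set N S)) (\<lambda>S\<in>K'. V (rev_set N S))"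
proof -
  interpret path_space A d P e bd by fact
  interpret R: path_space A "rev_face d" P "rev_face e" bd by fact
  have step: "fam_path K' (\<lambda>S\<in>K'. U (rev_set N S)) (\<lambda>S\<in>K'. V (rev_set N S))" if UV: "R.fam_path K U V" for U V
  proof -
    obtain Q where Q: "Q \<in> fam P (rev_face e) K"
      "U = (\<lambda>S\<in>K. bd 0 (card S) (Q S))" "V = (\<lambda>S\<in>K. bd 1 (card S) (Q S))"
      using UV unfolding R.fam_path_def by blast
    have Q': "(\<lambda>S\<in>K'. Q (rev_set N S)) \<in> fam P e K'"
      by (rule fam_rev[OF Q(1) K rev]) (simp_all add: rev_face_def)
    have card: "card (rev_set N S) = card S" if "S \<in> K'" for S
      using rev_set(3) that K(2) by blast
    show ?thesis unfolding fam_path_def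
      by (rule bexI[OF _ Q'], intro conjI restrict_ext) (simp_all add: Q rev card)
  qed
  show ?thesis by (rule equivclp_map[where f = "\<lambda>U. \<lambda>S\<in>K'. U (rev_set N S)", OF _ conn]) (rule step)
qed

section \<open>Degeneracies of free slices\<close>

text \<open>The coface maps in the indexing by cardinality that the slices use; \<open>m = 0\<close>
  is the inclusion of the empty set.\<close>

definition lcoface :: "nat \<Rightarrow> nat \<Rightarrow> nat \<Rightarrow> nat" where
  "lcoface m j = (\<lambda>l\<in>{..<m}. if l < j then l else Suc l)"

lemma lcoface_inj: "lcoface m j \<in> inj_maps lessThan m (Suc m)"
  unfolding inj_maps_def lcoface_def by (auto simp: strict_mono_on_def)

text \<open>Vertices put in front shift the index of a coface by their number, vertices put behind
  do not. Over a vertex, the two restrictions omit the last vertex but one and the last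
  vertex.\<close>

lemma join_coface:
  "join_map (Suc 0) (Suc 0) m (id_map atMost 0) (lcoface m j) = coface m (Suc j)"
  "join_map (Suc 1) (Suc 1) m (id_map atMost 1) (lcoface m j) = coface (Suc m) (Suc (Suc j))"
  "i \<le> 1 \<Longrightarrow> join_map (Suc 0) (Suc 1) m (coface 0 i) (id_map lessThan m) = coface m i"
  "j \<le> m \<Longrightarrow> join_map m (Suc m) (Suc 0) (lcoface m j) (id_map atMost 0) = coface m j"
  "j \<le> m \<Longrightarrow> join_map m (Suc m) (Suc 1) (lcoface m j) (id_map atMost 1) = coface (Suc m) j"
  "i \<le> 1 \<Longrightarrow> join_map m m (Suc 0) (id_map lessThan m) (coface 0 i) = coface m (m + i)"
  by (auto simp: join_map_def id_map_def lcoface_def coface_def fun_eq_iff)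

text \<open>The homotopy evaluated on the constant path at \<open>x\<close> paired with the
  nondegenerate edge of the interval.\<close>

definition homotopy_path :: "'b diagram \<Rightarrow> (nat \<Rightarrow> nat \<Rightarrow> 'b \<times> (nat \<Rightarrow> nat) \<Rightarrow> 'a) \<Rightarrow> nat \<Rightarrow> 'b \<Rightarrow> 'a" where
  "homotopy_path A H n x = H n 1 (act (Lev A n) 1 0 (\<lambda>_\<in>{..1}. 0) x, id_map atMost 1)"

lemma homotopy_path:
  assumes A: "simplicial_set (Lev A n)"
    and H: "presheaf_map I (times_interval A) B H"
    and x: "x \<in> points (Lev A n)"
  shows "homotopy_path A H n x \<in> cells (Lev B n) 1"
    and "k \<le> 1 \<Longrightarrow> act (Lev B n) 0 1 (\<lambda>_\<in>{..0}. k) (homotopy_path A H n x) = H n 0 (x, \<lambda>_\<in>{..0}. k)"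
    and "\<mu> \<in> inj_maps I m n \<Longrightarrow>
      Res A m n \<mu> 1 (act (Lev A n) 1 0 (\<lambda>_\<in>{..1}. 0) x) = act (Lev A m) 1 0 (\<lambda>_\<in>{..1}. 0) (Res A m n \<mu> 0 x) \<Longrightarrow>
      Res B m n \<mu> 1 (homotopy_path A H n x) = homotopy_path A H m (Res A m n \<mu> 0 x)"
proof -
  let ?x = "act (Lev A n) 1 0 (\<lambda>_\<in>{..1}. 0) x"
  have c: "(\<lambda>_\<in>{..1}. 0) \<in> mono_maps 1 0" by (rule const_mono) simp
  have x': "?x \<in> cells (Lev A n) 1" using A c x unfolding simplicial_set_def by blast
  have cell: "(?x, id_map atMost 1) \<in> cells (Lev (times_interval A) n) 1"
    using x' id_map_mono by (simp add: times_interval_def std_simplex_def)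
  have Hn: "simplicial_map (Lev (times_interval A) n) (Lev B n) (H n)"
    using H unfolding presheaf_map_def by blast
  show "homotopy_path A H n x \<in> cells (Lev B n) 1"
    unfolding homotopy_path_def using Hn cell unfolding simplicial_map_def by blast
  show "act (Lev B n) 0 1 (\<lambda>_\<in>{..0}. k) (homotopy_path A H n x) = H n 0 (x, \<lambda>_\<in>{..0}. k)" if k: "k \<le> 1"
  proof -
    have ck: "(\<lambda>_\<in>{..0}. k) \<in> mono_maps 0 1" by (rule const_mono[OF k])
    have "act (Lev B n) 0 1 (\<lambda>_\<in>{..0}. k) (homotopy_path A H n x)
        = H n 0 (act (Lev (times_interval A) n) 0 1 (\<lambda>_\<in>{..0}. k) (?x, id_map atMost 1))"
      unfolding homotopy_path_def using Hn cell ck unfolding simplicial_map_def by metis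
    also have "act (Lev (times_interval A) n) 0 1 (\<lambda>_\<in>{..0}. k) (?x, id_map atMost 1)
        = (act (Lev A n) 0 1 (\<lambda>_\<in>{..0}. k) ?x, \<lambda>_\<in>{..0}. k)"
      using k by (auto simp: times_interval_def std_simplex_def compose_def id_map_def fun_eq_iff)
    also have "act (Lev A n) 0 1 (\<lambda>_\<in>{..0}. k) ?x = x"
    proof -
      have "act (Lev A n) 0 0 (compose {..0} (\<lambda>_\<in>{..1}. 0) (\<lambda>_\<in>{..0}. k)) x
          = act (Lev A n) 0 1 (\<lambda>_\<in>{..0}. k) ?x"
        using A c ck x unfolding simplicial_set_def by blast
      moreover have "compose {..0 :: nat} (\<lambda>_\<in>{..1 :: nat}. 0) (\<lambda>_\<in>{..0}. k) = id_map atMost 0"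
        using k by (auto simp: compose_def id_map_def fun_eq_iff)
      ultimately show ?thesis using A x unfolding simplicial_set_def by simp
    qed
    finally show ?thesis .
  qed
  assume \<mu>: "\<mu> \<in> inj_maps I m n"
    and R: "Res A m n \<mu> 1 ?x = act (Lev A m) 1 0 (\<lambda>_\<in>{..1}. 0) (Res A m n \<mu> 0 x)"
  have "H m 1 (Res (times_interval A) m n \<mu> 1 (?x, id_map atMost 1)) = Res B m n \<mu> 1 (H n 1 (?x, id_map atMost 1))"
    using H \<mu> cell unfolding presheaf_map_def by blast
  then show "Res B m n \<mu> 1 (homotopy_path A H n x) = homotopy_path A H m (Res A m n \<mu> 0 x)"
    using R unfolding homotopy_path_def by (simp add: times_interval_def)
qed

text \<open>A simplex with \<open>n\<close> vertices lies in the free slice at index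
  \<open>n - 1\<close>, the number of its vertices besides the distinguished one.\<close>

definition aug_deg :: "(nat \<Rightarrow> nat \<Rightarrow> 'a \<Rightarrow> 'a) \<Rightarrow> nat \<Rightarrow> 'a \<Rightarrow> 'a" where
  "aug_deg s n = s (n - 1) 0"

context ss_space
begin

text \<open>The index function \<open>\<rho>\<close> is the identity for the slices under a vertex, and reverses the order of the
  faces for the slices over a vertex.\<close>

lemma degeneracy_instance:
  assumes X: "path_space (aug_cells X 0) (\<lambda>n i. aug_face X 0 n (\<rho> n i)) (aug_cells X 1)
      (\<lambda>n i. aug_face X 1 n (\<rho> n i)) (aug_end X)"
      "inner_kan_set (aug_cells X 0) (\<lambda>n i. aug_face X 0 n (\<rho> n i))"
    and s: "presheaf_map lessThan A B s"
    and hom: "\<And>i. i \<le> 1 \<Longrightarrow> homotopic_maps lessThan A A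
      (\<lambda>n p x. Res X n (Suc n) (coface n (\<rho> (Suc n) i)) p (s n p x)) (\<lambda>n p x. x)"
    and Lev: "\<And>n. Lev A n = Lev X n" "\<And>n. Lev B n = Lev X (Suc n)"
    and Res: "\<And>m j. 0 < j \<Longrightarrow> j \<le> Suc m \<Longrightarrow> \<exists>\<mu>\<in>inj_maps lessThan m (Suc m).
      Res A m (Suc m) \<mu> = Res X m (Suc m) (coface m (\<rho> (Suc m) j)) \<and>
      Res B m (Suc m) \<mu> = Res X (Suc m) (Suc (Suc m)) (coface (Suc m) (\<rho> (Suc (Suc m)) (Suc j)))"
  shows "\<exists>h. homotopy_degeneracy (aug_cells X 0) (\<lambda>n i. aug_face X 0 n (\<rho> n i)) (aug_cells X 1)
    (\<lambda>n i. aug_face X 1 n (\<rho> n i)) (aug_end X) (aug_deg s) h"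
proof -
  interpret path_space "aug_cells X 0" "\<lambda>n i. aug_face X 0 n (\<rho> n i)" "aug_cells X 1"
    "\<lambda>n i. aug_face X 1 n (\<rho> n i)" "aug_end X" by fact
  interpret inner_kan_set "aug_cells X 0" "\<lambda>n i. aug_face X 0 n (\<rho> n i)" by fact
  have "\<forall>i\<le>1. \<exists>H. presheaf_map lessThan (times_interval A) A H \<and>
      (\<forall>n p. \<forall>a\<in>cells (Lev A n) p.
        H n p (a, \<lambda>_\<in>{..p}. 0) = Res X n (Suc n) (coface n (\<rho> (Suc n) i)) p (s n p a)
        \<and> H n p (a, \<lambda>_\<in>{..p}. 1) = a)"
    using hom unfolding homotopic_maps_def by blast
  then obtain H where H: "\<And>i. i \<le> 1 \<Longrightarrow> presheaf_map lessThan (times_interval A) A (H i)"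
    "\<And>i n p a. i \<le> 1 \<Longrightarrow> a \<in> cells (Lev A n) p \<Longrightarrow>
        H i n p (a, \<lambda>_\<in>{..p}. 0) = Res X n (Suc n) (coface n (\<rho> (Suc n) i)) p (s n p a)"
    "\<And>i n p a. i \<le> 1 \<Longrightarrow> a \<in> cells (Lev A n) p \<Longrightarrow> H i n p (a, \<lambda>_\<in>{..p}. 1) = a"
    by metis
  have A: "simplicial_set (Lev A n)" for n unfolding Lev by (rule Lev_sset)
  have c: "(\<lambda>_\<in>{..1}. 0) \<in> mono_maps 1 0" by (rule const_mono) simp
  define h where "h i n = homotopy_path A (H i) (n - 1)" for i n
  have "homotopy_degeneracy (aug_cells X 0) (\<lambda>n i. aug_face X 0 n (\<rho> n i)) (aug_cells X 1)
    (\<lambda>n i. aug_face X 1 n (\<rho> n i)) (aug_end X) (aug_deg s) h"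
  proof
    fix x n assume x: "x \<in> aug_cells X 0 n" and n: "0 < n"
    then obtain m where m: "n = Suc m" "x \<in> points (Lev X m)" by (cases n) auto
    show "aug_deg s n x \<in> aug_cells X 0 (Suc n)"
      using s m unfolding presheaf_map_def simplicial_map_def Lev aug_deg_def by auto
    fix i :: nat assume i: "i \<le> 1"
    note hp = homotopy_path[OF A H(1)[OF i], of x m, unfolded Lev, OF m(2)]
    show "h i n x \<in> aug_cells X 1 n" unfolding h_def using hp(1) m by simp
    show "aug_end X 0 n (h i n x) = aug_face X 0 n (\<rho> n i) (aug_deg s n x)"
      unfolding h_def aug_deg_def using hp(2)[of 0] H(2)[OF i, of x m 0] m Lev by simp
    show "aug_end X 1 n (h i n x) = x"
      unfolding h_def using hp(2)[of 1] H(3)[OF i, of x m 0] m Lev by simp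
  next
    fix x n j assume x: "x \<in> aug_cells X 0 (Suc n)" and j: "0 < n" "0 < j" "j \<le> n"
    then obtain m where m: "n = Suc m" "x \<in> points (Lev X (Suc m))" by (cases n) auto
    obtain \<mu> where \<mu>: "\<mu> \<in> inj_maps lessThan m (Suc m)"
      "Res A m (Suc m) \<mu> = Res X m (Suc m) (coface m (\<rho> (Suc m) j))"
      "Res B m (Suc m) \<mu> = Res X (Suc m) (Suc (Suc m)) (coface (Suc m) (\<rho> (Suc (Suc m)) (Suc j)))"
      using Res[of j m] j m by auto
    have x': "x \<in> points (Lev A (Suc m))" using m Lev by simp
    have "s m 0 (Res A m (Suc m) \<mu> 0 x) = Res B m (Suc m) \<mu> 0 (s (Suc m) 0 x)"
      using s \<mu>(1) x' unfolding presheaf_map_def by blast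
    then show "aug_face X 0 (Suc n) (\<rho> (Suc n) (Suc j)) (aug_deg s (Suc n) x)
        = aug_deg s n (aug_face X 0 n (\<rho> n j) x)"
      unfolding \<mu>(2,3) aug_deg_def m by simp
    fix i :: nat assume i: "i \<le> 1"
    have "Res A m (Suc m) \<mu> 1 (homotopy_path A (H i) (Suc m) x)
        = homotopy_path A (H i) m (Res A m (Suc m) \<mu> 0 x)"
      by (rule homotopy_path(3)[OF A H(1)[OF i] x' \<mu>(1)])
         (unfold \<mu>(2) Lev, rule Res_act[OF coface_inj c m(2)])
    then show "aug_face X 1 n (\<rho> n j) (h i (Suc n) x) = h i n (aug_face X 0 n (\<rho> n j) x)"
      unfolding \<mu>(2) h_def m by simp
  qed
  then show ?thesis by blast
qed

lemma initial_instance: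
  assumes X: "inner_Kan_space X" and s: "initial_degeneracies X s"
  shows "\<exists>h. homotopy_degeneracy (aug_cells X 0) (aug_face X 0) (aug_cells X 1) (aug_face X 1)
    (aug_end X) (aug_deg s) h"
proof (rule degeneracy_instance[where \<rho> = "\<lambda>n i. i"])
  show "path_space (aug_cells X 0) (aug_face X 0) (aug_cells X 1) (aug_face X 1) (aug_end X)"
    by (rule path_space_aug)
  show "inner_kan_set (aug_cells X 0) (aug_face X 0)" by (rule inner_kan_aug[OF X])
  show "presheaf_map lessThan (slice_under X 0) (slice_under X 1) s"
    using s unfolding initial_degeneracies_def by blast
  fix i :: nat assume i: "i \<le> 1"
  have "under_restriction X 0 1 (coface 0 i) n = Res X n (Suc n) (coface n i)" for n
    using join_coface(3)[OF i, of n] by (simp add: under_restriction_def)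
  moreover have "homotopic_maps lessThan (slice_under X 0) (slice_under X 0)
      (\<lambda>n p x. under_restriction X 0 1 (coface 0 i) n p (s n p x)) (\<lambda>n p x. x)"
    using s i unfolding initial_degeneracies_def by blast
  ultimately show "homotopic_maps lessThan (slice_under X 0) (slice_under X 0)
      (\<lambda>n p x. Res X n (Suc n) (coface n i) p (s n p x)) (\<lambda>n p x. x)" by simp
next
  fix m j :: nat assume "0 < j"
  then obtain j' where "j = Suc j'" by (cases j) auto
  then show "\<exists>\<mu>\<in>inj_maps lessThan m (Suc m).
      Res (slice_under X 0) m (Suc m) \<mu> = Res X m (Suc m) (coface m j) \<and>
      Res (slice_under X 1) m (Suc m) \<mu> = Res X (Suc m) (Suc (Suc m)) (coface (Suc m) (Suc j))"
    using join_coface(1,2)[of m j'] by (intro bexI[OF _ lcoface_inj[of m j']]) (simp add: slice_under_def)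
qed (simp_all add: slice_under_def)

lemma terminal_instance:
  assumes X: "inner_Kan_space X" and s: "terminal_degeneracies X s"
  shows "\<exists>h. homotopy_degeneracy (aug_cells X 0) (rev_face (aug_face X 0)) (aug_cells X 1)
    (rev_face (aug_face X 1)) (aug_end X) (aug_deg s) h"
proof -
  have rev: "rev_face d = (\<lambda>n i. d n (n - i))" for d :: "nat \<Rightarrow> nat \<Rightarrow> 'a \<Rightarrow> 'a"
    by (simp add: rev_face_def fun_eq_iff)
  show ?thesis
    unfolding rev
  proof (rule degeneracy_instance[where \<rho> = "\<lambda>n i. n - i"])
    show "path_space (aug_cells X 0) (\<lambda>n i. aug_face X 0 n (n - i)) (aug_cells X 1)
        (\<lambda>n i. aug_face X 1 n (n - i)) (aug_end X)"
      using path_space_rev[OF path_space_aug] unfolding rev .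
    show "inner_kan_set (aug_cells X 0) (\<lambda>n i. aug_face X 0 n (n - i))"
      using inner_kan_set_rev[OF inner_kan_aug[OF X]] unfolding rev .
    show "presheaf_map lessThan (slice_over X 0) (slice_over X 1) s"
      using s unfolding terminal_degeneracies_def by blast
    fix i :: nat assume i: "i \<le> 1"
    \<comment> \<open>Reversal exchanges the two ends of the adjoined edge, so the homotopy of index
      \<open>1 - i\<close> takes the place of the one of index \<open>i\<close>.\<close>
    have "over_restriction X 0 1 (coface 0 (1 - i)) n = Res X n (Suc n) (coface n (Suc n - i))" for n
      using join_coface(6)[of "1 - i" n] i by (simp add: over_restriction_def)
    moreover have "homotopic_maps lessThan (slice_over X 0) (slice_over X 0)
        (\<lambda>n p x. over_restriction X 0 1 (coface 0 (1 - i)) n p (s n p x)) (\<lambda>n p x. x)"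
      using s unfolding terminal_degeneracies_def by simp
    ultimately show "homotopic_maps lessThan (slice_over X 0) (slice_over X 0)
        (\<lambda>n p x. Res X n (Suc n) (coface n (Suc n - i)) p (s n p x)) (\<lambda>n p x. x)" by simp
  next
    fix m j :: nat assume "0 < j" "j \<le> Suc m"
    then have "Suc m - j \<le> m" by simp
    from join_coface(4,5)[OF this]
    show "\<exists>\<mu>\<in>inj_maps lessThan m (Suc m).
        Res (slice_over X 0) m (Suc m) \<mu> = Res X m (Suc m) (coface m (Suc m - j)) \<and>
        Res (slice_over X 1) m (Suc m) \<mu> = Res X (Suc m) (Suc (Suc m)) (coface (Suc m) (Suc (Suc m) - Suc j))"
      by (intro bexI[OF _ lcoface_inj[of m "Suc m - j"]]) (simp add: slice_over_def)
  qed (simp_all add: slice_over_def)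
qed

end

section \<open>Degenerate edges are idempotent equivalences\<close>

context ss_space
begin

text \<open>Every simplex of the horn factors through a facet other than face \<open>i\<close>, so
  agreement on these facets makes the map given by \<open>v\<close> restrict to \<open>u\<close>
  exactly.\<close>

lemma horn_extends_by_filler:
  assumes i: "i \<le> Suc n"
    and u: "u \<in> points (mapping_space (ss_horn (Suc n) i) X)" and v: "v \<in> points (Lev X (Suc n))"
    and faces: "\<And>j. j \<le> Suc n \<Longrightarrow> j \<noteq> i \<Longrightarrow> Res X n (Suc n) (coface n j) 0 v = u n (coface n j)"
    and conn: "same_component (mapping_space (ss_horn (Suc n) i) X) u u'"
  shows "horn_extends X (Suc n) i u'"
proof -
  define w where "w m = (\<lambda>\<mu>\<in>ss_simplex (Suc n) m. Res X m (Suc n) \<mu> 0 v)" for m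
  have "w \<in> points (mapping_space (ss_simplex (Suc n)) X)"
    by (rule mapping_spaceI)
       (use Res_closed v compose_inj Res_compose in \<open>auto simp: w_def ss_simplex_def\<close>)
  moreover have "restrict_family (ss_horn (Suc n) i) w = u"
  proof (intro ext)
    fix m \<mu>
    show "restrict_family (ss_horn (Suc n) i) w m \<mu> = u m \<mu>"
    proof (cases "\<mu> \<in> ss_horn (Suc n) i m")
      case True
      then obtain j where j: "\<mu> \<in> inj_maps atMost m (Suc n)" "j \<le> Suc n" "j \<notin> \<mu> ` {..m}" "j \<noteq> i"
        unfolding ss_horn_def by blast
      note sq = squash[OF j(1-3)]
      have "Res X m (Suc n) \<mu> 0 v = Res X m n (squash m j \<mu>) 0 (u n (coface n j))"
        using Res_compose[OF sq(1) coface_inj v, of j] sq(2) faces[OF j(2,4)] by simp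
      also have "\<dots> = u m \<mu>"
        using mapping_spaceD(3)[OF u sq(1) coface_horn[OF j(2,4)]] sq(2) by simp
      finally show ?thesis using True j(1) by (simp add: restrict_family_def w_def ss_simplex_def)
    next
      case False
      then show ?thesis using mapping_spaceD(2)[OF u False] by (simp add: restrict_family_def)
    qed
  qed
  ultimately show ?thesis unfolding horn_extends_def using conn by auto
qed

lemma fam_to_map_coface:
  assumes "j \<le> Suc n" "{..Suc n} - {j} \<in> K"
  shows "fam_to_map (Suc n) K V n (coface n j) = V ({..Suc n} - {j})"
  using assms coface_inj[of n j] unfolding fam_to_map_def ss_of_def by (simp add: coface_image)

lemma facet_horn_complex: "j \<le> N \<Longrightarrow> j \<noteq> i \<Longrightarrow> {..N} - {j} \<in> horn_complex N i"
  unfolding horn_complex_def by auto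

lemma edge_image: "(\<lambda>j\<in>{..1}. a + j) ` {..1} = {a, Suc a :: nat}"
  by (auto simp: le_Suc_eq image_iff)

lemma left_horn_extends:
  assumes X: "inner_Kan_space X" and s: "initial_degeneracies X s" and N: "2 \<le> N"
    and x: "x \<in> points (Lev X 0)" and u: "u \<in> points (mapping_space (ss_horn N 0) X)"
    and conn: "same_component (Lev X 1) (u 1 (\<lambda>j\<in>{..1}. j)) (s 0 0 x)"
  shows "horn_extends X N 0 u"
proof -
  obtain h where "homotopy_degeneracy (aug_cells X 0) (aug_face X 0) (aug_cells X 1) (aug_face X 1)
    (aug_end X) (aug_deg s) h" using initial_instance[OF X s] by blast
  then interpret homotopy_degeneracy "aug_cells X 0" "aug_face X 0" "aug_cells X 1" "aug_face X 1"
    "aug_end X" "aug_deg s" h .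
  obtain n where n: "N = Suc n" using N by (cases N) auto
  let ?L = "horn_complex N 0"
  have L: "fin_complex ?L" using fin_complex_horn N by simp
  define U where "U = map_to_fam ?L u"
  have U: "U \<in> fam (aug_cells X 0) (aug_face X 0) ?L"
    unfolding U_def by (rule map_to_fam_closed[OF u[unfolded ss_horn_eq] L horn_complex_subset])
  have edge: "(\<lambda>j\<in>{..1}. j) ` {..1} = {0, 1 :: nat}" using edge_image[of 0] by simp
  have "U ((\<lambda>j\<in>{..1}. j) ` {..1}) = u 1 (\<lambda>j\<in>{..1}. j)"
    unfolding U_def
  proof (rule map_to_fam_image)
    show "(\<lambda>j\<in>{..1}. j) \<in> inj_maps atMost 1 N" by (rule inj_mapsI) (use N in auto)
    show "(\<lambda>j\<in>{..1}. j) ` {..1} \<in> ?L"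
      unfolding edge horn_complex_def using N by (auto intro!: exI[of _ 2])
  qed
  then have U01: "U {0, 1} = u 1 (\<lambda>j\<in>{..1}. j)" unfolding edge .
  have pc: "pt_conn 2 (U {0, 1}) (aug_deg s 1 x)"
    using conn pt_path_component[of 1] unfolding U01 aug_deg_def by (simp add: numeral_2_eq_2)
  obtain V v where V: "V \<in> fam (aug_cells X 0) (aug_face X 0) ?L" "fam_conn ?L U V"
    and v: "v \<in> aug_cells X 0 (Suc N)" "\<And>j. 1 \<le> j \<Longrightarrow> j \<le> N \<Longrightarrow> aug_face X 0 N j v = V ({..N} - {j})"
    using outer_horn[OF N U _ pc] x by auto
  have "same_component (mapping_space (ss_of N ?L) X) (fam_to_map N ?L U) (fam_to_map N ?L V)"
    by (rule fam_conn_component[OF L V(2)])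
  then have c: "same_component (mapping_space (ss_horn N 0) X) (fam_to_map N ?L V) u"
    unfolding U_def fam_to_map_to_fam[OF u[unfolded ss_horn_eq]] ss_horn_eq same_component_def
    by (rule equivclp_sym)
  show ?thesis
    unfolding n
  proof (rule horn_extends_by_filler)
    show "fam_to_map N ?L V \<in> points (mapping_space (ss_horn (Suc n) 0) X)"
      using fam_to_map_cell[OF V(1) L, of N] unfolding ss_horn_eq n .
    show "v \<in> points (Lev X (Suc n))" using v(1) n by simp
    show "Res X n (Suc n) (coface n j) 0 v = fam_to_map N ?L V n (coface n j)" if "j \<le> Suc n" "j \<noteq> 0" for j
      using v(2)[of j] fam_to_map_coface[of j n ?L V] facet_horn_complex[of j N 0] that n by simp
  qed (use c n in simp_all)
qed

text \<open>This is \<open>outer_horn\<close> for the opposite object: the family of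
  \<open>u\<close> is reversed, which turns the edge \<open>{N - 1, N}\<close> into
  \<open>{0, 1}\<close>, and the resulting family and connecting zigzag are reversed back.\<close>

lemma right_horn_extends:
  assumes X: "inner_Kan_space X" and s: "terminal_degeneracies X s" and N: "2 \<le> N"
    and x: "x \<in> points (Lev X 0)" and u: "u \<in> points (mapping_space (ss_horn N N) X)"
    and conn: "same_component (Lev X 1) (u 1 (\<lambda>j\<in>{..1}. N - 1 + j)) (s 0 0 x)"
  shows "horn_extends X N N u"
proof -
  obtain h where "homotopy_degeneracy (aug_cells X 0) (rev_face (aug_face X 0)) (aug_cells X 1)
    (rev_face (aug_face X 1)) (aug_end X) (aug_deg s) h" using terminal_instance[OF X s] by blast
  then interpret homotopy_degeneracy "aug_cells X 0" "rev_face (aug_face X 0)" "aug_cells X 1"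
    "rev_face (aug_face X 1)" "aug_end X" "aug_deg s" h .
  obtain n where n: "N = Suc n" using N by (cases N) auto
  let ?L = "horn_complex N 0" and ?R = "horn_complex N N"
  have L: "fin_complex ?L" and R: "fin_complex ?R" using fin_complex_horn N by simp_all
  have LR: "rev_set N S \<in> ?R" if "S \<in> ?L" for S using horn_complex_rev[OF _ that] by simp
  have RL: "rev_set N S \<in> ?L" if "S \<in> ?R" for S using horn_complex_rev[OF _ that] by simp
  define U0 where "U0 = map_to_fam ?R u"
  define U where "U = (\<lambda>S\<in>?L. U0 (rev_set N S))"
  have U0: "U0 \<in> fam (aug_cells X 0) (aug_face X 0) ?R"
    unfolding U0_def by (rule map_to_fam_closed[OF u[unfolded ss_horn_eq] R horn_complex_subset])
  have U: "U \<in> fam (aug_cells X 0) (rev_face (aug_face X 0)) ?L"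
    unfolding U_def by (rule fam_rev[OF U0 L horn_complex_subset LR]) (simp_all add: rev_face_def)
  have edge: "(\<lambda>j\<in>{..1}. N - 1 + j) ` {..1} = {n, N}" using edge_image[of "N - 1"] n by simp
  have "U0 ((\<lambda>j\<in>{..1}. N - 1 + j) ` {..1}) = u 1 (\<lambda>j\<in>{..1}. N - 1 + j)"
    unfolding U0_def
  proof (rule map_to_fam_image)
    show "(\<lambda>j\<in>{..1}. N - 1 + j) \<in> inj_maps atMost 1 N" by (rule inj_mapsI) (use N in auto)
    show "(\<lambda>j\<in>{..1}. N - 1 + j) ` {..1} \<in> ?R"
      unfolding edge horn_complex_def using N n by (auto intro!: exI[of _ 0])
  qed
  moreover have "rev_set N {0, 1} = {n, N}" using n by (auto simp: rev_set_def)
  moreover have "{0, 1} \<in> ?L" unfolding horn_complex_def using N by (auto intro!: exI[of _ 2])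
  ultimately have U01: "U {0, 1} = u 1 (\<lambda>j\<in>{..1}. N - 1 + j)" unfolding edge U_def by simp
  have pc: "pt_conn 2 (U {0, 1}) (aug_deg s 1 x)"
    using conn pt_path_component[of 1] unfolding U01 aug_deg_def by (simp add: numeral_2_eq_2)
  obtain V v where V: "V \<in> fam (aug_cells X 0) (rev_face (aug_face X 0)) ?L" "fam_conn ?L U V"
    and v: "v \<in> aug_cells X 0 (Suc N)"
    "\<And>j. 1 \<le> j \<Longrightarrow> j \<le> N \<Longrightarrow> rev_face (aug_face X 0) N j v = V ({..N} - {j})"
    using outer_horn[OF N U _ pc] x by auto
  define V0 where "V0 = (\<lambda>S\<in>?R. V (rev_set N S))"
  have V0: "V0 \<in> fam (aug_cells X 0) (aug_face X 0) ?R"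
    unfolding V0_def by (rule fam_rev[OF V(1) R horn_complex_subset RL]) (simp_all add: rev_face_def)
  have "equivclp (path_space.fam_path (aug_cells X 1) (aug_face X 1) (aug_end X) ?R)
      (\<lambda>S\<in>?R. U (rev_set N S)) (\<lambda>S\<in>?R. V (rev_set N S))"
    by (rule fam_conn_rev[OF path_space_aug path_space_rev[OF path_space_aug] V(2) R horn_complex_subset RL])
  moreover have "(\<lambda>S\<in>?R. U (rev_set N S)) = U0"
  proof
    fix S show "(\<lambda>S\<in>?R. U (rev_set N S)) S = U0 S"
      using RL[of S] rev_set(2)[of S N] horn_complex_subset[of N N] sliceD(1)[OF U0]
      by (cases "S \<in> ?R") (auto simp: U_def extensional_def)
  qed
  ultimately have "same_component (mapping_space (ss_of N ?R) X) (fam_to_map N ?R U0) (fam_to_map N ?R V0)"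
    using fam_conn_component[OF R, of U0 V0 N] unfolding V0_def by simp
  then have c: "same_component (mapping_space (ss_horn N N) X) (fam_to_map N ?R V0) u"
    unfolding U0_def fam_to_map_to_fam[OF u[unfolded ss_horn_eq]] ss_horn_eq same_component_def
    by (rule equivclp_sym)
  have "Res X n (Suc n) (coface n j) 0 v = fam_to_map N ?R V0 n (coface n j)" if j: "j \<le> Suc n" "j \<noteq> N" for j
  proof -
    have R: "{..N} - {j} \<in> ?R" using facet_horn_complex j n by simp
    have "rev_set N ({..N} - {j}) = {..N} - {N - j}"
    proof -
      have "rev_set N {..N} = {..N}" using rev_set(1,4)[of "{..N}" N] by auto
      then show ?thesis using rev_set(5)[of "{..N}" N j] j n by simp
    qed
    then have "V0 ({..N} - {j}) = V ({..N} - {N - j})" using R unfolding V0_def by simp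
    also have "\<dots> = rev_face (aug_face X 0) N (N - j) v" using v(2)[of "N - j"] j n by simp
    also have "\<dots> = Res X n (Suc n) (coface n j) 0 v" using j n unfolding rev_face_def by simp
    finally show ?thesis using fam_to_map_coface[of j n ?R V0] R j n by simp
  qed
  then show ?thesis
    using horn_extends_by_filler[of N n "fam_to_map N ?R V0" v u] fam_to_map_cell[OF V0 R, of N] v(1) c
    unfolding ss_horn_eq n by simp
qed

lemma degeneracy_idempotent_at:
  assumes X: "inner_Kan_space X" and s: "initial_degeneracies X s" and x: "x \<in> points (Lev X 0)"
  shows "idempotent_at X x (s 0 0 x)"
proof -
  obtain h where "homotopy_degeneracy (aug_cells X 0) (aug_face X 0) (aug_cells X 1) (aug_face X 1)
    (aug_end X) (aug_deg s) h" using initial_instance[OF X s] by blast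
  then interpret homotopy_degeneracy "aug_cells X 0" "aug_face X 0" "aug_cells X 1" "aug_face X 1"
    "aug_end X" "aug_deg s" h .
  have x1: "x \<in> aug_cells X 0 1" using x by simp
  have conn1: "pt_conn 1 a b \<longleftrightarrow> same_component (Lev X 0) a b" for a b
    using pt_path_component[of 0] by simp
  have conn2: "pt_conn 2 a b \<longleftrightarrow> same_component (Lev X 1) a b" for a b
    using pt_path_component[of 1] by (simp add: numeral_2_eq_2)
  have face: "face X 0 i = aug_face X 0 1 i" "face X 1 i = aug_face X 0 2 i" for i
    by (simp_all add: face_def numeral_2_eq_2)
  have sx: "aug_deg s 1 x = s 0 0 x" by (simp add: aug_deg_def)
  have "pt_path 1 (aug_face X 0 1 i (s 0 0 x)) x" if "i \<le> 1" for i
    unfolding pt_path_def using h_closed[OF that x1] h_bd0[OF that x1] h_bd1[OF that x1] sx by auto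
  \<comment> \<open>The homotopies from \<open>d i s\<close> to the identity, evaluated at the
    vertex \<open>x\<close>, connect both ends of the edge with \<open>x\<close>.\<close>
  then have ends: "same_component (Lev X 0) (face X 0 i (s 0 0 x)) x" if "i \<le> 1" for i
    unfolding face conn1[symmetric] using that by (blast intro: r_into_equivclp)
  have "same_component (Lev X 0) (face X 0 0 (s 0 0 x)) (face X 0 1 (s 0 0 x))"
    using ends[of 0] ends[of 1] unfolding same_component_def
    by (auto intro: equivclp_trans equivclp_sym)
  moreover obtain H where "H \<in> aug_cells X 0 3"
    "\<And>i. i \<le> 2 \<Longrightarrow> pt_conn 2 (aug_face X 0 2 i H) (aug_deg s 1 x)"
    using degenerate_edge_idempotent[OF x1] by blast
  moreover from this(1) have "H \<in> points (Lev X 2)" by (simp add: numeral_3_eq_3 numeral_2_eq_2)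
  moreover have "s 0 0 x \<in> points (Lev X 1)"
    using s0_closed[OF x1] sx by (simp add: numeral_2_eq_2)
  ultimately show ?thesis
    unfolding idempotent_at_def idempotent_edge_def using ends[of 0] ends[of 1]
    unfolding face conn2 sx by auto
qed

text \<open>Left horns are filled by means of \<open>s\<^sub>0\<close>, right horns by means of
  \<open>s\<^sub>\<omega>\<close>; that both edges at \<open>x\<close> lie in one component makes
  the second case a statement about \<open>s\<^sub>0\<close> as well.\<close>

lemma degeneracy_equivalence_edge:
  assumes X: "inner_Kan_space X" and s: "admits_degeneracies X s\<^sub>0 s\<^sub>\<omega>" and x: "x \<in> points (Lev X 0)"
  shows "equivalence_edge X (s\<^sub>0 0 0 x)"
proof -
  have s0: "initial_degeneracies X s\<^sub>0" and s\<omega>: "terminal_degeneracies X s\<^sub>\<omega>"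
    and conn: "same_component (Lev X 1) (s\<^sub>0 0 0 x) (s\<^sub>\<omega> 0 0 x)"
    using s x unfolding admits_degeneracies_def by blast+
  have "s\<^sub>0 0 0 x \<in> points (Lev X 1)"
    using degeneracy_idempotent_at[OF X s0 x] unfolding idempotent_at_def idempotent_edge_def by blast
  moreover have "horn_extends X n n u"
    if "2 \<le> n" "u \<in> points (mapping_space (ss_horn n n) X)"
      "same_component (Lev X 1) (u 1 (\<lambda>j\<in>{..1}. n - 1 + j)) (s\<^sub>0 0 0 x)" for n u
  proof (rule right_horn_extends[OF X s\<omega> that(1) x that(2)])
    show "same_component (Lev X 1) (u 1 (\<lambda>j\<in>{..1}. n - 1 + j)) (s\<^sub>\<omega> 0 0 x)"
      using that(3) conn unfolding same_component_def by (rule equivclp_trans)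
  qed
  ultimately show ?thesis
    unfolding equivalence_edge_def using left_horn_extends[OF X s0 _ x] by blast
qed

end

theorem theorem1p2:
  fixes X :: "'a diagram" and s\<^sub>0 s\<^sub>\<omega> :: "nat \<Rightarrow> nat \<Rightarrow> 'a \<Rightarrow> 'a"
  assumes "inner_Kan_space X"
    and "admits_degeneracies X s\<^sub>0 s\<^sub>\<omega>"
  shows "(\<forall>x\<in>points (Lev X 0). idempotent_equivalence_at X x (s\<^sub>0 0 0 x)) \<and> quasi_unital X"
proof -
  interpret ss_space X using assms(1) unfolding inner_Kan_space_def ss_space_def by blast
  have "initial_degeneracies X s\<^sub>0" using assms(2) unfolding admits_degeneracies_def by blast
  then have "idempotent_equivalence_at X x (s\<^sub>0 0 0 x)" if "x \<in> points (Lev X 0)" for x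
    unfolding idempotent_equivalence_at_def
    using degeneracy_idempotent_at[OF assms(1)] degeneracy_equivalence_edge[OF assms] that by blast
  then show ?thesis unfolding quasi_unital_def using assms(1) by blast
qed

end
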